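(* Let $G$ be a finite abelian group with character group $\widehat G$, let $n\geqslant 2$, and let $$w=\sum_{1\leqslant i<j\leqslant n}\mathsf a_{ij}(ij)+\sum_{g\in G^n}\mathsf c_g\,g\in\mathbb R[G\wr\mathfrak S_n],\qquad \mathsf a_{ij}\geqslant 0,\quad \mathsf c_g=\mathsf c_{g^{-1}}\geqslant 0 .$$ Then $$\psi_{G\wr\mathfrak S_n}(w)=\min\Bigl\{\psi_{G\wr\mathfrak S_n}(w,\mathrm{Std}_n),\ \min_{\kappa}\psi_{G\wr\mathfrak S_n}(w,V_\kappa)\Bigr\},$$ where the inner minimum is over all families $\kappa=(\kappa_\chi)_{\chi\in\widehat G}$ of non-negative integers with $\sum_{\chi\in\widehat G}\kappa_\chi=n$ such that $V_\kappa$ is not the trivial representation.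
   Context: $G\wr\mathfrak S_n=G^n\rtimes\mathfrak S_n$ with multiplication $(g;\pi)(h;\sigma)=(g(\pi\cdot h);\pi\sigma)$, $\pi\cdot g=(g_{\pi^{-1}(1)},\dots,g_{\pi^{-1}(n)})$; $G^n$ and $\mathfrak S_n$ are regarded as subgroups, and $(ij)$ is the transposition. All representations are finite-dimensional, complex and unitary. For a finite group $H$ and $w=\sum_h\mathsf c_h h\in\mathbb R[H]$ with $\mathsf c_h=\mathsf c_{h^{-1}}\geqslant 0$, put $\Delta_H(w)=\sum_h\mathsf c_h(1_H-h)$. For a representation $V$ of $H$, $\psi_H(w,V)$ is the smallest eigenvalue of $\Delta_H(w)$ on $(V^H)^\perp$, where $V^H$ is the fixed subspace, with $\psi_H(w,V)=+\infty$ if $V=V^H$. Put $\psi_H(w)=\psi_H(w,\mathrm{Reg}_H)$, with $\mathrm{Reg}_H$ the regular representation. A minimum over an empty set is $+\infty$. $\mathrm{Std}_n$ is the irreducible $\mathfrak S_n$-representation of shape $(n-1,1)$, lifted to $G\wr\mathfrak S_n$ via the quotient map to $\mathfrak S_n$. For a multiplicity vector $\kappa=(\kappa_\chi)_{\chi\in\widehat G}$, that is, a family of non-negative integers indexed by the character group $\widehat G$ of the finite abelian group $G$ with $\sum_{\chi\in\widehat G}\kappa_\chi=n$, $V_\kappa$ is the irreducible representation of $G\wr\mathfrak S_n$ indexed by the multipartition whose $\chi$-component is the one-row partition $(\kappa_\chi)$, that is, $$V_\kappa=\mathrm{Ind}_{\prod_\chi(G\wr\mathfrak S_{\kappa_\chi})}^{G\wr\mathfrak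 S_n}\Bigl(\boxtimes_{\chi}\chi^{\otimes\kappa_\chi}\Bigr),$$ where on $\chi^{\otimes m}$ the base group $G^m$ acts by $(g_1,\dots,g_m)\mapsto\prod_i\chi(g_i)$ and $\mathfrak S_m$ acts trivially. The trivial representation is the case $\kappa_{\mathrm{triv}}=n$. *)

theory Defs
  imports Complex_Main "HOL-Library.Extended_Real" "HOL-Algebra.Sym_Groups" "HOL-Algebra.Product_Groups"
    "HOL-Algebra.Multiplicative_Group"
begin

section \<open>Finite-dimensional unitary representations\<close>

text \<open>
  A representation acts on a subspace of the functions \<open>'b \<Rightarrow> complex\<close> that vanish outside a finite
  index set, with the standard Hermitian inner product on that index set.
  Every finite-dimensional unitary representation is isomorphic to one of this form.
\<close>

record ('h, 'b) rep =
  rep_index :: "'b set"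
  rep_space :: "('b \<Rightarrow> complex) set"
  rep_act   :: "'h \<Rightarrow> ('b \<Rightarrow> complex) \<Rightarrow> 'b \<Rightarrow> complex"

definition rep_inner :: "('h, 'b) rep \<Rightarrow> ('b \<Rightarrow> complex) \<Rightarrow> ('b \<Rightarrow> complex) \<Rightarrow> complex" where
  "rep_inner R u v = (\<Sum>b\<in>rep_index R. u b * cnj (v b))"

locale unitary_rep =
  fixes H :: "('h, 'm) monoid_scheme" and R :: "('h, 'b) rep"
  assumes finite_index: "finite (rep_index R)"
    and support: "v \<in> rep_space R \<Longrightarrow> b \<notin> rep_index R \<Longrightarrow> v b = 0"
    and zero_closed: "(\<lambda>b. 0) \<in> rep_space R"
    and add_closed: "u \<in> rep_space R \<Longrightarrow> v \<in> rep_space R \<Longrightarrow> (\<lambda>b. u b + v b) \<in> rep_space R"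
    and scale_closed: "v \<in> rep_space R \<Longrightarrow> (\<lambda>b. z * v b) \<in> rep_space R"
    and act_closed: "h \<in> carrier H \<Longrightarrow> v \<in> rep_space R \<Longrightarrow> rep_act R h v \<in> rep_space R"
    and act_add: "h \<in> carrier H \<Longrightarrow> u \<in> rep_space R \<Longrightarrow> v \<in> rep_space R \<Longrightarrow>
          rep_act R h (\<lambda>b. u b + v b) = (\<lambda>b. rep_act R h u b + rep_act R h v b)"
    and act_scale: "h \<in> carrier H \<Longrightarrow> v \<in> rep_space R \<Longrightarrow>
          rep_act R h (\<lambda>b. z * v b) = (\<lambda>b. z * rep_act R h v b)"
    and act_one: "v \<in> rep_space R \<Longrightarrow> rep_act R \<one>\<^bsub>H\<^esub> v = v"
    and act_mult: "h \<in> carrier H \<Longrightarrow> k \<in> carrier H \<Longrightarrow> v \<in> rep_space R \<Longrightarrow>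
          rep_act R (h \<otimes>\<^bsub>H\<^esub> k) v = rep_act R h (rep_act R k v)"
    and act_unitary: "h \<in> carrier H \<Longrightarrow> u \<in> rep_space R \<Longrightarrow> v \<in> rep_space R \<Longrightarrow>
          rep_inner R (rep_act R h u) (rep_act R h v) = rep_inner R u v"

definition regular_rep :: "('h, 'm) monoid_scheme \<Rightarrow> ('h, 'h) rep" where
  "regular_rep H = \<lparr>
     rep_index = carrier H,
     rep_space = {f. \<forall>x. x \<notin> carrier H \<longrightarrow> f x = 0},
     rep_act = (\<lambda>h f x. if x \<in> carrier H then f (inv\<^bsub>H\<^esub> h \<otimes>\<^bsub>H\<^esub> x) else 0)\<rparr>"

text \<open>The one-dimensional representation afforded by a linear character.\<close>

definition linear_rep :: "('h \<Rightarrow> complex) \<Rightarrow> ('h, unit) rep" where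
  "linear_rep f = \<lparr>rep_index = UNIV, rep_space = UNIV, rep_act = (\<lambda>h v b. f h * v b)\<rparr>"

definition lift_rep :: "('h \<Rightarrow> 'k) \<Rightarrow> ('k, 'b) rep \<Rightarrow> ('h, 'b) rep" where
  "lift_rep p R = \<lparr>rep_index = rep_index R, rep_space = rep_space R,
     rep_act = (\<lambda>h. rep_act R (p h))\<rparr>"

text \<open>
  \<open>Ind\<^sub>K\<^sup>H R\<close>, realised on the functions \<open>F\<close> from \<open>H\<close> to \<open>R\<close> with \<open>F (h k) = k\<inverse> (F h)\<close> for \<open>k \<in> K\<close>,
  where \<open>x \<in> H\<close> acts by \<open>(x F) h = F (x\<inverse> h)\<close>. The functions are uncurried.
\<close>

definition induced_rep ::
  "('h, 'm) monoid_scheme \<Rightarrow> 'h set \<Rightarrow> ('h, 'b) rep \<Rightarrow> ('h, 'h \<times> 'b) rep" where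
  "induced_rep H K R = \<lparr>
     rep_index = carrier H \<times> rep_index R,
     rep_space = {F. (\<forall>h b. h \<notin> carrier H \<longrightarrow> F (h, b) = 0) \<and>
                     (\<forall>h\<in>carrier H. (\<lambda>b. F (h, b)) \<in> rep_space R) \<and>
                     (\<forall>h\<in>carrier H. \<forall>k\<in>K.
                        (\<lambda>b. F (h \<otimes>\<^bsub>H\<^esub> k, b)) = rep_act R (inv\<^bsub>H\<^esub> k) (\<lambda>b. F (h, b)))},
     rep_act = (\<lambda>x F (h, b). if h \<in> carrier H then F (inv\<^bsub>H\<^esub> x \<otimes>\<^bsub>H\<^esub> h, b) else 0)\<rparr>"

definition trivial_rep :: "('h, 'm) monoid_scheme \<Rightarrow> ('h, 'b) rep \<Rightarrow> bool" where
  "trivial_rep H R \<longleftrightarrow>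
     (\<exists>v. v \<noteq> (\<lambda>b. 0) \<and> rep_space R = {u. \<exists>z. u = (\<lambda>b. z * v b)}) \<and>
     (\<forall>h\<in>carrier H. \<forall>v\<in>rep_space R. rep_act R h v = v)"


section \<open>Laplacians and spectral gaps\<close>

text \<open>Elements of the real group algebra are coefficient functions; only values on the carrier matter.\<close>

definition galg_unit :: "'h \<Rightarrow> 'h \<Rightarrow> real" where
  "galg_unit h = (\<lambda>x. if x = h then 1 else 0)"

definition galg_act ::
  "('h, 'm) monoid_scheme \<Rightarrow> ('h, 'b) rep \<Rightarrow> ('h \<Rightarrow> real) \<Rightarrow> ('b \<Rightarrow> complex) \<Rightarrow> 'b \<Rightarrow> complex" where
  "galg_act H R w v = (\<lambda>b. \<Sum>h\<in>carrier H. complex_of_real (w h) * rep_act R h v b)"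

definition laplacian :: "('h, 'm) monoid_scheme \<Rightarrow> ('h \<Rightarrow> real) \<Rightarrow> 'h \<Rightarrow> real" where
  "laplacian H w = (\<lambda>x. \<Sum>h\<in>carrier H. w h * (galg_unit \<one>\<^bsub>H\<^esub> x - galg_unit h x))"

definition fixed_space :: "('h, 'm) monoid_scheme \<Rightarrow> ('h, 'b) rep \<Rightarrow> ('b \<Rightarrow> complex) set" where
  "fixed_space H R = {v \<in> rep_space R. \<forall>h\<in>carrier H. rep_act R h v = v}"

definition fixed_perp :: "('h, 'm) monoid_scheme \<Rightarrow> ('h, 'b) rep \<Rightarrow> ('b \<Rightarrow> complex) set" where
  "fixed_perp H R = {v \<in> rep_space R. \<forall>u\<in>fixed_space H R. rep_inner R v u = 0}"

text \<open>
  Only real eigenvalues are collected: for symmetric \<open>w\<close> the Laplacian acts as a self-adjoint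
  operator on a unitary representation.
\<close>

definition laplacian_eigenvalues ::
  "('h, 'm) monoid_scheme \<Rightarrow> ('h \<Rightarrow> real) \<Rightarrow> ('h, 'b) rep \<Rightarrow> real set" where
  "laplacian_eigenvalues H w R = {e. \<exists>v\<in>fixed_perp H R. v \<noteq> (\<lambda>b. 0) \<and>
     galg_act H R (laplacian H w) v = (\<lambda>b. complex_of_real e * v b)}"

definition psi :: "('h, 'm) monoid_scheme \<Rightarrow> ('h \<Rightarrow> real) \<Rightarrow> ('h, 'b) rep \<Rightarrow> ereal" where
  "psi H w R = (if fixed_space H R = rep_space R then \<infinity>
                else ereal (Min (laplacian_eigenvalues H w R)))"

definition psi_group :: "('h, 'm) monoid_scheme \<Rightarrow> ('h \<Rightarrow> real) \<Rightarrow> ereal" where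
  "psi_group H w = psi H w (regular_rep H)"


section \<open>The wreath product with the symmetric group\<close>

type_synonym 'a wr = "(nat \<Rightarrow> 'a) \<times> (nat \<Rightarrow> nat)"

abbreviation base_group :: "('a, 'm) monoid_scheme \<Rightarrow> nat \<Rightarrow> (nat \<Rightarrow> 'a) monoid" where
  "base_group G n \<equiv> product_group {1..n} (\<lambda>_. G)"

definition perm_act :: "nat \<Rightarrow> (nat \<Rightarrow> nat) \<Rightarrow> (nat \<Rightarrow> 'a) \<Rightarrow> nat \<Rightarrow> 'a" where
  "perm_act n \<pi> g = (\<lambda>i\<in>{1..n}. g (inv' \<pi> i))"

definition wreath :: "('a, 'm) monoid_scheme \<Rightarrow> nat \<Rightarrow> 'a wr monoid" where
  "wreath G n = \<lparr>
     carrier = carrier (base_group G n) \<times> carrier (sym_group n),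
     mult = (\<lambda>(g, \<pi>) (h, \<sigma>). (g \<otimes>\<^bsub>base_group G n\<^esub> perm_act n \<pi> h, \<pi> \<otimes>\<^bsub>sym_group n\<^esub> \<sigma>)),
     one = (\<one>\<^bsub>base_group G n\<^esub>, \<one>\<^bsub>sym_group n\<^esub>)\<rparr>"

definition base_emb :: "nat \<Rightarrow> (nat \<Rightarrow> 'a) \<Rightarrow> 'a wr" where
  "base_emb n g = (g, \<one>\<^bsub>sym_group n\<^esub>)"

definition sym_emb :: "('a, 'm) monoid_scheme \<Rightarrow> nat \<Rightarrow> (nat \<Rightarrow> nat) \<Rightarrow> 'a wr" where
  "sym_emb G n \<pi> = (\<one>\<^bsub>base_group G n\<^esub>, \<pi>)"

text \<open>The sum-zero vectors in \<open>\<complex>\<^sup>n\<close>, that is, the Specht module of shape \<open>(n - 1, 1)\<close>.\<close>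

definition std_rep :: "nat \<Rightarrow> (nat \<Rightarrow> nat, nat) rep" where
  "std_rep n = \<lparr>
     rep_index = {1..n},
     rep_space = {v. (\<forall>i. i \<notin> {1..n} \<longrightarrow> v i = 0) \<and> (\<Sum>i\<in>{1..n}. v i) = 0},
     rep_act = (\<lambda>\<pi> v i. v (inv' \<pi> i))\<rparr>"

definition wreath_std_rep :: "nat \<Rightarrow> ('a wr, nat) rep" where
  "wreath_std_rep n = lift_rep snd (std_rep n)"


section \<open>The representations indexed by multiplicity vectors\<close>

definition characters :: "('a, 'm) monoid_scheme \<Rightarrow> ('a \<Rightarrow> complex) set" where
  "characters G = {\<chi> \<in> carrier G \<rightarrow>\<^sub>E (- {0}).
     \<forall>x\<in>carrier G. \<forall>y\<in>carrier G. \<chi> (x \<otimes>\<^bsub>G\<^esub> y) = \<chi> x * \<chi> y}"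

definition multiplicity_vectors ::
  "('a, 'm) monoid_scheme \<Rightarrow> nat \<Rightarrow> (('a \<Rightarrow> complex) \<Rightarrow> nat) set" where
  "multiplicity_vectors G n =
     {\<kappa> \<in> characters G \<rightarrow>\<^sub>E UNIV. (\<Sum>\<chi>\<in>characters G. \<kappa> \<chi>) = n}"

text \<open>
  To embed \<open>\<Prod>\<^sub>\<chi> (G \<wr> S\<^bsub>\<kappa>(\<chi>)\<^esub>)\<close> into \<open>G \<wr> S\<^sub>n\<close>, the set \<open>{1..n}\<close> is cut into
  blocks \<open>{i. b i = \<chi>}\<close> of size \<open>\<kappa> \<chi>\<close>, given by a labelling \<open>b\<close>. The subgroup is then the
  stabiliser of \<open>b\<close>. Different labellings give conjugate subgroups and isomorphic
  induced representations, so an arbitrary one is chosen.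
\<close>

definition block_labelling ::
  "('a, 'm) monoid_scheme \<Rightarrow> nat \<Rightarrow> (('a \<Rightarrow> complex) \<Rightarrow> nat) \<Rightarrow> (nat \<Rightarrow> 'a \<Rightarrow> complex) \<Rightarrow> bool" where
  "block_labelling G n \<kappa> b \<longleftrightarrow> b \<in> {1..n} \<rightarrow> characters G \<and>
     (\<forall>\<chi>\<in>characters G. card {i\<in>{1..n}. b i = \<chi>} = \<kappa> \<chi>)"

definition block_subgroup ::
  "('a, 'm) monoid_scheme \<Rightarrow> nat \<Rightarrow> (nat \<Rightarrow> 'a \<Rightarrow> complex) \<Rightarrow> 'a wr set" where
  "block_subgroup G n b = {(g, \<pi>) \<in> carrier (wreath G n). \<forall>i\<in>{1..n}. b (\<pi> i) = b i}"

definition block_character ::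
  "('a, 'm) monoid_scheme \<Rightarrow> nat \<Rightarrow> (nat \<Rightarrow> 'a \<Rightarrow> complex) \<Rightarrow> 'a wr \<Rightarrow> complex" where
  "block_character G n b = (\<lambda>(g, \<pi>). \<Prod>\<chi>\<in>characters G. \<Prod>i\<in>{i\<in>{1..n}. b i = \<chi>}. \<chi> (g i))"

definition V_rep ::
  "('a, 'm) monoid_scheme \<Rightarrow> nat \<Rightarrow> (('a \<Rightarrow> complex) \<Rightarrow> nat) \<Rightarrow> ('a wr, 'a wr \<times> unit) rep" where
  "V_rep G n \<kappa> = (let b = (SOME b. block_labelling G n \<kappa> b) in
     induced_rep (wreath G n) (block_subgroup G n b) (linear_rep (block_character G n b)))"


section \<open>Well-definedness\<close>

lemma perm_act_mult:
  assumes "\<pi> permutes {1..n}" "\<sigma> permutes {1..n}"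
  shows "perm_act n (\<pi> \<circ> \<sigma>) g = perm_act n \<pi> (perm_act n \<sigma> g)"
  using permutes_in_image[OF permutes_inv[OF assms(1)]]
  by (auto simp: perm_act_def fun_eq_iff o_inv_distrib[OF permutes_bij[OF assms(1)] permutes_bij[OF assms(2)]])

lemma perm_act_closed:
  assumes "\<pi> permutes {1..n}" "g \<in> carrier (base_group G n)"
  shows "perm_act n \<pi> g \<in> carrier (base_group G n)"
  using assms permutes_in_image[OF permutes_inv[OF assms(1)]] by (auto simp: perm_act_def PiE_iff)

lemma group_wreath:
  assumes "group G" shows "group (wreath G n)"
proof -
  interpret G: group G by fact
  let ?B = "base_group G n" and ?S = "sym_group n"
  interpret B: group ?B using assms by simp
  interpret S: group ?S by (rule sym_group_is_group)
  have dist: "perm_act n \<pi> (g \<otimes>\<^bsub>?B\<^esub> h) = perm_act n \<pi> g \<otimes>\<^bsub>?B\<^esub> perm_act n \<pi> h"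
    if "\<pi> permutes {1..n}" for \<pi> g h
    using permutes_in_image[OF permutes_inv[OF that]] by (auto simp: perm_act_def fun_eq_iff)
  have one: "perm_act n \<pi> \<one>\<^bsub>?B\<^esub> = \<one>\<^bsub>?B\<^esub>" if "\<pi> permutes {1..n}" for \<pi>
    using permutes_in_image[OF permutes_inv[OF that]] by (auto simp: perm_act_def fun_eq_iff)
  have id: "perm_act n id g = g" if "g \<in> carrier ?B" for g
    using that by (auto simp: perm_act_def PiE_iff extensional_def fun_eq_iff)
  note car = sym_group_carrier sym_group_mult sym_group_one
  note [simp del] = carrier_product_group mult_product_group one_product_group One_nat_def
  show ?thesis
  proof (rule groupI, goal_cases)
    case (1 x y) then show ?case
      by (auto simp: wreath_def perm_act_closed car permutes_compose intro!: B.m_closed)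
  next
    case 2 then show ?case by (auto simp: wreath_def)
  next
    case (3 x y z) then show ?case
      by (auto simp: wreath_def car dist perm_act_mult perm_act_closed permutes_compose B.m_assoc comp_assoc)
  next
    case (4 x) then show ?case by (auto simp: wreath_def car id)
  next
    case (5 x)
    obtain g \<pi> where x: "x = (g, \<pi>)" "g \<in> carrier ?B" "\<pi> permutes {1..n}"
      using 5 by (auto simp: wreath_def car)
    have p: "inv' \<pi> permutes {1..n}" using x permutes_inv by blast
    show ?case
      by (rule bexI[of _ "(perm_act n (inv' \<pi>) (inv\<^bsub>?B\<^esub> g), inv' \<pi>)"])
        (use x p permutes_inv_o(2)[OF x(3)] in
          \<open>auto simp: wreath_def car perm_act_closed dist[OF p, symmetric] one[OF p]\<close>)
  qed
qed

lemma unitary_rep_regular_rep: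
  assumes "group H" "finite (carrier H)" shows "unitary_rep H (regular_rep H)"
proof -
  interpret H: group H by fact
  have re: "(\<Sum>x\<in>carrier H. F (inv\<^bsub>H\<^esub> h \<otimes>\<^bsub>H\<^esub> x)) = sum F (carrier H)" if "h \<in> carrier H" for h and F :: "'a \<Rightarrow> complex"
    by (rule sum.reindex_bij_witness[of _ "\<lambda>x. h \<otimes>\<^bsub>H\<^esub> x" "\<lambda>x. inv\<^bsub>H\<^esub> h \<otimes>\<^bsub>H\<^esub> x"])
      (use that in \<open>auto simp: H.m_assoc[symmetric]\<close>)
  show ?thesis
  proof (unfold_locales, goal_cases)
    case (11 h u v) then show ?case
      using re[OF 11(1), of "\<lambda>x. u x * cnj (v x)"]
      by (simp add: regular_rep_def rep_inner_def cong: sum.cong)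
  qed (use assms in \<open>auto simp: regular_rep_def fun_eq_iff H.inv_mult_group H.m_assoc\<close>)
qed

lemma unitary_rep_wreath_std_rep: "unitary_rep (wreath G n) (wreath_std_rep n)"
proof -
  have re: "(\<Sum>i\<in>{1..n}. F (inv' \<pi> i)) = (\<Sum>i\<in>{1..n}. F i)" if "\<pi> permutes {1..n}" for \<pi> and F :: "nat \<Rightarrow> complex"
    using sum.permute[OF permutes_inv[OF that], of F] by (simp add: o_def)
  note d = wreath_def wreath_std_rep_def lift_rep_def std_rep_def sym_group_carrier sym_group_mult sym_group_one
  show ?thesis
  proof (unfold_locales, goal_cases)
    case (6 h v)
    then have p: "snd h permutes {1..n}" by (auto simp: d)
    show ?case using 6 re[OF p, of v] permutes_in_image[OF permutes_inv[OF p]] by (auto simp: d simp del: atLeastAtMost_iff)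
  next
    case (10 h k v)
    then have p: "snd h permutes {1..n}" "snd k permutes {1..n}" by (auto simp: d)
    then show ?case
      using o_inv_distrib[OF permutes_bij[OF p(1)] permutes_bij[OF p(2)]]
      by (cases h; cases k) (simp add: d fun_eq_iff)
  next
    case (11 h u v)
    then have p: "snd h permutes {1..n}" by (auto simp: d)
    show ?case using re[OF p, of "\<lambda>x. u x * cnj (v x)"] by (simp add: d rep_inner_def)
  qed (auto simp: d sum.distrib sum_distrib_left[symmetric] fun_eq_iff)
qed

lemma unitary_rep_induced_rep:
  assumes "group H" "finite (carrier H)" "subgroup K H" "unitary_rep (H\<lparr>carrier := K\<rparr>) R"
  shows "unitary_rep H (induced_rep H K R)"
proof -
  interpret H: group H by fact
  interpret K: subgroup K H by fact
  interpret R: unitary_rep "H\<lparr>carrier := K\<rparr>" R by fact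
  have re: "(\<Sum>x\<in>carrier H. F (inv\<^bsub>H\<^esub> h \<otimes>\<^bsub>H\<^esub> x)) = sum F (carrier H)" if "h \<in> carrier H" for h and F :: "'a \<Rightarrow> complex"
    by (rule sum.reindex_bij_witness[of _ "\<lambda>x. h \<otimes>\<^bsub>H\<^esub> x" "\<lambda>x. inv\<^bsub>H\<^esub> h \<otimes>\<^bsub>H\<^esub> x"])
      (use that in \<open>auto simp: H.m_assoc[symmetric]\<close>)
  show ?thesis
  proof (unfold_locales, goal_cases)
    case 1 then show ?case using assms R.finite_index by (auto simp: induced_rep_def)
  next
    case (2 v b) then show ?case using R.support by (cases b) (auto simp: induced_rep_def)
  next
    case 3 then show ?case using R.zero_closed R.act_scale[OF _ R.zero_closed, of _ 0]
      by (auto simp: induced_rep_def)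
  next
    case (4 u v) then show ?case using R.add_closed R.act_add
      by (auto simp: induced_rep_def fun_eq_iff)
  next
    case (5 v z) then show ?case using R.scale_closed R.act_scale
      by (auto simp: induced_rep_def fun_eq_iff)
  next
    case (6 h v) then show ?case
      by (auto simp: induced_rep_def H.m_assoc[symmetric])
  next
    case (11 h u v) then show ?case
      using re[OF 11(1), of "\<lambda>x. \<Sum>b\<in>rep_index R. u (x, b) * cnj (v (x, b))"]
      by (simp add: induced_rep_def rep_inner_def sum.cartesian_product' cong: sum.cong)
  qed (auto simp: induced_rep_def fun_eq_iff H.inv_mult_group H.m_assoc)
qed

lemma ex_block_labelling:
  assumes "\<kappa> \<in> multiplicity_vectors G n" "n > 0"
  shows "\<exists>b. block_labelling G n \<kappa> b"
proof -
  let ?S = "SIGMA \<chi>:characters G. {..<\<kappa> \<chi>}"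
  have fin: "finite (characters G)"
    using assms by (cases "finite (characters G)") (auto simp: multiplicity_vectors_def)
  have "card ?S = card {1..n}" using assms fin by (simp add: multiplicity_vectors_def)
  then obtain f where f: "bij_betw f {1..n} ?S"
    using fin by (metis finite_SigmaI finite_atLeastAtMost finite_lessThan finite_same_card_bij)
  show ?thesis
  proof (rule exI[of _ "fst \<circ> f"], unfold block_labelling_def, intro conjI ballI)
    show "fst \<circ> f \<in> {1..n} \<rightarrow> characters G" using bij_betwE[OF f] by auto
  next
    fix \<chi> assume "\<chi> \<in> characters G"
    have "f ` {i\<in>{1..n}. (fst \<circ> f) i = \<chi>} = {p \<in> f ` {1..n}. fst p = \<chi>}" by force
    also have "\<dots> = {p \<in> ?S. fst p = \<chi>}" using f unfolding bij_betw_def by blast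
    also have "\<dots> = {\<chi>} \<times> {..<\<kappa> \<chi>}" using \<open>\<chi> \<in> _\<close> by auto
    finally have "f ` {i\<in>{1..n}. (fst \<circ> f) i = \<chi>} = {\<chi>} \<times> {..<\<kappa> \<chi>}" .
    moreover have "inj_on f {i\<in>{1..n}. (fst \<circ> f) i = \<chi>}"
      using f unfolding bij_betw_def by (blast intro: inj_on_subset)
    ultimately have "bij_betw f {i\<in>{1..n}. (fst \<circ> f) i = \<chi>} ({\<chi>} \<times> {..<\<kappa> \<chi>})"
      unfolding bij_betw_def by blast
    then show "card {i\<in>{1..n}. (fst \<circ> f) i = \<chi>} = \<kappa> \<chi>"
      by (simp add: bij_betw_same_card card_cartesian_product)
  qed
qed

lemma norm_character_eq_1:
  assumes "group G" "finite (carrier G)" "\<chi> \<in> characters G" "x \<in> carrier G"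
  shows "norm (\<chi> x) = 1"
proof -
  interpret G: group G by fact
  have "\<chi> (\<one>\<^bsub>G\<^esub> \<otimes>\<^bsub>G\<^esub> \<one>\<^bsub>G\<^esub>) = \<chi> \<one>\<^bsub>G\<^esub> * \<chi> \<one>\<^bsub>G\<^esub>"
    using assms(3) G.one_closed unfolding characters_def by blast
  moreover have "\<chi> \<one>\<^bsub>G\<^esub> \<noteq> 0" using assms(3) G.one_closed unfolding characters_def PiE_iff by blast
  ultimately have 1: "\<chi> \<one>\<^bsub>G\<^esub> * \<chi> \<one>\<^bsub>G\<^esub> = \<chi> \<one>\<^bsub>G\<^esub>" "\<chi> \<one>\<^bsub>G\<^esub> \<noteq> 0" by simp_all
  then have 1: "\<chi> \<one>\<^bsub>G\<^esub> = 1" by simp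
  have "\<chi> (x [^]\<^bsub>G\<^esub> (k::nat)) = \<chi> x ^ k" for k
    using assms(3,4) 1 by (induction k) (auto simp: characters_def)
  from this[of "order G"] have "\<chi> x ^ order G = 1" using assms(4) 1 by (simp add: G.pow_order_eq_1)
  then have "norm (\<chi> x) ^ order G = 1" by (metis norm_power norm_one)
  moreover have "order G > 0" using assms(2) G.order_gt_0_iff_finite by blast
  ultimately show ?thesis using power_eq_imp_eq_base[of "norm (\<chi> x)" "order G" 1] by simp
qed

lemma unitary_rep_V_rep:
  assumes "group G" "finite (carrier G)" "\<kappa> \<in> multiplicity_vectors G n" "n > 0"
  shows "unitary_rep (wreath G n) (V_rep G n \<kappa>)"
proof -
  define b where "b = (SOME b. block_labelling G n \<kappa> b)"
  have b: "block_labelling G n \<kappa> b" unfolding b_def by (rule someI_ex[OF ex_block_labelling[OF assms(3,4)]])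
  interpret G: group G by fact
  interpret W: group "wreath G n" using assms by (rule_tac group_wreath)
  let ?W = "wreath G n" and ?K = "block_subgroup G n b" and ?f = "block_character G n b"
  have fin: "finite (carrier ?W)"
    using assms(2) by (auto simp: wreath_def sym_group_def intro!: finite_PiE finite_permutations)
  have finc: "finite (characters G)"
    using assms by (cases "finite (characters G)") (auto simp: multiplicity_vectors_def)
  have K: "subgroup ?K ?W"
  proof (rule W.subgroupI)
    show "?K \<subseteq> carrier ?W" by (auto simp: block_subgroup_def)
    have "\<one>\<^bsub>?W\<^esub> \<in> ?K" using W.one_closed by (auto simp: block_subgroup_def wreath_def sym_group_def)
    then show "?K \<noteq> {}" by blast
    show mul: "x \<otimes>\<^bsub>?W\<^esub> y \<in> ?K" if "x \<in> ?K" "y \<in> ?K" for x y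
    proof -
      obtain g p h q where x: "x = (g,p)" "y = (h,q)" by (metis surj_pair)
      have q: "q permutes {1..n}" using that x by (auto simp: block_subgroup_def wreath_def sym_group_def)
      have "x \<otimes>\<^bsub>?W\<^esub> y \<in> carrier ?W" using that by (auto simp: block_subgroup_def)
      then show ?thesis using that permutes_in_image[OF q] unfolding x
        by (simp add: block_subgroup_def wreath_def sym_group_mult)
    qed
    show "inv\<^bsub>?W\<^esub> x \<in> ?K" if "x \<in> ?K" for x
    proof -
      have c: "x \<in> carrier ?W" using that by (auto simp: block_subgroup_def)
      obtain g p h q where x: "x = (g,p)" "inv\<^bsub>?W\<^esub> x = (h,q)" by (metis surj_pair)
      have ic: "inv\<^bsub>?W\<^esub> x \<in> carrier ?W" using c by simp
      have "x \<otimes>\<^bsub>?W\<^esub> inv\<^bsub>?W\<^esub> x = \<one>\<^bsub>?W\<^esub>" using c by simp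
      then have "(g,p) \<otimes>\<^bsub>?W\<^esub> (h,q) = \<one>\<^bsub>?W\<^esub>" unfolding x(2) unfolding x(1) .
      then have "p \<circ> q = id" by (simp add: wreath_def sym_group_def)
      moreover have q: "q permutes {1..n}" using ic x by (auto simp: wreath_def sym_group_def)
      ultimately have "\<forall>i\<in>{1..n}. b (q i) = b i"
        using that permutes_in_image[OF q] unfolding x(1)
        by (simp add: block_subgroup_def fun_eq_iff del: atLeastAtMost_iff) (metis)
      then show ?thesis using ic unfolding x(2) by (simp add: block_subgroup_def)
    qed
  qed
  have f: "?f (g, p) = (\<Prod>i\<in>{1..n}. b i (g i))" for g p
  proof -
    have "?f (g,p) = (\<Prod>\<chi>\<in>characters G. \<Prod>i\<in>{i\<in>{1..n}. b i = \<chi>}. b i (g i))"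
      by (simp add: block_character_def)
    also have "\<dots> = (\<Prod>i\<in>{1..n}. b i (g i))"
      by (rule prod.group) (use b finc in \<open>auto simp: block_labelling_def\<close>)
    finally show ?thesis .
  qed
  have bi: "b i \<in> characters G" if "i \<in> {1..n}" for i using b that by (auto simp: block_labelling_def)
  have n1: "norm (?f x) = 1" if "x \<in> ?K" for x
  proof -
    obtain g p where x: "x = (g,p)" by (metis surj_pair)
    have "g i \<in> carrier G" if "i \<in> {1..n}" for i
      using \<open>x \<in> ?K\<close> that by (auto simp: x block_subgroup_def wreath_def)
    then show ?thesis unfolding x f prod_norm[symmetric]
      using norm_character_eq_1[OF assms(1,2) bi] by (intro prod.neutral) blast
  qed
  have fm: "?f (x \<otimes>\<^bsub>?W\<^esub> y) = ?f x * ?f y" if "x \<in> ?K" "y \<in> ?K" for x y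
  proof -
    obtain g p h q where x: "x = (g,p)" "y = (h,q)" by (metis surj_pair)
    have p: "p permutes {1..n}" and bp: "\<And>i. i \<in> {1..n} \<Longrightarrow> b (p i) = b i"
      using that x by (auto simp: block_subgroup_def wreath_def sym_group_def)
    have gh: "g i \<in> carrier G" "h i \<in> carrier G" if "i \<in> {1..n}" for i
      using \<open>x \<in> ?K\<close> \<open>y \<in> ?K\<close> that by (auto simp: x block_subgroup_def wreath_def)
    have ip: "inv' p i \<in> {1..n}" if "i \<in> {1..n}" for i using permutes_in_image[OF permutes_inv[OF p]] that by blast
    have "?f (x \<otimes>\<^bsub>?W\<^esub> y) = (\<Prod>i\<in>{1..n}. b i (g i \<otimes>\<^bsub>G\<^esub> h (inv' p i)))"
      unfolding x wreath_def by (simp add: f perm_act_def)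
    also have "\<dots> = (\<Prod>i\<in>{1..n}. b i (g i)) * (\<Prod>i\<in>{1..n}. b i (h (inv' p i)))"
      unfolding prod.distrib[symmetric]
    proof (intro prod.cong refl)
      fix i assume i: "i \<in> {1..n}"
      show "b i (g i \<otimes>\<^bsub>G\<^esub> h (inv' p i)) = b i (g i) * b i (h (inv' p i))"
        using bi[OF i] gh(1)[OF i] gh(2)[OF ip[OF i]] unfolding characters_def by blast
    qed
    also have "(\<Prod>i\<in>{1..n}. b i (h (inv' p i))) = (\<Prod>i\<in>{1..n}. b (p i) (h i))"
      using prod.permute[OF p, of "\<lambda>i. b i (h (inv' p i))"] permutes_inverses[OF p] by (simp add: o_def)
    also have "\<dots> = (\<Prod>i\<in>{1..n}. b i (h i))" using bp by (intro prod.cong) auto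
    finally show ?thesis by (simp add: x f)
  qed
  have f1: "?f \<one>\<^bsub>?W\<^esub> = 1"
    using fm[of "\<one>\<^bsub>?W\<^esub>" "\<one>\<^bsub>?W\<^esub>"] n1[of "\<one>\<^bsub>?W\<^esub>"] subgroup.one_closed[OF K] by auto
  have "unitary_rep (?W\<lparr>carrier := ?K\<rparr>) (linear_rep ?f)"
  proof (unfold_locales, goal_cases)
    case (11 h u v)
    then have "?f h * cnj (?f h) = 1" using n1[of h] by (simp add: complex_norm_square[symmetric])
    then show ?case by (simp add: linear_rep_def rep_inner_def UNIV_unit)
  qed (auto simp: linear_rep_def f1 fm distrib_left mult.assoc mult.left_commute)
  then show ?thesis
    unfolding V_rep_def b_def[symmetric] Let_def by (intro unitary_rep_induced_rep W.group_axioms fin K)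
qed

end

theory Submission
  imports Defs "HOL-Analysis.Function_Topology" "HOL-Analysis.Topology_Euclidean_Space" "HOL-Analysis.Convex"
begin

text \<open>
  Every spectral gap \<open>\<psi>(w, V)\<close> bounds \<open>\<psi>(w)\<close> from above, since eigenvectors embed into the regular representation
  as matrix coefficients. Conversely, right multiplication by \<open>G\<^sup>n\<close> commutes with the Laplacian, so some eigenfunction
  for \<open>\<psi>(w)\<close> is also an eigenfunction for it, with a character \<open>\<beta> = (\<beta>\<^sub>1, \<dots>, \<beta>\<^sub>n)\<close> of \<open>G\<^sup>n\<close>. The Laplacian then acts
  on functions on the symmetric group as the Laplacian of the transpositions plus a non-negative potential that is
  invariant under the stabiliser of \<open>\<beta>\<close>. If \<open>\<beta>\<close> is not trivial, the mean-square average of the eigenfunction over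
  this stabiliser is a test vector in \<open>V\<^sub>\<kappa>\<close>, where \<open>\<kappa>\<close> counts the values of \<open>\<beta>\<close>, with no larger Rayleigh quotient.
  If \<open>\<beta>\<close> is trivial, the potential vanishes and the claim is Aldous' spectral gap theorem. Its proof follows Caputo,
  Liggett and Richthammer: induction by removing a vertex with the star-mesh transformation, where the comparison of
  the Dirichlet forms is the octopus inequality. The latter reduces to the positivity of an element of the group
  algebra of the alternating group on five points.
\<close>

text \<open>For a non-trivial character the induced representation has no fixed vectors, so the
  lowest eigenvalue is sought and passing to moduli is harmless. For the trivial character the
  constants have to be excluded; moduli do not respect this constraint, and the second eigenvalue is
  needed. Hence one case is a comparison of test vectors while the other is Aldous' theorem. The
  number five arises as follows. The bound on the square of a weighted sum of transpositions has
  degree four in the weights and involves products of two transpositions, so at most four points at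
  a time. Eliminating the one weight that may be negative brings in a fifth point, and the claim
  becomes one inequality for each set of five points. Its positivity is certified by integer
  multiples of projections, which makes the check a finite computation with permutations of five
  points.\<close>

hide_const (open) Finite_Cartesian_Product.transpose

section \<open>Five points\<close>

datatype point5 = P0 | P1 | P2 | P3 | P4

text \<open>A map is stored as its table of values, so that equality and composition can be
  evaluated and the group algebra identities below are decided by \<open>code_simp\<close>.\<close>

datatype map5 = Map5 point5 point5 point5 point5 point5

primrec app5 :: "map5 \<Rightarrow> point5 \<Rightarrow> point5" where
  "app5 (Map5 a b c d e) = case_point5 a b c d e"

definition comp5 :: "map5 \<Rightarrow> map5 \<Rightarrow> map5" where
  "comp5 s t = (case t of Map5 a b c d e \<Rightarrow> Map5 (app5 s a) (app5 s b) (app5 s c) (app5 s d) (app5 s e))"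

definition points5 :: "point5 list" where "points5 = [P0, P1, P2, P3, P4]"

definition perms5 :: "map5 list" where
  "perms5 = [Map5 a b c d e. a \<leftarrow> points5, b \<leftarrow> points5, b \<noteq> a, c \<leftarrow> points5, c \<noteq> a \<and> c \<noteq> b,
     d \<leftarrow> points5, d \<noteq> a \<and> d \<noteq> b \<and> d \<noteq> c, e \<leftarrow> points5, e \<noteq> a \<and> e \<noteq> b \<and> e \<noteq> c \<and> e \<noteq> d]"

definition fixed_points5 :: "map5 \<Rightarrow> nat" where
  "fixed_points5 s = (case s of Map5 a b c d e \<Rightarrow> of_bool (a = P0) + of_bool (b = P1) + of_bool (c = P2) + of_bool (d = P3) + of_bool (e = P4))"

definition double_transp :: "map5 \<Rightarrow> bool" where
  "double_transp s \<longleftrightarrow> fixed_points5 s = 1 \<and> comp5 s s = Map5 P0 P1 P2 P3 P4"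

definition three_cycle :: "map5 \<Rightarrow> bool" where
  "three_cycle s \<longleftrightarrow> fixed_points5 s = 2 \<and> comp5 s s \<noteq> Map5 P0 P1 P2 P3 P4"

text \<open>In the group algebra of the alternating group on five points let \<open>p\<^sub>i\<close> be the projection onto the
  vectors fixed by the Klein four-group on the points other than \<open>i\<close> and orthogonal to those fixed by the
  alternating group on these points. Then \<open>coeff4\<close> lists the coefficients of \<open>12 p\<^sub>0\<close>, and \<open>coeff5\<close> those of
  \<open>6 (p\<^sub>1 + p\<^sub>2 + p\<^sub>3 + p\<^sub>4 - p\<^sub>0)\<close>. Both are 12 times a projection: all \<open>p\<^sub>i\<close> live in the five-dimensional
  irreducible representation, where each has rank 2, so that their invariant sum is the scalar 2.\<close>

definition coeff4 :: "map5 \<Rightarrow> int" where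
  "coeff4 s = (if app5 s P0 = P0 then if s = Map5 P0 P1 P2 P3 P4 \<or> double_transp s then 2 else if three_cycle s then -1 else 0 else 0)"

definition coeff5 :: "map5 \<Rightarrow> int" where
  "coeff5 s = (if s = Map5 P0 P1 P2 P3 P4 then 3 
           else if double_transp s then if app5 s P0 = P0 then -1 else 1
           else if three_cycle s \<and> app5 s P0 \<noteq> P0 then -1 else 0)"

text \<open>Let y* be y with every group element inverted. The coefficient of k in y* y is the sum
  of \<open>y h * y (comp5 h k)\<close>, so the condition reads y* y = 12 y and exhibits y as a
  positive element. The zero coefficients are dropped first to keep the evaluation small.\<close>

definition self_convolution :: "(map5 \<Rightarrow> int) \<Rightarrow> bool" where
  "self_convolution y \<longleftrightarrow> (let L = filter (\<lambda>(h, u). u \<noteq> 0) (map (\<lambda>h. (h, y h)) perms5) in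
    list_all (\<lambda>k. sum_list (map (\<lambda>(h, u). u * y (comp5 h k)) L) = 12 * y k) perms5)"

lemma self_convolution_coeff5: "self_convolution coeff5"
  by code_simp
lemma self_convolution_coeff4: "self_convolution coeff4"
  by code_simp

section \<open>Autocorrelations as positive definite functions on permutations\<close>

definition corr :: "'v set \<Rightarrow> (('v \<Rightarrow> 'v) \<Rightarrow> real) \<Rightarrow> ('v \<Rightarrow> 'v) \<Rightarrow> real" where
  "corr N f p = (\<Sum>\<eta> | \<eta> permutes N. f \<eta> * f (\<eta> \<circ> p))"

text \<open>Right translation is unitary, so \<open>corr N f\<close> is a matrix coefficient of f
  and thus a positive definite function. An inequality between its values for all f is therefore a
  positivity statement in the group algebra.\<close>

lemma corr_shift:
  assumes "p permutes N"
  shows "(\<Sum>\<eta> | \<eta> permutes N. f (\<eta> \<circ> p) * f (\<eta> \<circ> (p \<circ> r))) = corr N f r"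
  unfolding corr_def
  by (subst sum_permutations_compose_right[OF assms]) (simp add: o_assoc)

lemma corr_inv:
  assumes "p permutes N"
  shows "corr N f (inv' p) = corr N f p"
proof -
  have "corr N f (inv' p) = (\<Sum>\<eta> | \<eta> permutes N. f (\<eta> \<circ> p) * f (\<eta> \<circ> (p \<circ> inv' p)))"
    by (rule corr_shift[OF assms, symmetric])
  also have "\<dots> = corr N f p"
    using permutes_inv_o(1)[OF assms] by (simp add: corr_def mult.commute)
  finally show ?thesis .
qed

definition embed5 :: "(point5 \<Rightarrow> 'v) \<Rightarrow> map5 \<Rightarrow> 'v \<Rightarrow> 'v" where
  "embed5 e s x = (if x \<in> range e then e (app5 s (inv' e x)) else x)"

lemma app5_comp5: "app5 (comp5 s t) i = app5 s (app5 t i)"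
  by (cases t; cases i) (simp_all add: comp5_def)

lemma map5_eqI:
  assumes "\<And>i. app5 s i = app5 t i" shows "s = t"
  using assms[of P0] assms[of P1] assms[of P2] assms[of P3] assms[of P4]
  by (cases s; cases t) simp

lemma UNIV_point5: "UNIV = {P0, P1, P2, P3, P4}"
  using point5.exhaust by blast

instance point5 :: finite by standard (simp add: UNIV_point5)

lemma set_points5: "set points5 = UNIV"
  by (simp add: points5_def UNIV_point5)

lemma set_perms5: "set perms5 = {s. inj (app5 s)}"
proof -
  have "s \<in> set perms5 \<longleftrightarrow> inj (app5 s)" for s
  proof (cases s)
    case (Map5 a b c d e)
    have "s \<in> set perms5 \<longleftrightarrow> distinct [a, b, c, d, e]"
      unfolding perms5_def Map5 by (simp add: set_points5) blast
    also have "\<dots> \<longleftrightarrow> inj (app5 s)"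
      unfolding inj_on_def Map5 UNIV_point5 by simp blast
    finally show ?thesis .
  qed
  then show ?thesis by blast
qed

lemma distinct_perms5: "distinct perms5"
  by code_simp

lemma embed5_comp5:
  assumes "inj e" shows "embed5 e (comp5 s t) = embed5 e s \<circ> embed5 e t"
  using assms by (auto simp: embed5_def fun_eq_iff app5_comp5)

lemma embed5_eqI:
  assumes "inj e" "\<And>i. g (e i) = e (app5 s i)" "\<And>x. x \<notin> range e \<Longrightarrow> g x = x"
  shows "embed5 e s = g"
  using assms by (auto simp: embed5_def fun_eq_iff)

lemma sum_perms5_translate:
  fixes F :: "map5 \<Rightarrow> real"
  assumes "h \<in> set perms5"
  shows "(\<Sum>k\<in>set perms5. F (comp5 h k)) = (\<Sum>k\<in>set perms5. F k)"
proof -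
  have inj: "inj_on (comp5 h) (set perms5)"
  proof (rule inj_onI)
    fix s t assume "comp5 h s = comp5 h t"
    then have "app5 h (app5 s i) = app5 h (app5 t i)" for i by (metis app5_comp5)
    moreover have "inj (app5 h)" using assms by (simp add: set_perms5)
    ultimately have "app5 s i = app5 t i" for i by (metis injD)
    then show "s = t" by (rule map5_eqI)
  qed
  have "inj (app5 (comp5 h t))" if "inj (app5 t)" for t
  proof -
    have "app5 (comp5 h t) = app5 h \<circ> app5 t" by (simp add: fun_eq_iff app5_comp5)
    then show ?thesis using that assms by (simp add: set_perms5 inj_compose)
  qed
  then have "comp5 h ` set perms5 \<subseteq> set perms5" by (auto simp: set_perms5)
  then have "comp5 h ` set perms5 = set perms5"
    by (intro endo_inj_surj inj) auto
  then show ?thesis using sum.reindex[OF inj, of F] by simp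
qed

lemma sum_list_filter_nz:
  fixes g :: "'b \<Rightarrow> int"
  shows "(\<Sum>(h, u)\<leftarrow>filter (\<lambda>(h, u). u \<noteq> 0) (map (\<lambda>h. (h, g h)) xs). u * F h) = (\<Sum>h\<leftarrow>xs. g h * F h)"
  by (induction xs) auto

text \<open>The square norm of the sum of \<open>y h\<close> times the translate of f by h has the
  coefficients of y* y, which are 12 y. Only permutations in the support of y have to preserve N:
  those in the support of \<open>coeff4\<close> fix P0, so \<open>e P0\<close> may lie outside
  N.\<close>

lemma corr_gram_nonneg:
  fixes e :: "point5 \<Rightarrow> 'v" and y :: "map5 \<Rightarrow> int"
  assumes fin: "finite N" and e: "inj e" and ok: "self_convolution y"
    and perm: "\<And>s. s \<in> set perms5 \<Longrightarrow> y s \<noteq> 0 \<Longrightarrow> embed5 e s permutes N"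
  shows "0 \<le> (\<Sum>s\<in>set perms5. real_of_int (y s) * corr N f (embed5 e s))"
proof -
  let ?B = "set perms5"
  have conv: "(\<Sum>h\<in>?B. y h * y (comp5 h k)) = 12 * y k" if k: "k \<in> ?B" for k
  proof -
    have "(\<Sum>h\<in>?B. y h * y (comp5 h k)) = (\<Sum>h\<leftarrow>perms5. y h * y (comp5 h k))"
      by (simp add: sum_list_distinct_conv_sum_set distinct_perms5)
    also have "\<dots> = (\<Sum>(h, u)\<leftarrow>filter (\<lambda>(h, u). u \<noteq> 0) (map (\<lambda>h. (h, y h)) perms5). u * y (comp5 h k))"
      by (simp add: sum_list_filter_nz)
    also have "\<dots> = 12 * y k" using ok k unfolding self_convolution_def Let_def list_all_iff by blast
    finally show ?thesis .
  qed
  have "0 \<le> (\<Sum>\<eta> | \<eta> permutes N. (\<Sum>h\<in>?B. real_of_int (y h) * f (\<eta> \<circ> embed5 e h))\<^sup>2)"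
    by (intro sum_nonneg) simp
  also have "\<dots> = (\<Sum>\<eta> | \<eta> permutes N. \<Sum>h\<in>?B. \<Sum>k\<in>?B.
      real_of_int (y h * y (comp5 h k)) * (f (\<eta> \<circ> embed5 e h) * f (\<eta> \<circ> embed5 e (comp5 h k))))"
  proof (intro sum.cong refl)
    fix \<eta>
    have "(\<Sum>h\<in>?B. real_of_int (y h) * f (\<eta> \<circ> embed5 e h))\<^sup>2
      = (\<Sum>h\<in>?B. \<Sum>k\<in>?B. real_of_int (y h) * f (\<eta> \<circ> embed5 e h) * (real_of_int (y k) * f (\<eta> \<circ> embed5 e k)))"
      unfolding power2_eq_square sum_product ..
    \<comment> \<open>With \<open>comp5 h k\<close> in place of k the two translates differ by k
      whatever h is, so that \<open>corr_shift\<close> applies.\<close>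
    also have "\<dots> = (\<Sum>h\<in>?B. \<Sum>k\<in>?B. real_of_int (y h) * f (\<eta> \<circ> embed5 e h) * (real_of_int (y (comp5 h k)) * f (\<eta> \<circ> embed5 e (comp5 h k))))"
      by (intro sum.cong refl sum_perms5_translate[symmetric])
    finally show "(\<Sum>h\<in>?B. real_of_int (y h) * f (\<eta> \<circ> embed5 e h))\<^sup>2 = (\<Sum>h\<in>?B. \<Sum>k\<in>?B.
      real_of_int (y h * y (comp5 h k)) * (f (\<eta> \<circ> embed5 e h) * f (\<eta> \<circ> embed5 e (comp5 h k))))"
      by (simp add: mult_ac)
  qed
  also have "\<dots> = (\<Sum>h\<in>?B. \<Sum>k\<in>?B. real_of_int (y h * y (comp5 h k)) *
      (\<Sum>\<eta> | \<eta> permutes N. f (\<eta> \<circ> embed5 e h) * f (\<eta> \<circ> embed5 e (comp5 h k))))"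
    unfolding sum_distrib_left by (subst sum.swap, rule sum.cong[OF refl], rule sum.swap)
  also have "\<dots> = (\<Sum>h\<in>?B. \<Sum>k\<in>?B. real_of_int (y h * y (comp5 h k)) * corr N f (embed5 e k))"
  proof (intro sum.cong refl)
    fix h k assume h: "h \<in> ?B"
    show "real_of_int (y h * y (comp5 h k)) * (\<Sum>\<eta> | \<eta> permutes N. f (\<eta> \<circ> embed5 e h) * f (\<eta> \<circ> embed5 e (comp5 h k)))
       = real_of_int (y h * y (comp5 h k)) * corr N f (embed5 e k)"
    proof (cases "y h = 0")
      case False
      show ?thesis unfolding embed5_comp5[OF e] corr_shift[OF perm[OF h False]] ..
    qed simp
  qed
  also have "\<dots> = (\<Sum>k\<in>?B. real_of_int (\<Sum>h\<in>?B. y h * y (comp5 h k)) * corr N f (embed5 e k))"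
    by (subst sum.swap) (simp add: sum_distrib_right)
  also have "\<dots> = (\<Sum>k\<in>?B. 12 * (real_of_int (y k) * corr N f (embed5 e k)))"
    by (intro sum.cong refl) (simp add: conv)
  finally show ?thesis by (simp add: sum_distrib_left[symmetric])
qed

section \<open>Explicit coefficients and the quadratic form on four points\<close>

lemma coeff4_support: "filter (\<lambda>(h, u). u \<noteq> 0) (map (\<lambda>h. (h, coeff4 h)) perms5) =
    [(Map5 P0 P1 P2 P3 P4, 2),
     (Map5 P0 P1 P3 P4 P2, -1),
     (Map5 P0 P1 P4 P2 P3, -1),
     (Map5 P0 P2 P1 P4 P3, 2),
     (Map5 P0 P2 P3 P1 P4, -1),
     (Map5 P0 P2 P4 P3 P1, -1),
     (Map5 P0 P3 P1 P2 P4, -1),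
     (Map5 P0 P3 P2 P4 P1, -1),
     (Map5 P0 P3 P4 P1 P2, 2),
     (Map5 P0 P4 P1 P3 P2, -1),
     (Map5 P0 P4 P2 P1 P3, -1),
     (Map5 P0 P4 P3 P2 P1, 2)]"
  by code_simp

lemma coeff5_support: "filter (\<lambda>(h, u). u \<noteq> 0) (map (\<lambda>h. (h, coeff5 h)) perms5) =
    [(Map5 P0 P1 P2 P3 P4, 3),
     (Map5 P0 P2 P1 P4 P3, -1),
     (Map5 P0 P3 P4 P1 P2, -1),
     (Map5 P0 P4 P3 P2 P1, -1),
     (Map5 P1 P0 P2 P4 P3, 1),
     (Map5 P1 P0 P3 P2 P4, 1),
     (Map5 P1 P0 P4 P3 P2, 1),
     (Map5 P1 P2 P0 P3 P4, -1),
     (Map5 P1 P3 P2 P0 P4, -1),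
     (Map5 P1 P4 P2 P3 P0, -1),
     (Map5 P2 P0 P1 P3 P4, -1),
     (Map5 P2 P1 P0 P4 P3, 1),
     (Map5 P2 P1 P3 P0 P4, -1),
     (Map5 P2 P1 P4 P3 P0, -1),
     (Map5 P2 P3 P0 P1 P4, 1),
     (Map5 P2 P4 P0 P3 P1, 1),
     (Map5 P3 P0 P2 P1 P4, -1),
     (Map5 P3 P1 P0 P2 P4, -1),
     (Map5 P3 P1 P2 P4 P0, -1),
     (Map5 P3 P1 P4 P0 P2, 1),
     (Map5 P3 P2 P1 P0 P4, 1),
     (Map5 P3 P4 P2 P0 P1, 1),
     (Map5 P4 P0 P2 P3 P1, -1),
     (Map5 P4 P1 P0 P3 P2, -1),
     (Map5 P4 P1 P2 P0 P3, -1),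
     (Map5 P4 P1 P3 P2 P0, 1),
     (Map5 P4 P2 P1 P3 P0, 1),
     (Map5 P4 P3 P2 P1 P0, 1)]"
  by code_simp

lemma embed5_id: "embed5 e (Map5 P0 P1 P2 P3 P4) = id"
proof -
  have "app5 (Map5 P0 P1 P2 P3 P4) i = i" for i by (cases i) simp_all
  then show ?thesis by (simp add: embed5_def fun_eq_iff f_inv_into_f)
qed

lemma embed5_transposes:
  assumes e: "inj e"
    and "\<And>i. app5 s i = transpose a b (transpose c d i)"
  shows "embed5 e s = transpose (e a) (e b) \<circ> transpose (e c) (e d)"
  using assms by (intro embed5_eqI) (auto simp: Transposition.transpose_def inj_eq)

text \<open>Apart from the identity, the two supports consist of 3-cycles and double transpositions.
  Both are products of two transpositions, the form in which \<open>quad_form\<close> is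
  written.\<close>

lemma embed5_expand:
  assumes "inj e"
  shows "embed5 e (Map5 P0 P1 P3 P4 P2) = transpose (e P2) (e P4) \<circ> transpose (e P2) (e P3)"
    "embed5 e (Map5 P0 P1 P4 P2 P3) = transpose (e P2) (e P3) \<circ> transpose (e P2) (e P4)"
    "embed5 e (Map5 P0 P2 P1 P4 P3) = transpose (e P1) (e P2) \<circ> transpose (e P3) (e P4)"
    "embed5 e (Map5 P0 P2 P3 P1 P4) = transpose (e P1) (e P3) \<circ> transpose (e P1) (e P2)"
    "embed5 e (Map5 P0 P2 P4 P3 P1) = transpose (e P1) (e P4) \<circ> transpose (e P1) (e P2)"
    "embed5 e (Map5 P0 P3 P1 P2 P4) = transpose (e P1) (e P2) \<circ> transpose (e P1) (e P3)"
    "embed5 e (Map5 P0 P3 P2 P4 P1) = transpose (e P1) (e P4) \<circ> transpose (e P1) (e P3)"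
    "embed5 e (Map5 P0 P3 P4 P1 P2) = transpose (e P1) (e P3) \<circ> transpose (e P2) (e P4)"
    "embed5 e (Map5 P0 P4 P1 P3 P2) = transpose (e P1) (e P2) \<circ> transpose (e P1) (e P4)"
    "embed5 e (Map5 P0 P4 P2 P1 P3) = transpose (e P1) (e P3) \<circ> transpose (e P1) (e P4)"
    "embed5 e (Map5 P0 P4 P3 P2 P1) = transpose (e P1) (e P4) \<circ> transpose (e P2) (e P3)"
    "embed5 e (Map5 P1 P0 P2 P4 P3) = transpose (e P0) (e P1) \<circ> transpose (e P3) (e P4)"
    "embed5 e (Map5 P1 P0 P3 P2 P4) = transpose (e P0) (e P1) \<circ> transpose (e P2) (e P3)"
    "embed5 e (Map5 P1 P0 P4 P3 P2) = transpose (e P0) (e P1) \<circ> transpose (e P2) (e P4)"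
    "embed5 e (Map5 P1 P2 P0 P3 P4) = transpose (e P0) (e P2) \<circ> transpose (e P0) (e P1)"
    "embed5 e (Map5 P1 P3 P2 P0 P4) = transpose (e P0) (e P3) \<circ> transpose (e P0) (e P1)"
    "embed5 e (Map5 P1 P4 P2 P3 P0) = transpose (e P0) (e P4) \<circ> transpose (e P0) (e P1)"
    "embed5 e (Map5 P2 P0 P1 P3 P4) = transpose (e P0) (e P1) \<circ> transpose (e P0) (e P2)"
    "embed5 e (Map5 P2 P1 P0 P4 P3) = transpose (e P0) (e P2) \<circ> transpose (e P3) (e P4)"
    "embed5 e (Map5 P2 P1 P3 P0 P4) = transpose (e P0) (e P3) \<circ> transpose (e P0) (e P2)"
    "embed5 e (Map5 P2 P1 P4 P3 P0) = transpose (e P0) (e P4) \<circ> transpose (e P0) (e P2)"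
    "embed5 e (Map5 P2 P3 P0 P1 P4) = transpose (e P0) (e P2) \<circ> transpose (e P1) (e P3)"
    "embed5 e (Map5 P2 P4 P0 P3 P1) = transpose (e P0) (e P2) \<circ> transpose (e P1) (e P4)"
    "embed5 e (Map5 P3 P0 P2 P1 P4) = transpose (e P0) (e P1) \<circ> transpose (e P0) (e P3)"
    "embed5 e (Map5 P3 P1 P0 P2 P4) = transpose (e P0) (e P2) \<circ> transpose (e P0) (e P3)"
    "embed5 e (Map5 P3 P1 P2 P4 P0) = transpose (e P0) (e P4) \<circ> transpose (e P0) (e P3)"
    "embed5 e (Map5 P3 P1 P4 P0 P2) = transpose (e P0) (e P3) \<circ> transpose (e P2) (e P4)"
    "embed5 e (Map5 P3 P2 P1 P0 P4) = transpose (e P0) (e P3) \<circ> transpose (e P1) (e P2)"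
    "embed5 e (Map5 P3 P4 P2 P0 P1) = transpose (e P0) (e P3) \<circ> transpose (e P1) (e P4)"
    "embed5 e (Map5 P4 P0 P2 P3 P1) = transpose (e P0) (e P1) \<circ> transpose (e P0) (e P4)"
    "embed5 e (Map5 P4 P1 P0 P3 P2) = transpose (e P0) (e P2) \<circ> transpose (e P0) (e P4)"
    "embed5 e (Map5 P4 P1 P2 P0 P3) = transpose (e P0) (e P3) \<circ> transpose (e P0) (e P4)"
    "embed5 e (Map5 P4 P1 P3 P2 P0) = transpose (e P0) (e P4) \<circ> transpose (e P2) (e P3)"
    "embed5 e (Map5 P4 P2 P1 P3 P0) = transpose (e P0) (e P4) \<circ> transpose (e P1) (e P2)"
    "embed5 e (Map5 P4 P3 P2 P1 P0) = transpose (e P0) (e P4) \<circ> transpose (e P1) (e P3)"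
  by (rule embed5_transposes[OF assms], rename_tac i, case_tac i; simp add: Transposition.transpose_def)+

lemma sum_perms5_support:
  "(\<Sum>s\<in>set perms5. real_of_int (y s) * F s) =
    (\<Sum>(h, u)\<leftarrow>filter (\<lambda>(h, u). u \<noteq> 0) (map (\<lambda>h. (h, y h)) perms5). real_of_int u * F h)"
proof -
  have "(\<Sum>(h, u)\<leftarrow>filter (\<lambda>(h, u). u \<noteq> 0) (map (\<lambda>h. (h, y h)) xs). real_of_int u * F h)
      = (\<Sum>h\<leftarrow>xs. real_of_int (y h) * F h)" for xs
    by (induction xs) auto
  then show ?thesis by (simp add: sum_list_distinct_conv_sum_set distinct_perms5)
qed

text \<open>The quadratic form of \<open>12 p\<close>, with \<open>p\<close> as above for the four points \<open>i, j, k, l\<close>; each 3-cycle is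
  counted twice in place of its inverse.\<close>

definition quad_form :: "(('v \<Rightarrow> 'v) \<Rightarrow> real) \<Rightarrow> 'v \<Rightarrow> 'v \<Rightarrow> 'v \<Rightarrow> 'v \<Rightarrow> real" where
  "quad_form q i j k l = (if distinct [i, j, k, l] then
     2 * q id + 2 * (q (transpose i j \<circ> transpose k l) + q (transpose i k \<circ> transpose j l) + q (transpose i l \<circ> transpose j k))
     - 2 * (q (transpose i j \<circ> transpose i k) + q (transpose i j \<circ> transpose i l)
          + q (transpose i k \<circ> transpose i l) + q (transpose j k \<circ> transpose j l)) else 0)"

lemma inv_transposes: "inv' (transpose i j \<circ> transpose k l) = transpose k l \<circ> transpose i j"
  by (rule inv_unique_comp) (simp_all add: fun_eq_iff)

lemma corr_transposes_swap:
  assumes "i \<in> N" "j \<in> N" "k \<in> N" "l \<in> N"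
  shows "corr N f (transpose k l \<circ> transpose i j) = corr N f (transpose i j \<circ> transpose k l)"
  using corr_inv[of "transpose i j \<circ> transpose k l" N f] assms
  by (simp add: inv_transposes permutes_compose permutes_swap_id)

lemma quad_form_nonneg_aux:
  fixes e :: "point5 \<Rightarrow> 'v"
  assumes "finite N" "inj e" "{e P1, e P2, e P3, e P4} \<subseteq> N"
  shows "0 \<le> quad_form (corr N f) (e P1) (e P2) (e P3) (e P4)"
proof -
  have sw: "corr N f (transpose (e i) (e k) \<circ> transpose (e i) (e j)) = corr N f (transpose (e i) (e j) \<circ> transpose (e i) (e k))"
    if "{e i, e j, e k} \<subseteq> N" for i j k
    using that by (intro corr_transposes_swap) auto
  have "0 \<le> (\<Sum>s\<in>set perms5. real_of_int (coeff4 s) * corr N f (embed5 e s))"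
  proof (rule corr_gram_nonneg[OF assms(1,2) self_convolution_coeff4])
    fix s assume s: "s \<in> set perms5" "coeff4 s \<noteq> 0"
    then have "(s, coeff4 s) \<in> set (filter (\<lambda>(h, u). u \<noteq> 0) (map (\<lambda>h. (h, coeff4 h)) perms5))" by simp
    then show "embed5 e s permutes N" using assms(3) unfolding coeff4_support
      by (auto simp: embed5_id embed5_expand[OF assms(2)] intro!: permutes_compose permutes_swap_id)
  qed
  moreover have "distinct [e P1, e P2, e P3, e P4]" using assms(2) by (simp add: inj_eq)
  moreover note sw[of P1 P2 P3] sw[of P1 P2 P4] sw[of P1 P3 P4] sw[of P2 P3 P4]
  ultimately show ?thesis using assms(3)
    unfolding sum_perms5_support coeff4_support quad_form_def
    by (simp add: embed5_id embed5_expand[OF assms(2)])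
qed

text \<open>Each \<open>quad_form\<close> here belongs to 12 times the projection of the omitted
  point, so the right-hand side minus the left-hand side is the form of 2 \<open>coeff5\<close>. The
  3-cycles that fix P0 occur once on each side and cancel.\<close>

lemma quad_form_five_aux:
  fixes e :: "point5 \<Rightarrow> 'v"
  assumes "finite N" "inj e" "range e \<subseteq> N"
  shows "quad_form (corr N f) (e P1) (e P2) (e P3) (e P4) \<le>
     quad_form (corr N f) (e P0) (e P1) (e P2) (e P3) + quad_form (corr N f) (e P0) (e P1) (e P2) (e P4)
   + quad_form (corr N f) (e P0) (e P1) (e P3) (e P4) + quad_form (corr N f) (e P0) (e P2) (e P3) (e P4)"
proof -
  have eN: "e i \<in> N" for i using assms(3) by auto
  have sw: "corr N f (transpose (e i) (e k) \<circ> transpose (e i) (e j)) = corr N f (transpose (e i) (e j) \<circ> transpose (e i) (e k))" for i j k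
    by (intro corr_transposes_swap eN)
  have "0 \<le> (\<Sum>s\<in>set perms5. real_of_int (coeff5 s) * corr N f (embed5 e s))"
  proof (rule corr_gram_nonneg[OF assms(1,2) self_convolution_coeff5])
    fix s assume s: "s \<in> set perms5" "coeff5 s \<noteq> 0"
    then have "(s, coeff5 s) \<in> set (filter (\<lambda>(h, u). u \<noteq> 0) (map (\<lambda>h. (h, coeff5 h)) perms5))" by simp
    then show "embed5 e s permutes N" unfolding coeff5_support
      by (auto simp: embed5_id embed5_expand[OF assms(2)] intro!: permutes_compose permutes_swap_id eN)
  qed
  moreover have "i \<noteq> j \<Longrightarrow> e i \<noteq> e j" for i j using assms(2) by (simp add: inj_eq)
  moreover note sw[of P0 P1 P2] sw[of P0 P1 P3] sw[of P0 P1 P4] sw[of P0 P2 P3] sw[of P0 P2 P4] sw[of P0 P3 P4] sw[of P1 P2 P3] sw[of P1 P2 P4] sw[of P1 P3 P4] sw[of P2 P3 P4]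
  ultimately show ?thesis
    unfolding sum_perms5_support coeff5_support quad_form_def
    by (simp add: embed5_id embed5_expand[OF assms(2)])
qed

lemma quad_form_five:
  assumes "finite N" "{x, i, j, k, l} \<subseteq> N" "distinct [x, i, j, k, l]"
  shows "quad_form (corr N f) i j k l \<le>
     quad_form (corr N f) x i j k + quad_form (corr N f) x i j l
   + quad_form (corr N f) x i k l + quad_form (corr N f) x j k l"
proof -
  have "inj (case_point5 x i j k l)" using assms(3) by (auto simp: inj_on_def split: point5.splits)
  moreover have "range (case_point5 x i j k l) \<subseteq> N" using assms(2) by (auto split: point5.splits)
  ultimately show ?thesis using quad_form_five_aux[OF assms(1), of "case_point5 x i j k l" f] by simp
qed

lemma quad_form_nonneg:
  fixes i :: nat
  assumes "finite N" "{i, j, k, l} \<subseteq> N"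
  shows "0 \<le> quad_form (corr N f) i j k l"
proof (cases "distinct [i, j, k, l]")
  case True
  \<comment> \<open>The fifth point only completes the embedding and may lie outside N; a fresh one
    exists because the points are natural numbers.\<close>
  obtain x where x: "x \<notin> {i, j, k, l}" using ex_new_if_finite[of "{i, j, k, l}"] by auto
  have "inj (case_point5 x i j k l)" using x True by (auto simp: inj_on_def split: point5.splits)
  then show ?thesis using quad_form_nonneg_aux[OF assms(1), of "case_point5 x i j k l" f] assms(2) by simp
qed (auto simp: quad_form_def)

section \<open>The octopus inequality\<close>

lemma quad_form_nondistinct: "\<not> distinct [i, j, k, l] \<Longrightarrow> quad_form q i j k l = 0"
  unfolding quad_form_def by (rule if_not_P)

text \<open>The value at a 3-cycle. Since \<open>corr\<close> is invariant under inversion, for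
  distinct i, j, k it depends only on the set of the three points; the two swap lemmas below express
  this.\<close>

definition cycle_corr :: "'v set \<Rightarrow> (('v \<Rightarrow> 'v) \<Rightarrow> real) \<Rightarrow> 'v \<Rightarrow> 'v \<Rightarrow> 'v \<Rightarrow> real" where
  "cycle_corr N f i j k = corr N f (transpose i j \<circ> transpose i k)"

lemma cycle_corr_swap23:
  assumes "i \<in> N" "j \<in> N" "k \<in> N"
  shows "cycle_corr N f i k j = cycle_corr N f i j k"
  unfolding cycle_corr_def using assms by (intro corr_transposes_swap)

lemma cycle_corr_swap12:
  assumes "i \<in> N" "j \<in> N" "k \<in> N" "distinct [i, j, k]"
  shows "cycle_corr N f j i k = cycle_corr N f i j k"
proof -
  have "transpose j i \<circ> transpose j k = transpose i k \<circ> transpose i j"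
    using assms(4) by (auto simp: fun_eq_iff Transposition.transpose_def)
  then show ?thesis
    unfolding cycle_corr_def using corr_transposes_swap[of i N j i k f] assms by simp
qed

lemma corr_transposes_cycle:
  "corr N f (transpose a b \<circ> transpose a d) = cycle_corr N f a b d"
  "corr N f (transpose a b \<circ> transpose d a) = cycle_corr N f a b d"
  "corr N f (transpose a b \<circ> transpose b d) = cycle_corr N f b a d"
  "corr N f (transpose a b \<circ> transpose d b) = cycle_corr N f b a d"
  unfolding cycle_corr_def by (simp_all add: transpose_commute[of a b] transpose_commute[of d])

lemma cycle_corr_same: "cycle_corr N f a b b = corr N f id"
proof -
  have "transpose a b \<circ> transpose a b = id" by (simp add: fun_eq_iff)
  then show ?thesis unfolding cycle_corr_def by (rule arg_cong)
qed

section \<open>Forms of degree four in the weights\<close>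

definition sum4 :: "'v set \<Rightarrow> ('v \<Rightarrow> real) \<Rightarrow> ('v \<Rightarrow> 'v \<Rightarrow> 'v \<Rightarrow> 'v \<Rightarrow> real) \<Rightarrow> real" where
  "sum4 N c F = (\<Sum>i\<in>N. \<Sum>j\<in>N. \<Sum>k\<in>N. \<Sum>l\<in>N. c i * c j * c k * c l * F i j k l)"

lemma sum4_swap12: "sum4 N c (\<lambda>i j k l. F j i k l) = sum4 N c F"
  unfolding sum4_def by (subst sum.swap) (simp add: mult_ac)

lemma sum4_swap23: "sum4 N c (\<lambda>i j k l. F i k j l) = sum4 N c F"
  unfolding sum4_def by (rule sum.cong[OF refl], subst sum.swap) (simp add: mult_ac)

lemma sum4_swap34: "sum4 N c (\<lambda>i j k l. F i j l k) = sum4 N c F"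
  unfolding sum4_def by (rule sum.cong[OF refl], rule sum.cong[OF refl], subst sum.swap) (simp add: mult_ac)

lemma sum4_add: "sum4 N c (\<lambda>i j k l. F i j k l + G i j k l) = sum4 N c F + sum4 N c G"
  by (simp add: sum4_def sum.distrib distrib_left)

lemma sum4_cmult: "sum4 N c (\<lambda>i j k l. a * F i j k l) = a * sum4 N c F"
  by (simp add: sum4_def sum_distrib_left mult_ac)

lemma sum4_product:
  "(\<Sum>i\<in>N. \<Sum>j\<in>N. c i * c j * F i j) * (\<Sum>k\<in>N. \<Sum>l\<in>N. c k * c l * G k l) = sum4 N c (\<lambda>i j k l. F i j * G k l)"
  unfolding sum4_def sum_distrib_right unfolding sum_distrib_left by (intro sum.cong refl) (simp add: mult_ac)

lemma sum4_independent:
  assumes "sum c N = 0" shows "sum4 N c (\<lambda>i j k l. F i j k) = 0"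
proof -
  have "(\<Sum>l\<in>N. c i * c j * c k * c l * F i j k) = c i * c j * c k * F i j k * sum c N" for i j k
    by (subst sum_distrib_left) (simp add: mult_ac)
  then show ?thesis using assms by (simp add: sum4_def)
qed

definition pair_defect :: "'v set \<Rightarrow> (('v \<Rightarrow> 'v) \<Rightarrow> real) \<Rightarrow> 'v \<Rightarrow> 'v \<Rightarrow> 'v \<Rightarrow> 'v \<Rightarrow> real" where
  "pair_defect N f i j k l = (if i \<noteq> j \<and> k \<noteq> l then corr N f id - corr N f (transpose i j \<circ> transpose k l) else 0)"

definition cycle_defect :: "'v set \<Rightarrow> (('v \<Rightarrow> 'v) \<Rightarrow> real) \<Rightarrow> 'v \<Rightarrow> 'v \<Rightarrow> 'v \<Rightarrow> real" where
  "cycle_defect N f i j k = (if distinct [i, j, k] then corr N f id - cycle_corr N f i j k else 0)"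

text \<open>Holds also when indices coincide. Since the right-hand side is a sum of terms that each miss one index, it
  vanishes when summed against weights of total zero.\<close>

lemma pair_cycle_quad:
  assumes "i \<in> N" "j \<in> N" "k \<in> N" "l \<in> N"
  shows "pair_defect N f i j k l + pair_defect N f i k j l + pair_defect N f i l j k + 1/2 * quad_form (corr N f) i j k l
    = cycle_defect N f i j k + cycle_defect N f i j l + cycle_defect N f i k l + cycle_defect N f j k l"
proof (cases "distinct [i, j, k, l]")
  case True
  then show ?thesis
    by (simp add: pair_defect_def cycle_defect_def quad_form_def cycle_corr_def field_simps)
next
  case False
  note sw = cycle_corr_swap12[of _ N _ _ f] cycle_corr_swap23[of _ N _ _ f]
  from False consider "i = j" | "i = k" "i \<noteq> j" | "i = l" "i \<noteq> j" "i \<noteq> k"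
    | "j = k" "i \<noteq> j" | "j = l" "i \<noteq> j" "j \<noteq> k" | "k = l" "i \<noteq> k" "j \<noteq> k" "i \<noteq> j" by auto
  then show ?thesis
    by (cases; simp add: quad_form_nondistinct pair_defect_def cycle_defect_def corr_transposes_cycle cycle_corr_same assms sw)
qed

text \<open>The product of the weights is symmetric in the four indices, so the three pairings in
  \<open>pair_cycle_quad\<close> contribute equally, while each term on its right-hand side misses
  an index and sums to zero. Thus three times the left-hand side is minus one half of the sum of
  \<open>quad_form\<close>.\<close>

lemma sum4_pair_quad:
  assumes c0: "sum c N = 0"
  shows "sum4 N c (pair_defect N f) = - (1/6) * sum4 N c (quad_form (corr N f))"
proof -
  have "sum4 N c (\<lambda>i j k l. pair_defect N f i j k l + pair_defect N f i k j l + pair_defect N f i l j k + 1/2 * quad_form (corr N f) i j k l)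
      = sum4 N c (\<lambda>i j k l. cycle_defect N f i j k + cycle_defect N f i j l + cycle_defect N f i k l + cycle_defect N f j k l)"
    unfolding sum4_def by (intro sum.cong refl) (simp only: pair_cycle_quad)
  moreover have "sum4 N c (\<lambda>i j k l. pair_defect N f i l j k) = sum4 N c (pair_defect N f)"
    using sum4_swap34[of N c "\<lambda>i j k l. pair_defect N f i k j l"] sum4_swap23[of N c "pair_defect N f"] by simp
  moreover have "sum4 N c (\<lambda>i j k l. cycle_defect N f i j l) = 0"
    using sum4_swap34[of N c "\<lambda>i j k l. cycle_defect N f i j k"] sum4_independent[OF c0, of "cycle_defect N f"] by simp
  moreover have "sum4 N c (\<lambda>i j k l. cycle_defect N f i k l) = 0"
    using sum4_swap23[of N c "\<lambda>i j k l. cycle_defect N f i j l"] \<open>sum4 N c (\<lambda>i j k l. cycle_defect N f i j l) = 0\<close> by simp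
  moreover have "sum4 N c (\<lambda>i j k l. cycle_defect N f j k l) = 0"
    using sum4_swap12[of N c "\<lambda>i j k l. cycle_defect N f i k l"] \<open>sum4 N c (\<lambda>i j k l. cycle_defect N f i k l) = 0\<close> by simp
  ultimately show ?thesis
    using sum4_swap23[of N c "pair_defect N f"] sum4_independent[OF c0, of "cycle_defect N f"]
      sum4_cmult[of N c "1/2" "quad_form (corr N f)"]
    by (simp add: sum4_add)
qed

lemma quad_form_swap:
  assumes "i \<in> N" "j \<in> N" "k \<in> N" "l \<in> N"
  shows "quad_form (corr N f) j i k l = quad_form (corr N f) i j k l"
    and "quad_form (corr N f) i k j l = quad_form (corr N f) i j k l"
    and "quad_form (corr N f) i j l k = quad_form (corr N f) i j k l"
proof -
  note sw = cycle_corr_swap12[of _ N _ _ f] cycle_corr_swap23[of _ N _ _ f] corr_transposes_cycle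
  have sw2: "corr N f (transpose a b \<circ> transpose x y) = corr N f (transpose x y \<circ> transpose a b)"
    if "a \<in> N" "b \<in> N" "x \<in> N" "y \<in> N" for a b x y using that by (intro corr_transposes_swap)
  show "quad_form (corr N f) j i k l = quad_form (corr N f) i j k l"
    unfolding quad_form_def using assms
    by (auto simp: sw transpose_commute[of j i] sw2[of j k i l] sw2[of j l i k])
  show "quad_form (corr N f) i k j l = quad_form (corr N f) i j k l"
    unfolding quad_form_def using assms
    by (auto simp: sw transpose_commute[of k j])
  show "quad_form (corr N f) i j l k = quad_form (corr N f) i j k l"
    unfolding quad_form_def using assms
    by (auto simp: sw transpose_commute[of l k])
qed

text \<open>This eliminates \<open>c x\<close>, the only weight that may be negative in the
  application.\<close>

lemma sum_zero_difference:
  fixes c :: "'v \<Rightarrow> real"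
  assumes "finite N" "x \<in> N" "sum c N = 0"
  shows "(\<Sum>i\<in>N. c i * F i) = (\<Sum>i\<in>N - {x}. c i * (F i - F x))"
proof -
  have "c x = - sum c (N - {x})" using assms by (simp add: sum.remove[of N x])
  then have "c x * F x = - (\<Sum>i\<in>N - {x}. c i * F x)" by (simp add: sum_distrib_right)
  then show ?thesis using assms by (simp add: sum.remove[of N x] right_diff_distrib sum_subtractf)
qed

lemma sum_mult_diff:
  fixes c :: "'v \<Rightarrow> real"
  shows "(\<Sum>i\<in>A. c i * F i) - (\<Sum>i\<in>A. c i * G i) = (\<Sum>i\<in>A. c i * (F i - G i))"
  by (simp add: right_diff_distrib sum_subtractf)

text \<open>The weight at x is eliminated in all four indices. As \<open>quad_form\<close> vanishes
  at repeated indices, only terms with at most one x survive, and the coefficient of each product of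
  non-negative weights is one form without x minus four forms with x. For distinct i, j, k, l this
  is the five-point inequality; otherwise the first form is zero and the others are
  non-negative.\<close>

lemma octopus_sum4:
  fixes N :: "nat set"
  assumes "finite N" "x \<in> N" "sum c N = 0" "\<And>i. i \<in> N - {x} \<Longrightarrow> c i \<ge> 0"
  shows "sum4 N c (quad_form (corr N f)) \<le> 0"
proof -
  let ?Q = "quad_form (corr N f)" and ?A = "N - {x}"
  note d = sum_zero_difference[OF assms(1-3)]
  have "sum4 N c ?Q = (\<Sum>i\<in>N. c i * (\<Sum>j\<in>N. c j * (\<Sum>k\<in>N. c k * (\<Sum>l\<in>N. c l * ?Q i j k l))))"
    by (simp add: sum4_def sum_distrib_left mult_ac)
  also have "\<dots> = (\<Sum>i\<in>?A. c i * (\<Sum>j\<in>?A. c j * (\<Sum>k\<in>?A. c k * (\<Sum>l\<in>?A. c l *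
      (?Q i j k l - ?Q i j k x - ?Q i j x l - ?Q i x k l - ?Q x j k l)))))"
    unfolding d sum_mult_diff by (intro sum.cong refl arg_cong2[of _ _ _ _ "(*)"]) (simp add: quad_form_nondistinct)
  also have "\<dots> \<le> 0"
  proof -
    have "?Q i j k l - ?Q i j k x - ?Q i j x l - ?Q i x k l - ?Q x j k l \<le> 0"
      if "i \<in> ?A" "j \<in> ?A" "k \<in> ?A" "l \<in> ?A" for i j k l
    proof -
      have N: "i \<in> N" "j \<in> N" "k \<in> N" "l \<in> N" using that by auto
      note sw = quad_form_swap[where N = N and f = f]
      have e: "?Q i j k x = ?Q x i j k" "?Q i j x l = ?Q x i j l" "?Q i x k l = ?Q x i k l"
        using sw(1,2)[of i x] sw N assms(2) by metis+
      show ?thesis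
      proof (cases "distinct [i, j, k, l]")
        case True
        then have "distinct [x, i, j, k, l]" using that by auto
        then show ?thesis using quad_form_five[OF assms(1), of x i j k l f] N assms(2) e by simp
      next
        case False
        have "0 \<le> ?Q i j k x" "0 \<le> ?Q i j x l" "0 \<le> ?Q i x k l" "0 \<le> ?Q x j k l"
          using N assms(1,2) by (auto intro!: quad_form_nonneg)
        then show ?thesis using quad_form_nondistinct[OF False, of "corr N f"] by simp
      qed
    qed
    then show ?thesis
      by (intro sum_nonpos mult_nonneg_nonpos assms(4))
  qed
  finally show ?thesis .
qed

lemma sum_permutes_square_diff:
  assumes "finite N" "p permutes N"
  shows "(\<Sum>\<eta> | \<eta> permutes N. (f (\<eta> \<circ> p) - f \<eta>)\<^sup>2) = 2 * (corr N f id - corr N f p)"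
proof -
  have "(\<Sum>\<eta> | \<eta> permutes N. (f (\<eta> \<circ> p) - f \<eta>)\<^sup>2)
      = (\<Sum>\<eta> | \<eta> permutes N. f (\<eta> \<circ> p) * f (\<eta> \<circ> (p \<circ> id))) + corr N f id - 2 * corr N f p"
    unfolding corr_def sum_distrib_left sum_subtractf[symmetric] sum.distrib[symmetric]
    by (intro sum.cong refl) (simp add: power2_eq_square algebra_simps)
  then show ?thesis unfolding corr_shift[OF assms(2)] by simp
qed

text \<open>With \<open>c x\<close> redefined so that the weights sum to zero, the inequality says that
  \<open>T = \<Sum> c\<^sub>i c\<^sub>j (i j)\<close> over \<open>i \<noteq> j\<close> is bounded below by \<open>- \<Sum> c\<^sub>i\<^sup>2\<close>, which follows from a bound on \<open>T\<^sup>2\<close>.\<close>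

theorem octopus_inequality:
  fixes N :: "nat set" and f :: "(nat \<Rightarrow> nat) \<Rightarrow> real"
  defines "D i j \<equiv> (\<Sum>\<eta> | \<eta> permutes N. (f (\<eta> \<circ> transpose i j) - f \<eta>)\<^sup>2)"
  assumes fin: "finite N" and x: "x \<in> N" and pos: "\<And>i. i \<in> N - {x} \<Longrightarrow> c i \<ge> 0"
  shows "(\<Sum>i\<in>N - {x}. \<Sum>j\<in>N - {x}. c i * c j * D i j)
    \<le> 2 * sum c (N - {x}) * (\<Sum>i\<in>N - {x}. c i * D x i)"
proof -
  let ?A = "N - {x}"
  define c' where "c' = c(x := - sum c ?A)"
  have c'A: "c' i = c i" if "i \<in> ?A" for i using that by (auto simp: c'_def)
  have "sum c' N = c' x + sum c' ?A" using fin x by (simp add: sum.remove)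
  also have "sum c' ?A = sum c ?A" by (rule sum.cong) (auto simp: c'_def)
  finally have c0: "sum c' N = 0" by (simp add: c'_def)
  have pos': "c' i \<ge> 0" if "i \<in> ?A" for i using pos[OF that] c'A[OF that] by simp
  define s where "s = sum c ?A"
  define q1 where "q1 = corr N f id"
  \<comment> \<open>With T formed from the weights \<open>c'\<close>, \<open>g\<close> is T f and
    \<open>m\<close> is the sum of the coefficients of T. As the weights sum to zero,
    \<open>m\<close> is minus the sum of their squares.\<close>
  define m where "m = (\<Sum>i\<in>N. \<Sum>j\<in>N. c' i * c' j * of_bool (i \<noteq> j))"
  define g where "g \<eta> = (\<Sum>i\<in>N. \<Sum>j\<in>N. c' i * c' j * of_bool (i \<noteq> j) * f (\<eta> \<circ> transpose i j))" for \<eta>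
  have tp: "transpose i j permutes N" if "i \<in> N" "j \<in> N" for i j using that by (rule permutes_swap_id)
  have gg: "(\<Sum>\<eta> | \<eta> permutes N. (g \<eta>)\<^sup>2) = sum4 N c' (\<lambda>i j k l. of_bool (i \<noteq> j) * of_bool (k \<noteq> l) * corr N f (transpose i j \<circ> transpose k l))"
  proof -
    have "(\<Sum>\<eta> | \<eta> permutes N. (g \<eta>)\<^sup>2) = (\<Sum>\<eta> | \<eta> permutes N. sum4 N c' (\<lambda>i j k l. of_bool (i \<noteq> j) * of_bool (k \<noteq> l)
       * (f (\<eta> \<circ> transpose i j) * f (\<eta> \<circ> transpose k l))))"
      using sum4_product[of c' "\<lambda>i j. of_bool (i \<noteq> j) * f (\<eta> \<circ> transpose i j)" N "\<lambda>i j. of_bool (i \<noteq> j) * f (\<eta> \<circ> transpose i j)" for \<eta>]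
      unfolding g_def power2_eq_square by (simp add: mult_ac)
    also have "\<dots> = sum4 N c' (\<lambda>i j k l. of_bool (i \<noteq> j) * of_bool (k \<noteq> l)
       * (\<Sum>\<eta> | \<eta> permutes N. f (\<eta> \<circ> transpose i j) * f (\<eta> \<circ> transpose k l)))"
      unfolding sum4_def sum_distrib_left
      by (subst sum.swap, rule sum.cong[OF refl], subst sum.swap, rule sum.cong[OF refl],
          subst sum.swap, rule sum.cong[OF refl], subst sum.swap, rule sum.cong[OF refl], rule refl)
    also have "\<dots> = sum4 N c' (\<lambda>i j k l. of_bool (i \<noteq> j) * of_bool (k \<noteq> l) * corr N f (transpose i j \<circ> transpose k l))"
    proof -
      have "(\<Sum>\<eta> | \<eta> permutes N. f (\<eta> \<circ> transpose i j) * f (\<eta> \<circ> transpose k l)) = corr N f (transpose i j \<circ> transpose k l)"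
        if "i \<in> N" "j \<in> N" for i j k l
        using corr_shift[OF tp[OF that], of f "transpose i j \<circ> transpose k l"]
        by (simp add: o_assoc)
      then show ?thesis unfolding sum4_def by (intro sum.cong refl) simp
    qed
    finally show ?thesis .
  qed
  have "sum4 N c' (pair_defect N f) = sum4 N c' (\<lambda>i j k l. of_bool (i \<noteq> j) * of_bool (k \<noteq> l) * q1)
     - sum4 N c' (\<lambda>i j k l. of_bool (i \<noteq> j) * of_bool (k \<noteq> l) * corr N f (transpose i j \<circ> transpose k l))"
    unfolding sum4_def pair_defect_def sum_subtractf[symmetric] q1_def
    by (intro sum.cong refl) (simp add: algebra_simps)
  also have "sum4 N c' (\<lambda>i j k l. of_bool (i \<noteq> j) * of_bool (k \<noteq> l) * q1) = m\<^sup>2 * q1"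
    using sum4_product[of c' "\<lambda>i j. of_bool (i \<noteq> j)" N "\<lambda>i j. of_bool (i \<noteq> j)"]
      sum4_cmult[of N c' q1 "\<lambda>i j k l. of_bool (i \<noteq> j) * of_bool (k \<noteq> l)"]
    unfolding m_def power2_eq_square by (simp add: mult_ac)
  finally have "sum4 N c' (pair_defect N f) = m\<^sup>2 * q1 - (\<Sum>\<eta> | \<eta> permutes N. (g \<eta>)\<^sup>2)" unfolding gg .
  moreover have "0 \<le> sum4 N c' (pair_defect N f)"
    using octopus_sum4[OF fin x c0 pos', of f] by (simp add: sum4_pair_quad[OF c0])
  ultimately have gle: "(\<Sum>\<eta> | \<eta> permutes N. (g \<eta>)\<^sup>2) \<le> m\<^sup>2 * q1" by simp
  have q1: "q1 = (\<Sum>\<eta> | \<eta> permutes N. (f \<eta>)\<^sup>2)" by (simp add: q1_def corr_def power2_eq_square)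
  then have q1pos: "q1 \<ge> 0" by (simp add: sum_nonneg)
  have fg: "(\<Sum>\<eta> | \<eta> permutes N. f \<eta> * g \<eta>) = (\<Sum>i\<in>N. \<Sum>j\<in>N. c' i * c' j * of_bool (i \<noteq> j) * corr N f (transpose i j))"
    unfolding g_def corr_def sum_distrib_left
    by (subst sum.swap, rule sum.cong[OF refl], subst sum.swap, rule sum.cong[OF refl]) (simp add: mult_ac)
  \<comment> \<open>\<open>gle\<close> bounds the norm of T f by |m| times the norm of f. By
    Cauchy-Schwarz |<f, T f>| is at most |m| <f, f>, and since m is not positive this yields the
    lower bound m <f, f>.\<close>
  have "(\<Sum>\<eta> | \<eta> permutes N. f \<eta> * g \<eta>)\<^sup>2 \<le> q1 * (\<Sum>\<eta> | \<eta> permutes N. (g \<eta>)\<^sup>2)"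
    unfolding q1 by (rule Cauchy_Schwarz_ineq_sum)
  also have "\<dots> \<le> q1 * (m\<^sup>2 * q1)" using gle q1pos by (rule mult_left_mono)
  also have "\<dots> = (m * q1)\<^sup>2" by (simp add: power2_eq_square)
  finally have "\<bar>\<Sum>\<eta> | \<eta> permutes N. f \<eta> * g \<eta>\<bar> \<le> \<bar>m * q1\<bar>" by (simp add: abs_le_square_iff)
  moreover have "m \<le> 0"
  proof -
    have "m + (\<Sum>i\<in>N. (c' i)\<^sup>2) = (\<Sum>i\<in>N. \<Sum>j\<in>N. c' i * c' j)"
    proof -
      have "(\<Sum>i\<in>N. (c' i)\<^sup>2) = (\<Sum>i\<in>N. \<Sum>j\<in>N. c' i * c' j * of_bool (i = j))"
        using fin by (intro sum.cong refl) (simp add: power2_eq_square of_bool_def if_distrib cong: if_cong)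
      then show ?thesis unfolding m_def
        by (simp only: sum.distrib[symmetric]) (intro sum.cong refl, auto)
    qed
    also have "\<dots> = sum c' N * sum c' N" by (simp add: sum_product)
    finally have "m = - (\<Sum>i\<in>N. (c' i)\<^sup>2)" using c0 by simp
    then show ?thesis by (simp add: sum_nonneg)
  qed
  ultimately have fgm: "(\<Sum>\<eta> | \<eta> permutes N. f \<eta> * g \<eta>) \<ge> m * q1"
    using q1pos by (simp add: abs_mult abs_le_iff mult_nonpos_nonneg)
  have D: "D i j = 2 * (q1 - corr N f (transpose i j))" if "i \<in> N" "j \<in> N" for i j
    unfolding D_def q1_def using sum_permutes_square_diff[OF fin tp[OF that]] .
  have Dii: "D i i = 0" for i by (simp add: D_def)
  have "(\<Sum>i\<in>N. \<Sum>j\<in>N. c' i * c' j * D i j) = (\<Sum>i\<in>N. \<Sum>j\<in>N. 2 * (c' i * c' j * of_bool (i \<noteq> j) * q1 - c' i * c' j * of_bool (i \<noteq> j) * corr N f (transpose i j)))"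
    by (intro sum.cong refl) (auto simp: D q1_def algebra_simps)
  also have "\<dots> = 2 * (m * q1 - (\<Sum>\<eta> | \<eta> permutes N. f \<eta> * g \<eta>))"
    unfolding fg m_def by (simp only: sum_subtractf sum_distrib_left[symmetric] sum_distrib_right[symmetric])
  also have "\<dots> \<le> 0" using fgm by simp
  finally have "(\<Sum>i\<in>N. c' i * (\<Sum>j\<in>N. c' j * D i j)) \<le> 0"
    by (simp add: sum_distrib_left mult_ac)
  \<comment> \<open>Eliminating \<open>c' x\<close> returns to the original weights. The terms with
    \<open>D x i\<close> and with \<open>D x j\<close> each sum to \<open>s\<close> times the star
    at x, whence the factor 2 in the claim.\<close>
  then have "(\<Sum>i\<in>?A. c' i * (\<Sum>j\<in>?A. c' j * (D i j - D i x - D x j))) \<le> 0"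
    unfolding sum_zero_difference[OF fin x c0] sum_mult_diff by (simp add: Dii algebra_simps)
  also have "(\<Sum>i\<in>?A. c' i * (\<Sum>j\<in>?A. c' j * (D i j - D i x - D x j))) = (\<Sum>i\<in>?A. \<Sum>j\<in>?A. c i * c j * (D i j - D x i - D x j))"
    unfolding sum_distrib_left
    by (intro sum.cong refl) (simp add: c'A D_def transpose_commute[of _ x])
  also have "\<dots> = (\<Sum>i\<in>?A. \<Sum>j\<in>?A. c i * c j * D i j) - (\<Sum>i\<in>?A. \<Sum>j\<in>?A. c i * c j * D x i) - (\<Sum>i\<in>?A. \<Sum>j\<in>?A. c i * c j * D x j)"
    by (simp add: right_diff_distrib sum_subtractf)
  also have "(\<Sum>i\<in>?A. \<Sum>j\<in>?A. c i * c j * D x i) = s * (\<Sum>i\<in>?A. c i * D x i)"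
    unfolding s_def sum_product by (subst sum.swap) (simp add: mult_ac)
  also have "(\<Sum>i\<in>?A. \<Sum>j\<in>?A. c i * c j * D x j) = s * (\<Sum>i\<in>?A. c i * D x i)"
    unfolding s_def sum_product by (simp add: mult_ac)
  finally show ?thesis by (simp add: s_def)
qed

section \<open>Smallest eigenvalues of self-adjoint operators\<close>

lemma continuous_on_coordinate: "continuous_on X (\<lambda>v :: 'b \<Rightarrow> 'c :: topological_space. v b)"
  by (rule continuous_on_subset[OF continuous_on_product_coordinates]) simp

text \<open>Vectors are functions on a possibly infinite type, so compactness comes from Tychonoff's
  theorem, with singleton factors outside the index set.\<close>

lemma compact_finite_support_unit_ball:
  assumes "finite (I :: 'b set)"
  shows "compact {v :: 'b \<Rightarrow> complex. \<forall>b. v b \<in> (if b \<in> I then cball 0 1 else {0})}"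
proof -
  have "compactin (product_topology (\<lambda>i. euclidean) UNIV)
      (PiE UNIV (\<lambda>b. if b \<in> I then cball 0 1 else {0 :: complex}))"
    by (subst compactin_PiE) (simp add: compact_cball)
  then show ?thesis
    by (simp add: euclidean_product_topology compactin_euclidean_iff PiE_UNIV_domain Pi_def)
qed

lemma quadratic_nonneg_linear_zero:
  fixes A B :: real
  assumes "\<And>t. t\<^sup>2 * A + 2 * t * B \<ge> 0"
  shows "B = 0"
proof (rule ccontr)
  assume "B \<noteq> 0"
  show False
  proof (cases "A \<le> 0")
    case True
    have "B\<^sup>2 * A - 2 * B\<^sup>2 \<ge> 0" using assms[of "- B"] by (simp add: power2_eq_square)
    moreover have "B\<^sup>2 * A \<le> 0" using True by (simp add: mult_nonneg_nonpos)
    moreover have "B\<^sup>2 > 0" using \<open>B \<noteq> 0\<close> by simp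
    ultimately show False by linarith
  next
    case False
    then have "(- B / A)\<^sup>2 * A + 2 * (- B / A) * B = - (B\<^sup>2 / A)"
      by (simp add: field_simps power2_eq_square)
    moreover have "B\<^sup>2 / A > 0" using \<open>B \<noteq> 0\<close> False by simp
    ultimately show False using assms[of "- B / A"] by linarith
  qed
qed

text \<open>The Rayleigh quotient attains its minimum on the unit sphere of W, which is compact
  because W is closed and finitely supported. The first variation at a minimiser v says that Re <L v
  - e v, u> = 0 for all u in W; the choice u = L v - e v shows that v is an eigenvector.\<close>

lemma spectral_minimum:
  fixes I :: "'b set" and W :: "('b \<Rightarrow> complex) set" and L
  assumes fin: "finite I" and closed: "closed W"
    and supp: "\<And>v b. v \<in> W \<Longrightarrow> b \<notin> I \<Longrightarrow> v b = 0"
    and add: "\<And>u v. u \<in> W \<Longrightarrow> v \<in> W \<Longrightarrow> (\<lambda>b. u b + v b) \<in> W"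
    and scale: "\<And>z v. v \<in> W \<Longrightarrow> (\<lambda>b. z * v b) \<in> W"
    and Lcl: "\<And>v. v \<in> W \<Longrightarrow> L v \<in> W"
    and Ladd: "\<And>u v. u \<in> W \<Longrightarrow> v \<in> W \<Longrightarrow> L (\<lambda>b. u b + v b) = (\<lambda>b. L u b + L v b)"
    and Lscale: "\<And>z v. v \<in> W \<Longrightarrow> L (\<lambda>b. z * v b) = (\<lambda>b. z * L v b)"
    and sa: "\<And>u v. u \<in> W \<Longrightarrow> v \<in> W \<Longrightarrow> (\<Sum>b\<in>I. L u b * cnj (v b)) = (\<Sum>b\<in>I. u b * cnj (L v b))"
    and cont: "\<And>b. continuous_on W (\<lambda>v. L v b)"
    and ne: "v0 \<in> W" "v0 \<noteq> (\<lambda>b. 0)"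
  obtains e v where "v \<in> W" "v \<noteq> (\<lambda>b. 0)" "L v = (\<lambda>b. complex_of_real e * v b)"
    "\<And>u. u \<in> W \<Longrightarrow> e * (\<Sum>b\<in>I. (cmod (u b))\<^sup>2) \<le> Re (\<Sum>b\<in>I. L u b * cnj (u b))"
proof -
  define nn where "nn v = (\<Sum>b\<in>I. (cmod (v b))\<^sup>2)" for v :: "'b \<Rightarrow> complex"
  define q where "q v = Re (\<Sum>b\<in>I. L v b * cnj (v b))" for v
  define S where "S = W \<inter> {v. nn v = 1}"
  note cb = continuous_on_coordinate
  have cnn: "continuous_on X nn" for X
    unfolding nn_def by (intro continuous_intros cb)
  have nnpos: "nn v > 0" if v: "v \<in> W" "v \<noteq> (\<lambda>b. 0)" for v
  proof -
    obtain b where b: "v b \<noteq> 0" using v by auto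
    then have "b \<in> I" using supp v by blast
    then have "(cmod (v b))\<^sup>2 \<le> nn v"
      unfolding nn_def by (intro member_le_sum fin) auto
    moreover have "(cmod (v b))\<^sup>2 > 0" using b by simp
    ultimately show ?thesis by linarith
  qed
  have "closed {v. nn v = 1}"
    using continuous_closed_preimage_constant[OF cnn, of UNIV 1] by simp
  then have clS: "closed S" unfolding S_def by (intro closed_Int closed)
  have subS: "S \<subseteq> {v. \<forall>b. v b \<in> (if b \<in> I then cball 0 1 else {0})}"
  proof
    fix v assume v: "v \<in> S"
    have "cmod (v b) \<le> 1" if "b \<in> I" for b
    proof -
      have "(cmod (v b))\<^sup>2 \<le> nn v" unfolding nn_def using that by (intro member_le_sum fin) auto
      then have "(cmod (v b))\<^sup>2 \<le> 1\<^sup>2" using v by (simp add: S_def)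
      then show ?thesis by (rule power2_le_imp_le) simp
    qed
    then show "v \<in> {v. \<forall>b. v b \<in> (if b \<in> I then cball 0 1 else {0})}"
      using v supp by (auto simp: S_def dist_norm)
  qed
  have compS: "compact S"
    using compact_Int_closed[OF compact_finite_support_unit_ball[OF fin] clS] subS
    by (simp add: inf.absorb2)
  define s0 where "s0 = (\<lambda>b. complex_of_real (1 / sqrt (nn v0)) * v0 b)"
  have nns: "nn (\<lambda>b. z * v b) = (cmod z)\<^sup>2 * nn v" for z v
    by (simp add: nn_def norm_mult power_mult_distrib sum_distrib_left)
  have "s0 \<in> S" using nnpos[OF ne] scale[OF ne(1)]
    unfolding s0_def S_def by (auto simp: nns norm_divide power_divide simp del: of_real_divide)
  then have "S \<noteq> {}" by blast
  moreover have "continuous_on S q" unfolding q_def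
    by (intro continuous_intros cb continuous_on_subset[OF cont]) (auto simp: S_def)
  ultimately obtain v where v: "v \<in> S" and vmin: "\<And>u. u \<in> S \<Longrightarrow> q v \<le> q u"
    using continuous_attains_inf[OF compS] by blast
  have vW: "v \<in> W" and nv: "nn v = 1" using v by (auto simp: S_def)
  define e where "e = q v"
  have qs: "q (\<lambda>b. z * u b) = (cmod z)\<^sup>2 * q u" if "u \<in> W" for z u
  proof -
    have "(\<Sum>b\<in>I. z * L u b * (cnj z * cnj (u b))) = complex_of_real ((cmod z)\<^sup>2) * (\<Sum>b\<in>I. L u b * cnj (u b))"
      by (simp add: sum_distrib_left complex_norm_square mult_ac del: of_real_power)
    then show ?thesis using that by (simp add: q_def Lscale)
  qed
  have min: "e * nn u \<le> q u" if u: "u \<in> W" for u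
  proof (cases "u = (\<lambda>b. 0)")
    case True
    then show ?thesis by (simp add: q_def nn_def)
  next
    case False
    define r where "r = sqrt (nn u)"
    have r: "r > 0" "r\<^sup>2 = nn u" using nnpos[OF u False] by (auto simp: r_def)
    have "(\<lambda>b. complex_of_real (1 / r) * u b) \<in> S"
      using scale[OF u] r unfolding S_def by (auto simp: nns norm_divide power_divide simp del: of_real_divide)
    then have "e \<le> q u / r\<^sup>2" unfolding e_def
      using vmin[of "\<lambda>b. complex_of_real (1 / r) * u b"] u
      by (simp add: qs norm_divide power_divide del: of_real_divide)
    then show ?thesis unfolding r(2) using nnpos[OF u False] by (simp add: pos_le_divide_eq)
  qed
  have orth: "Re (\<Sum>b\<in>I. (L v b - complex_of_real e * v b) * cnj (u b)) = 0" if u: "u \<in> W" for u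
  proof (rule quadratic_nonneg_linear_zero)
    fix t :: real
    let ?w = "\<lambda>b. v b + complex_of_real t * u b"
    have w: "?w \<in> W" using add[OF vW scale[OF u]] .
    have Lw: "L ?w = (\<lambda>b. L v b + complex_of_real t * L u b)"
      using Ladd[OF vW scale[OF u]] Lscale[OF u] by simp
    have cr: "(\<Sum>b\<in>I. L u b * cnj (v b)) = cnj (\<Sum>b\<in>I. L v b * cnj (u b))"
      using sa[OF u vW] by (simp add: mult_ac)
    have "(\<Sum>b\<in>I. L ?w b * cnj (?w b)) = (\<Sum>b\<in>I. L v b * cnj (v b))
        + complex_of_real t * ((\<Sum>b\<in>I. L v b * cnj (u b)) + (\<Sum>b\<in>I. L u b * cnj (v b)))
        + complex_of_real (t\<^sup>2) * (\<Sum>b\<in>I. L u b * cnj (u b))"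
      unfolding Lw by (simp add: sum.distrib sum_distrib_left algebra_simps power2_eq_square)
    then have q1: "q ?w = q v + 2 * t * Re (\<Sum>b\<in>I. L v b * cnj (u b)) + t\<^sup>2 * q u"
      unfolding q_def cr by simp
    have nnc: "complex_of_real (nn x) = (\<Sum>b\<in>I. x b * cnj (x b))" for x
      by (simp add: nn_def complex_norm_square del: of_real_power)
    have "complex_of_real (nn ?w) = complex_of_real (nn v)
        + complex_of_real t * ((\<Sum>b\<in>I. v b * cnj (u b)) + cnj (\<Sum>b\<in>I. v b * cnj (u b)))
        + complex_of_real (t\<^sup>2) * complex_of_real (nn u)"
      unfolding nnc by (simp add: sum.distrib sum_distrib_left algebra_simps power2_eq_square)
    then have "Re (complex_of_real (nn ?w)) = Re (complex_of_real (nn v)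
        + complex_of_real t * ((\<Sum>b\<in>I. v b * cnj (u b)) + cnj (\<Sum>b\<in>I. v b * cnj (u b)))
        + complex_of_real (t\<^sup>2) * complex_of_real (nn u))" by simp
    then have n1: "nn ?w = nn v + 2 * t * Re (\<Sum>b\<in>I. v b * cnj (u b)) + t\<^sup>2 * nn u"
      by simp
    have sp: "(\<Sum>b\<in>I. (L v b - complex_of_real e * v b) * cnj (u b))
        = (\<Sum>b\<in>I. L v b * cnj (u b)) - complex_of_real e * (\<Sum>b\<in>I. v b * cnj (u b))"
      by (simp add: sum_subtractf sum_distrib_left algebra_simps)
    show "0 \<le> t\<^sup>2 * (q u - e * nn u) + 2 * t * Re (\<Sum>b\<in>I. (L v b - complex_of_real e * v b) * cnj (u b))"
      using min[OF w] unfolding q1 n1 nv sp by (simp add: e_def algebra_simps)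
  qed
  define d where "d = (\<lambda>b. L v b + (- complex_of_real e) * v b)"
  have d: "d \<in> W" unfolding d_def by (intro add scale Lcl vW)
  have "nn d = Re (\<Sum>b\<in>I. d b * cnj (d b))"
    by (simp add: nn_def complex_norm_square[symmetric] del: of_real_power)
  also have "\<dots> = 0" using orth[OF d] by (simp add: d_def)
  finally have "d = (\<lambda>b. 0)" using nnpos[OF d] by force
  then have "L v = (\<lambda>b. complex_of_real e * v b)" by (auto simp: d_def fun_eq_iff)
  moreover have "v \<noteq> (\<lambda>b. 0)" using nv by (auto simp: nn_def)
  ultimately show ?thesis using that[OF vW] min unfolding nn_def q_def by blast
qed

text \<open>\<open>psi\<close> is defined by \<open>Min\<close>, which is meaningful on finite sets.
  Eigenvectors for different eigenvalues are orthogonal, and there are at most \<open>card I\<close>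
  non-zero orthogonal vectors supported in I.\<close>

lemma finite_eigenvalues:
  fixes I :: "'b set" and W :: "('b \<Rightarrow> complex) set" and L
  assumes fin: "finite I"
    and supp: "\<And>v b. v \<in> W \<Longrightarrow> b \<notin> I \<Longrightarrow> v b = 0"
    and sa: "\<And>u v. u \<in> W \<Longrightarrow> v \<in> W \<Longrightarrow> (\<Sum>b\<in>I. L u b * cnj (v b)) = (\<Sum>b\<in>I. u b * cnj (L v b))"
  shows "finite {e :: real. \<exists>v\<in>W. v \<noteq> (\<lambda>b. 0) \<and> L v = (\<lambda>b. complex_of_real e * v b)}" (is "finite ?E")
proof -
  obtain V where V: "\<And>e. e \<in> ?E \<Longrightarrow> V e \<in> W \<and> V e \<noteq> (\<lambda>b. 0) \<and> L (V e) = (\<lambda>b. complex_of_real e * V e b)"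
    using bchoice[of ?E "\<lambda>e v. v \<in> W \<and> v \<noteq> (\<lambda>b. 0) \<and> L v = (\<lambda>b. complex_of_real e * v b)"] by blast
  define nn where "nn e = (\<Sum>b\<in>I. (cmod (V e b))\<^sup>2)" for e
  have pos: "nn e > 0" if "e \<in> ?E" for e
  proof -
    note v = V[OF that]
    obtain b where b: "V e b \<noteq> 0" using v by auto
    then have "b \<in> I" using supp v by blast
    then have "(cmod (V e b))\<^sup>2 \<le> nn e" unfolding nn_def by (intro member_le_sum fin) auto
    moreover have "(cmod (V e b))\<^sup>2 > 0" using b by simp
    ultimately show ?thesis by linarith
  qed
  have orth: "(\<Sum>b\<in>I. V e b * cnj (V e' b)) = 0" if "e \<in> ?E" "e' \<in> ?E" "e \<noteq> e'" for e e'
  proof -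
    have "complex_of_real e * (\<Sum>b\<in>I. V e b * cnj (V e' b)) = complex_of_real e' * (\<Sum>b\<in>I. V e b * cnj (V e' b))"
      using sa[of "V e" "V e'"] V[OF that(1)] V[OF that(2)]
      by (simp add: sum_distrib_left mult_ac)
    then show ?thesis using that(3) by simp
  qed
  have card: "card F \<le> card I" if F: "finite F" "F \<subseteq> ?E" for F
  proof -
    \<comment> \<open>Bessel's inequality for the basis vector at \<open>b\<close>, summed over \<open>b\<close>.\<close>
    have bessel: "(\<Sum>e\<in>F. (cmod (V e b))\<^sup>2 / nn e) \<le> 1" if b: "b \<in> I" for b
    proof -
      define g where "g e = cnj (V e b) / complex_of_real (nn e)" for e
      \<comment> \<open>\<open>p\<close> is the orthogonal projection of the basis vector at b onto
        the span of the chosen eigenvectors. Its square norm and its value at b both equal B, so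
        \<open>B\<^sup>2 \<le> B\<close>.\<close>
      define p where "p x = (\<Sum>e\<in>F. g e * V e x)" for x
      define B where "B = (\<Sum>e\<in>F. (cmod (V e b))\<^sup>2 / nn e)"
      have gV: "g e * V e b = complex_of_real ((cmod (V e b))\<^sup>2 / nn e)" for e
        unfolding g_def of_real_divide complex_norm_square by simp
      have B: "complex_of_real B = p b" unfolding B_def p_def gV by simp
      have "(\<Sum>x\<in>I. p x * cnj (p x)) = (\<Sum>x\<in>I. \<Sum>e\<in>F. \<Sum>e'\<in>F. g e * cnj (g e') * (V e x * cnj (V e' x)))"
        unfolding p_def cnj_sum sum_product complex_cnj_mult by (simp only: mult.assoc mult.left_commute)
      also have "\<dots> = (\<Sum>e\<in>F. \<Sum>x\<in>I. \<Sum>e'\<in>F. g e * cnj (g e') * (V e x * cnj (V e' x)))"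
        by (rule sum.swap)
      also have "\<dots> = (\<Sum>e\<in>F. \<Sum>e'\<in>F. g e * cnj (g e') * (\<Sum>x\<in>I. V e x * cnj (V e' x)))"
        by (subst sum.swap) (simp only: sum_distrib_left)
      also have "\<dots> = (\<Sum>e\<in>F. \<Sum>e'\<in>F. if e = e' then complex_of_real ((cmod (V e b))\<^sup>2 / nn e) else 0)"
      proof (intro sum.cong refl)
        fix e e' assume e: "e \<in> F" "e' \<in> F"
        have n: "nn e \<noteq> 0" using pos e F by force
        have "(\<Sum>x\<in>I. V e x * cnj (V e x)) = complex_of_real (nn e)"
          by (simp add: nn_def complex_norm_square del: of_real_power)
        moreover have "g e * cnj (g e) * complex_of_real (nn e) = g e * V e b"
          using n by (simp add: g_def)
        ultimately have "g e * cnj (g e) * (\<Sum>x\<in>I. V e x * cnj (V e x)) = complex_of_real ((cmod (V e b))\<^sup>2 / nn e)"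
          using gV[of e] by presburger
        moreover have "(\<Sum>x\<in>I. V e x * cnj (V e' x)) = 0" if "e \<noteq> e'"
          using e F(2) that by (intro orth) blast+
        ultimately show "g e * cnj (g e') * (\<Sum>x\<in>I. V e x * cnj (V e' x)) = (if e = e' then complex_of_real ((cmod (V e b))\<^sup>2 / nn e) else 0)"
          by (cases "e = e'") simp_all
      qed
      also have "\<dots> = complex_of_real B" using F(1) by (simp add: B_def)
      finally have "complex_of_real (\<Sum>x\<in>I. (cmod (p x))\<^sup>2) = complex_of_real B"
        by (simp add: complex_norm_square del: of_real_power)
      then have "(\<Sum>x\<in>I. (cmod (p x))\<^sup>2) = B" by (simp only: of_real_eq_iff)
      moreover have "(cmod (p b))\<^sup>2 \<le> (\<Sum>x\<in>I. (cmod (p x))\<^sup>2)"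
        using b by (intro member_le_sum fin) auto
      ultimately have "B\<^sup>2 \<le> B" using B[symmetric] by simp
      then have "B \<le> 0 \<or> B \<le> 1" using mult_le_cancel_right1[of B B] by (auto simp: power2_eq_square)
      then show ?thesis unfolding B_def[symmetric] by linarith
    qed
    have "real (card F) = (\<Sum>e\<in>F. nn e / nn e)" using pos F(2) by (subst sum.cong[of _ F _ "\<lambda>_. 1"]) force+
    also have "\<dots> = (\<Sum>b\<in>I. \<Sum>e\<in>F. (cmod (V e b))\<^sup>2 / nn e)"
      by (subst sum.swap) (simp only: nn_def sum_divide_distrib)
    also have "\<dots> \<le> (\<Sum>b\<in>I. 1)" by (intro sum_mono bessel)
    finally show ?thesis by simp
  qed
  show ?thesis
  proof (rule ccontr)
    assume "infinite ?E"
    then obtain F where "finite F" "card F = Suc (card I)" "F \<subseteq> ?E"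
      using infinite_arbitrarily_large by blast
    then show False using card[of F] by simp
  qed
qed

section \<open>The interchange process\<close>

lemma sum_square_recentre:
  fixes v :: "'v \<Rightarrow> real"
  assumes "finite N" "N \<noteq> {}"
  shows "(\<Sum>i\<in>N. (v i - sum v N / real (card N))\<^sup>2) = (\<Sum>i\<in>N. (v i)\<^sup>2) - (sum v N)\<^sup>2 / real (card N)"
proof -
  define n where "n = real (card N)"
  have n: "n > 0" using assms by (simp add: n_def card_gt_0_iff)
  have "(\<Sum>i\<in>N. (v i - sum v N / n)\<^sup>2) = (\<Sum>i\<in>N. (v i)\<^sup>2 - 2 * (sum v N / n) * v i + (sum v N / n)\<^sup>2)"
    by (intro sum.cong refl) (simp add: power2_eq_square algebra_simps)
  also have "\<dots> = (\<Sum>i\<in>N. (v i)\<^sup>2) - 2 * (sum v N / n) * sum v N + n * (sum v N / n)\<^sup>2"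
    by (simp add: sum.distrib sum_subtractf sum_distrib_left n_def)
  also have "\<dots> = (\<Sum>i\<in>N. (v i)\<^sup>2) - (sum v N)\<^sup>2 / n"
    using n by (simp add: power2_eq_square field_simps)
  finally show ?thesis by (simp add: n_def)
qed

text \<open>The energy depends only on differences, so subtracting the mean changes the square norm
  alone.\<close>

lemma poincare_recentre:
  fixes v :: "'v \<Rightarrow> real"
  assumes "finite N" "N \<noteq> {}"
    and "\<And>v. sum v N = 0 \<Longrightarrow> \<mu> * (\<Sum>i\<in>N. (v i)\<^sup>2) \<le> (\<Sum>i\<in>N. \<Sum>j\<in>N. a i j * (v i - v j)\<^sup>2) / 2"
  shows "\<mu> * ((\<Sum>i\<in>N. (v i)\<^sup>2) - (sum v N)\<^sup>2 / real (card N)) \<le> (\<Sum>i\<in>N. \<Sum>j\<in>N. a i j * (v i - v j)\<^sup>2) / 2"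
proof -
  have "sum (\<lambda>i. v i - sum v N / real (card N)) N = 0"
    using assms(1,2) by (simp add: sum_subtractf)
  from assms(3)[OF this] show ?thesis
    by (simp add: sum_square_recentre[OF assms(1,2)])
qed

lemma sum_pairs_remove:
  fixes g :: "'v \<Rightarrow> 'v \<Rightarrow> real"
  assumes "finite N" "x \<in> N" "g x x = 0" "\<And>i. i \<in> N \<Longrightarrow> g i x = g x i"
  shows "(\<Sum>i\<in>N. \<Sum>j\<in>N. g i j) = (\<Sum>i\<in>N - {x}. \<Sum>j\<in>N - {x}. g i j) + 2 * (\<Sum>i\<in>N - {x}. g x i)"
proof -
  have "(\<Sum>i\<in>N. \<Sum>j\<in>N. g i j) = (\<Sum>j\<in>N. g x j) + (\<Sum>i\<in>N - {x}. \<Sum>j\<in>N. g i j)"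
    by (rule sum.remove[OF assms(1,2)])
  also have "(\<Sum>j\<in>N. g x j) = (\<Sum>i\<in>N - {x}. g x i)"
    using sum.remove[OF assms(1,2), of "g x"] assms(3) by simp
  also have "(\<Sum>i\<in>N - {x}. \<Sum>j\<in>N. g i j) = (\<Sum>i\<in>N - {x}. g x i + (\<Sum>j\<in>N - {x}. g i j))"
  proof (intro sum.cong refl)
    fix i assume "i \<in> N - {x}"
    then show "(\<Sum>j\<in>N. g i j) = g x i + (\<Sum>j\<in>N - {x}. g i j)"
      using sum.remove[OF assms(1,2), of "g i"] assms(4) by simp
  qed
  finally show ?thesis by (simp add: sum.distrib)
qed

lemma weighted_variance:
  fixes u c :: "'v \<Rightarrow> real"
  shows "(\<Sum>i\<in>A. \<Sum>j\<in>A. c i * c j * (u i - u j)\<^sup>2) / 2 = sum c A * (\<Sum>i\<in>A. c i * (u i)\<^sup>2) - (\<Sum>i\<in>A. c i * u i)\<^sup>2"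
proof -
  have "(\<Sum>i\<in>A. \<Sum>j\<in>A. c i * c j * (u i - u j)\<^sup>2)
    = (\<Sum>i\<in>A. \<Sum>j\<in>A. c j * (c i * (u i)\<^sup>2)) + (\<Sum>i\<in>A. \<Sum>j\<in>A. c i * (c j * (u j)\<^sup>2)) - 2 * (\<Sum>i\<in>A. \<Sum>j\<in>A. (c i * u i) * (c j * u j))"
    unfolding sum_distrib_left sum_subtractf[symmetric] sum.distrib[symmetric]
    by (intro sum.cong refl) (simp add: power2_eq_square algebra_simps)
  also have "(\<Sum>i\<in>A. \<Sum>j\<in>A. c j * (c i * (u i)\<^sup>2)) = sum c A * (\<Sum>i\<in>A. c i * (u i)\<^sup>2)"
    unfolding sum_product by (rule sum.swap)
  also have "(\<Sum>i\<in>A. \<Sum>j\<in>A. c i * (c j * (u j)\<^sup>2)) = sum c A * (\<Sum>i\<in>A. c i * (u i)\<^sup>2)"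
    unfolding sum_product ..
  also have "(\<Sum>i\<in>A. \<Sum>j\<in>A. (c i * u i) * (c j * u j)) = (\<Sum>i\<in>A. c i * u i)\<^sup>2"
    unfolding sum_product power2_eq_square ..
  finally show ?thesis by simp
qed

text \<open>The star-mesh reduction: the test function is extended harmonically to the removed vertex.\<close>

lemma poincare_star_mesh:
  fixes a :: "'v \<Rightarrow> 'v \<Rightarrow> real" and u :: "'v \<Rightarrow> real"
  assumes fin: "finite N" and x: "x \<in> N"
    and sym: "\<And>i j. i \<in> N \<Longrightarrow> j \<in> N \<Longrightarrow> a i j = a j i"
    and pos: "\<And>i j. i \<in> N \<Longrightarrow> j \<in> N \<Longrightarrow> a i j \<ge> 0"
    and gap: "\<And>v. sum v N = 0 \<Longrightarrow> \<mu> * (\<Sum>i\<in>N. (v i)\<^sup>2) \<le> (\<Sum>i\<in>N. \<Sum>j\<in>N. a i j * (v i - v j)\<^sup>2) / 2"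
    and s: "(\<Sum>i\<in>N - {x}. a x i) > 0"
    and u: "sum u (N - {x}) = 0"
  shows "\<mu> * (\<Sum>i\<in>N - {x}. (u i)\<^sup>2) \<le>
    (\<Sum>i\<in>N - {x}. \<Sum>j\<in>N - {x}. (a i j + a x i * a x j / (\<Sum>k\<in>N - {x}. a x k)) * (u i - u j)\<^sup>2) / 2"
    (is "_ \<le> ?R")
proof -
  let ?A = "N - {x}"
  define s where "s = (\<Sum>i\<in>?A. a x i)"
  define m where "m = (\<Sum>i\<in>?A. a x i * u i) / s"
  define v where "v = u(x := m)"
  have s0: "s > 0" using assms(6) by (simp add: s_def)
  have vA: "v i = u i" if "i \<in> ?A" for i using that by (auto simp: v_def)
  have ms: "(\<Sum>i\<in>?A. a x i * u i) = m * s" using s0 by (simp add: m_def)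
  have star: "(\<Sum>i\<in>?A. a x i * (m - u i)\<^sup>2) = (\<Sum>i\<in>?A. a x i * (u i)\<^sup>2) - s * m\<^sup>2"
  proof -
    have "(\<Sum>i\<in>?A. a x i * (m - u i)\<^sup>2) = (\<Sum>i\<in>?A. m\<^sup>2 * a x i - 2 * m * (a x i * u i) + a x i * (u i)\<^sup>2)"
      by (intro sum.cong refl) (simp add: power2_eq_square algebra_simps)
    also have "\<dots> = m\<^sup>2 * s - 2 * m * (m * s) + (\<Sum>i\<in>?A. a x i * (u i)\<^sup>2)"
      by (simp only: sum.distrib sum_subtractf sum_distrib_left[symmetric] ms s_def[symmetric])
    finally show ?thesis by (simp add: power2_eq_square algebra_simps)
  qed
  have "(\<Sum>i\<in>N. \<Sum>j\<in>N. a i j * (v i - v j)\<^sup>2) = (\<Sum>i\<in>?A. \<Sum>j\<in>?A. a i j * (v i - v j)\<^sup>2) + 2 * (\<Sum>i\<in>?A. a x i * (v x - v i)\<^sup>2)"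
    using sym[OF _ x] by (intro sum_pairs_remove fin x) (auto simp: power2_commute)
  also have "(\<Sum>i\<in>?A. \<Sum>j\<in>?A. a i j * (v i - v j)\<^sup>2) = (\<Sum>i\<in>?A. \<Sum>j\<in>?A. a i j * (u i - u j)\<^sup>2)"
    by (intro sum.cong refl) (simp add: vA)
  also have "(\<Sum>i\<in>?A. a x i * (v x - v i)\<^sup>2) = (\<Sum>i\<in>?A. a x i * (m - u i)\<^sup>2)"
    by (intro sum.cong refl) (auto simp: v_def)
  finally have Ev: "(\<Sum>i\<in>N. \<Sum>j\<in>N. a i j * (v i - v j)\<^sup>2) / 2
      = (\<Sum>i\<in>?A. \<Sum>j\<in>?A. a i j * (u i - u j)\<^sup>2) / 2 + ((\<Sum>i\<in>?A. a x i * (u i)\<^sup>2) - s * m\<^sup>2)"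
    by (simp add: star)
  \<comment> \<open>By \<open>weighted_variance\<close> the mesh has exactly the energy of the star
    when x carries the weighted mean \<open>m\<close>.\<close>
  have "?R = (\<Sum>i\<in>?A. \<Sum>j\<in>?A. a i j * (u i - u j)\<^sup>2) / 2 + (\<Sum>i\<in>?A. \<Sum>j\<in>?A. a x i * a x j * (u i - u j)\<^sup>2) / 2 / s"
    unfolding s_def[symmetric] sum_divide_distrib sum.distrib[symmetric]
    by (intro sum.cong refl) (simp add: algebra_simps add_divide_distrib)
  also have "\<dots> = (\<Sum>i\<in>?A. \<Sum>j\<in>?A. a i j * (u i - u j)\<^sup>2) / 2 + ((\<Sum>i\<in>?A. a x i * (u i)\<^sup>2) - s * m\<^sup>2)"
    unfolding weighted_variance ms s_def[symmetric] using s0 by (simp add: power2_eq_square field_simps)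
  finally have ER: "?R = (\<Sum>i\<in>N. \<Sum>j\<in>N. a i j * (v i - v j)\<^sup>2) / 2" using Ev by simp
  show ?thesis
  proof (cases "\<mu> \<le> 0")
    case True
    then have "\<mu> * (\<Sum>i\<in>?A. (u i)\<^sup>2) \<le> 0" by (intro mult_nonpos_nonneg sum_nonneg) auto
    also have "0 \<le> ?R" unfolding ER by (auto intro!: divide_nonneg_pos sum_nonneg mult_nonneg_nonneg pos)
    finally show ?thesis .
  next
    case False
    \<comment> \<open>The extension has total m, so subtracting its mean costs
      \<open>m\<^sup>2 / card N\<close>. This is at most the \<open>m\<^sup>2\<close> that the
      vertex x adds to the square norm, so for positive \<mu> the gap is kept.\<close>
    have "sum v N = m" using sum.remove[OF fin x, of v] u sum.cong[OF refl vA, of ?A] by (simp add: v_def)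
    moreover have "(\<Sum>i\<in>N. (v i)\<^sup>2) = m\<^sup>2 + (\<Sum>i\<in>?A. (u i)\<^sup>2)"
      using sum.remove[OF fin x, of "\<lambda>i. (v i)\<^sup>2"] by (simp add: v_def)
    moreover have "m\<^sup>2 / real (card N) \<le> m\<^sup>2"
      using fin x by (cases "card N") (auto simp: field_simps)
    ultimately have "(\<Sum>i\<in>?A. (u i)\<^sup>2) \<le> (\<Sum>i\<in>N. (v i)\<^sup>2) - (sum v N)\<^sup>2 / real (card N)" by simp
    then have "\<mu> * (\<Sum>i\<in>?A. (u i)\<^sup>2) \<le> \<mu> * ((\<Sum>i\<in>N. (v i)\<^sup>2) - (sum v N)\<^sup>2 / real (card N))"
      using False by (intro mult_left_mono) auto
    also have "\<dots> \<le> ?R" unfolding ER using x by (intro poincare_recentre fin gap) auto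
    finally show ?thesis .
  qed
qed

section \<open>Dirichlet forms on permutations and one-particle marginals\<close>

definition swap_energy :: "'v set \<Rightarrow> ('v \<Rightarrow> 'v \<Rightarrow> real) \<Rightarrow> (('v \<Rightarrow> 'v) \<Rightarrow> real) \<Rightarrow> real" where
  "swap_energy N a F = (\<Sum>i\<in>N. \<Sum>j\<in>N. a i j * (\<Sum>p | p permutes N. (F (p \<circ> transpose i j) - F p)\<^sup>2)) / 4"

lemma swap_energy_nonneg:
  assumes "\<And>i j. i \<in> N \<Longrightarrow> j \<in> N \<Longrightarrow> a i j \<ge> 0"
  shows "swap_energy N a F \<ge> 0"
  unfolding swap_energy_def
  by (intro divide_nonneg_pos sum_nonneg mult_nonneg_nonneg assms) auto

text \<open>The divisor 4 in \<open>swap_energy\<close> combines the factor 1/2 of a Dirichlet form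
  with another 1/2 because the sum runs over ordered pairs; it makes the energy equal to <L F, F>
  for the generator with the divisor 2.\<close>

lemma swap_energy_eq:
  fixes a :: "'v \<Rightarrow> 'v \<Rightarrow> real"
  assumes "finite N"
  shows "swap_energy N a F = (\<Sum>p | p permutes N. (\<Sum>i\<in>N. \<Sum>j\<in>N. a i j * (F p - F (p \<circ> transpose i j))) / 2 * F p)"
proof -
  have "(\<Sum>p | p permutes N. (F (p \<circ> transpose i j) - F p)\<^sup>2) = 2 * (\<Sum>p | p permutes N. (F p - F (p \<circ> transpose i j)) * F p)"
    if "i \<in> N" "j \<in> N" for i j
    using sum_permutes_square_diff[OF assms permutes_swap_id[OF that], of F]
    by (simp add: corr_def left_diff_distrib right_diff_distrib sum_subtractf mult.commute)
  then have "swap_energy N a F = (\<Sum>i\<in>N. \<Sum>j\<in>N. a i j * (2 * (\<Sum>p | p permutes N. (F p - F (p \<circ> transpose i j)) * F p))) / 4"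
    unfolding swap_energy_def by simp
  also have "\<dots> = (\<Sum>i\<in>N. \<Sum>j\<in>N. \<Sum>p | p permutes N. a i j * (F p - F (p \<circ> transpose i j)) / 2 * F p)"
    unfolding sum_distrib_left sum_divide_distrib by (intro sum.cong refl) simp
  also have "\<dots> = (\<Sum>p | p permutes N. \<Sum>i\<in>N. \<Sum>j\<in>N. a i j * (F p - F (p \<circ> transpose i j)) / 2 * F p)"
    by (subst sum.swap[of _ _ N], rule sum.swap)
  finally show ?thesis by (simp add: sum_divide_distrib sum_distrib_right)
qed

text \<open>Letting the transpositions act on points gives the generator of the random walk. A swap
  changes v only at i and j, where the two terms add up to
  \<open>(v i - v j)\<^sup>2\<close>.\<close>

lemma energy_eq_transpose:
  fixes v :: "'v \<Rightarrow> real"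
  assumes "finite N"
  shows "(\<Sum>y\<in>N. (\<Sum>i\<in>N. \<Sum>j\<in>N. a i j * (v y - v (transpose i j y))) / 2 * v y) = (\<Sum>i\<in>N. \<Sum>j\<in>N. a i j * (v i - v j)\<^sup>2) / 2"
proof -
  have 1: "(\<Sum>y\<in>N. (v y - v (transpose i j y)) * v y) = (v i - v j)\<^sup>2" if "i \<in> N" "j \<in> N" for i j
  proof (cases "i = j")
    case False
    have "(\<Sum>y\<in>N. (v y - v (transpose i j y)) * v y) = (\<Sum>y\<in>{i, j}. (v y - v (transpose i j y)) * v y)"
      using that assms by (intro sum.mono_neutral_right) auto
    then show ?thesis using False by (simp add: power2_eq_square algebra_simps)
  qed simp
  have "(\<Sum>y\<in>N. (\<Sum>i\<in>N. \<Sum>j\<in>N. a i j * (v y - v (transpose i j y))) / 2 * v y)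
    = (\<Sum>y\<in>N. \<Sum>i\<in>N. \<Sum>j\<in>N. a i j * ((v y - v (transpose i j y)) * v y)) / 2"
    unfolding sum_divide_distrib sum_distrib_right by (intro sum.cong refl) simp
  also have "(\<Sum>y\<in>N. \<Sum>i\<in>N. \<Sum>j\<in>N. a i j * ((v y - v (transpose i j y)) * v y))
     = (\<Sum>i\<in>N. \<Sum>j\<in>N. \<Sum>y\<in>N. a i j * ((v y - v (transpose i j y)) * v y))"
    by (subst sum.swap, rule sum.cong[OF refl], rule sum.swap)
  also have "\<dots> = (\<Sum>i\<in>N. \<Sum>j\<in>N. a i j * (v i - v j)\<^sup>2)"
    unfolding sum_distrib_left[symmetric] using 1 by simp
  finally show ?thesis .
qed

definition marginal :: "'v set \<Rightarrow> (('v \<Rightarrow> 'v) \<Rightarrow> real) \<Rightarrow> 'v \<Rightarrow> 'v \<Rightarrow> real" where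
  "marginal N F k y = (\<Sum>p | p permutes N. of_bool (p y = k) * F p)"

lemma sum_marginal:
  assumes "finite N" "k \<in> N"
  shows "(\<Sum>y\<in>N. marginal N F k y) = (\<Sum>p | p permutes N. F p)"
proof -
  have "(\<Sum>y\<in>N. of_bool (p y = k) * F p) = F p" if p: "p permutes N" for p
  proof -
    obtain y where y: "y \<in> N" "p y = k" using p assms(2) permutes_image[OF p] by (metis imageE)
    have "(\<Sum>z\<in>N. of_bool (p z = k) * F p) = (\<Sum>z\<in>N. if z = y then F p else 0)"
      using y permutes_inj[OF p] by (intro sum.cong refl) (auto simp: inj_eq)
    then show ?thesis using assms(1) y by simp
  qed
  then show ?thesis unfolding marginal_def by (subst sum.swap) simp
qed

text \<open>For fixed k the marginal sees a permutation only through the position y with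
  \<open>p y = k\<close>, and composition on the right permutes positions. Hence it intertwines the
  interchange generator with that of the random walk.\<close>

lemma marginal_transpose:
  assumes "i \<in> N" "j \<in> N"
  shows "marginal N (\<lambda>p. F (p \<circ> transpose i j)) k y = marginal N F k (transpose i j y)"
  unfolding marginal_def
  by (subst sum_permutations_compose_right[OF permutes_swap_id[OF assms], of "\<lambda>p. of_bool (p (transpose i j y) = k) * F p"])
    simp

text \<open>The permutations with \<open>p x = k\<close> are those of A composed on the left with
  \<open>transpose x k\<close>. A vanishing marginal at x therefore gives the mean-zero condition
  that the induction hypothesis on A needs.\<close>

lemma marginal_insert:
  assumes "finite A" "x \<notin> A" "k \<in> insert x A"
  shows "marginal (insert x A) F k x = (\<Sum>q | q permutes A. F (transpose x k \<circ> q))"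
proof -
  have qx: "q x = x" if "q permutes A" for q using that assms(2) by (rule permutes_not_in)
  have "marginal (insert x A) F k x = (\<Sum>b\<in>insert x A. \<Sum>q | q permutes A. of_bool ((transpose x b \<circ> q) x = k) * F (transpose x b \<circ> q))"
    unfolding marginal_def by (rule sum_over_permutations_insert[OF assms(1,2)])
  also have "\<dots> = (\<Sum>b\<in>insert x A. if b = k then (\<Sum>q | q permutes A. F (transpose x b \<circ> q)) else 0)"
    by (intro sum.cong refl) (simp add: qx)
  also have "\<dots> = (\<Sum>q | q permutes A. F (transpose x k \<circ> q))"
    using assms by (simp only: sum.delta finite_insert if_True)
  finally show ?thesis .
qed

text \<open>The induction needs an eigenfunction, since only then do the marginals satisfy an
  eigenvalue equation. It is taken for the smallest eigenvalue on mean-zero functions, so that e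
  also bounds the energy of F. The minimiser is complex, but the rates are real, so whichever of its
  real and imaginary parts is non-zero at \<open>p0\<close> serves.\<close>

lemma interchange_eigenfunction:
  fixes N :: "'v set" and a :: "'v \<Rightarrow> 'v \<Rightarrow> real"
  assumes fin: "finite N" and F0: "F0 permutes N" "F F0 \<noteq> 0" and F: "(\<Sum>p | p permutes N. F p) = (0 :: real)"
  obtains e F1 where "(\<Sum>p | p permutes N. F1 p) = (0 :: real)"
    "\<exists>p. p permutes N \<and> F1 p \<noteq> 0"
    "\<And>p. p permutes N \<Longrightarrow> (\<Sum>i\<in>N. \<Sum>j\<in>N. a i j * (F1 p - F1 (p \<circ> transpose i j))) / 2 = e * F1 p"
    "e * (\<Sum>p | p permutes N. (F p)\<^sup>2) \<le> swap_energy N a F"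
proof -
  let ?I = "{p. p permutes N}"
  define W where "W = {v :: ('v \<Rightarrow> 'v) \<Rightarrow> complex. (\<forall>p. p \<notin> ?I \<longrightarrow> v p = 0) \<and> (\<Sum>p\<in>?I. v p) = 0}"
  define L where "L v p = (if p \<in> ?I then (\<Sum>i\<in>N. \<Sum>j\<in>N. complex_of_real (a i j) * (v p - v (p \<circ> transpose i j))) / 2 else 0)"
    for v :: "('v \<Rightarrow> 'v) \<Rightarrow> complex" and p
  have finI: "finite ?I" using fin by (rule finite_permutations)
  have re: "(\<Sum>p\<in>?I. h (p \<circ> transpose i j)) = (\<Sum>p\<in>?I. h p)" if "i \<in> N" "j \<in> N" for h :: "_ \<Rightarrow> complex" and i j
    using sum_permutations_compose_right[OF permutes_swap_id[OF that], of h] by simp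
  note cb = continuous_on_coordinate
  have "W = (\<Inter>p\<in>- ?I. {v. v p = 0}) \<inter> {v. (\<Sum>p\<in>?I. v p) = 0}" by (auto simp: W_def)
  moreover have "closed {v :: ('v \<Rightarrow> 'v) \<Rightarrow> complex. v p = 0}" for p
    using continuous_closed_preimage_constant[OF cb closed_UNIV, of p 0] by simp
  moreover have "closed {v :: ('v \<Rightarrow> 'v) \<Rightarrow> complex. (\<Sum>p\<in>?I. v p) = 0}"
  proof -
    have "continuous_on UNIV (\<lambda>v :: ('v \<Rightarrow> 'v) \<Rightarrow> complex. \<Sum>p\<in>?I. v p)" by (intro continuous_on_sum cb)
    from continuous_closed_preimage_constant[OF this closed_UNIV, of 0] show ?thesis by simp
  qed
  ultimately have closedW: "closed W" by (auto intro!: closed_Int closed_INT)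
  have sumL: "(\<Sum>p\<in>?I. L v p * w p) = (\<Sum>i\<in>N. \<Sum>j\<in>N. complex_of_real (a i j) / 2 * (\<Sum>p\<in>?I. (v p - v (p \<circ> transpose i j)) * w p))"
    for v w :: "('v \<Rightarrow> 'v) \<Rightarrow> complex"
  proof -
    have "(\<Sum>p\<in>?I. L v p * w p) = (\<Sum>p\<in>?I. \<Sum>i\<in>N. \<Sum>j\<in>N. complex_of_real (a i j) / 2 * ((v p - v (p \<circ> transpose i j)) * w p))"
    proof (intro sum.cong refl)
      fix p assume "p \<in> ?I"
      then have "L v p * w p = (\<Sum>i\<in>N. \<Sum>j\<in>N. complex_of_real (a i j) * (v p - v (p \<circ> transpose i j))) / 2 * w p"
        by (simp add: L_def)
      then show "L v p * w p = (\<Sum>i\<in>N. \<Sum>j\<in>N. complex_of_real (a i j) / 2 * ((v p - v (p \<circ> transpose i j)) * w p))"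
        unfolding sum_divide_distrib sum_distrib_right by (simp add: mult.assoc)
    qed
    also have "\<dots> = (\<Sum>i\<in>N. \<Sum>j\<in>N. \<Sum>p\<in>?I. complex_of_real (a i j) / 2 * ((v p - v (p \<circ> transpose i j)) * w p))"
      by (subst sum.swap, rule sum.cong[OF refl], rule sum.swap)
    finally show ?thesis by (simp only: sum_distrib_left)
  qed
  define v0 where "v0 p = (if p \<in> ?I then complex_of_real (F p) else 0)" for p
  have v0: "v0 \<in> W" using F by (simp add: W_def v0_def of_real_sum[symmetric])
  have "v0 F0 \<noteq> 0" using F0 by (simp add: v0_def)
  then have v0n: "v0 \<noteq> (\<lambda>b. 0)" by auto
  obtain e v where v: "v \<in> W" "v \<noteq> (\<lambda>b. 0)" "L v = (\<lambda>b. complex_of_real e * v b)"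
    and min: "\<And>u. u \<in> W \<Longrightarrow> e * (\<Sum>b\<in>?I. (cmod (u b))\<^sup>2) \<le> Re (\<Sum>b\<in>?I. L u b * cnj (u b))"
  proof (rule spectral_minimum[OF finI closedW, of L v0])
    show "v b = 0" if "v \<in> W" "b \<notin> ?I" for v b using that by (simp add: W_def)
    show "(\<lambda>b. u b + v b) \<in> W" if "u \<in> W" "v \<in> W" for u v using that by (simp add: W_def sum.distrib)
    show "(\<lambda>b. z * v b) \<in> W" if "v \<in> W" for z v using that by (simp add: W_def sum_distrib_left[symmetric])
    show "L v \<in> W" if "v \<in> W" for v
      using sumL[of v "\<lambda>_. 1"] by (simp add: W_def L_def[of v] sum_subtractf re[of _ _ v])
    show "L (\<lambda>b. u b + v b) = (\<lambda>b. L u b + L v b)" for u v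
      by (simp add: fun_eq_iff L_def sum.distrib[symmetric] add_divide_distrib[symmetric] algebra_simps)
    show "L (\<lambda>b. z * v b) = (\<lambda>b. z * L v b)" for z v
      by (simp add: fun_eq_iff L_def sum_distrib_left algebra_simps)
    show "(\<Sum>b\<in>?I. L u b * cnj (v b)) = (\<Sum>b\<in>?I. u b * cnj (L v b))" for u v
    proof -
      have "(\<Sum>b\<in>?I. u b * cnj (L v b)) = cnj (\<Sum>b\<in>?I. L v b * cnj (u b))" by (simp add: mult.commute)
      also have "\<dots> = (\<Sum>i\<in>N. \<Sum>j\<in>N. complex_of_real (a i j) / 2 * (\<Sum>p\<in>?I. u p * cnj (v p - v (p \<circ> transpose i j))))"
        unfolding sumL by (simp add: mult_ac)
      also have "\<dots> = (\<Sum>i\<in>N. \<Sum>j\<in>N. complex_of_real (a i j) / 2 * (\<Sum>p\<in>?I. (u p - u (p \<circ> transpose i j)) * cnj (v p)))"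
      proof (rule sum.cong[OF refl], rule sum.cong[OF refl], rule arg_cong2[of _ _ _ _ "(*)", OF refl])
        fix i j assume ij: "i \<in> N" "j \<in> N"
        have "(\<Sum>p\<in>?I. u (p \<circ> transpose i j) * cnj (v p)) = (\<Sum>p\<in>?I. u p * cnj (v (p \<circ> transpose i j)))"
          using re[OF ij, of "\<lambda>p. u (p \<circ> transpose i j) * cnj (v p)"] by (simp add: comp_assoc)
        then show "(\<Sum>p\<in>?I. u p * cnj (v p - v (p \<circ> transpose i j))) = (\<Sum>p\<in>?I. (u p - u (p \<circ> transpose i j)) * cnj (v p))"
          by (simp add: algebra_simps sum_subtractf)
      qed
      finally show ?thesis unfolding sumL by simp
    qed
    show "continuous_on W (\<lambda>v. L v b)" for b
      unfolding L_def by (cases "b \<in> ?I") (auto intro!: continuous_intros cb)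
  qed (use v0 v0n in auto)
  have ev: "(\<Sum>i\<in>N. \<Sum>j\<in>N. complex_of_real (a i j) * (v p - v (p \<circ> transpose i j))) / 2 = complex_of_real e * v p"
    if "p \<in> ?I" for p using fun_cong[OF v(3), of p] that by (simp add: L_def)
  obtain p0 where p0: "p0 \<in> ?I" "v p0 \<noteq> 0" using v by (auto simp: W_def)
  have vs: "(\<Sum>p\<in>?I. v p) = 0" using v by (simp add: W_def)
  have "e * (\<Sum>p | p permutes N. (F p)\<^sup>2) \<le> swap_energy N a F"
  proof -
    have "(\<Sum>b\<in>?I. L v0 b * cnj (v0 b)) = complex_of_real (swap_energy N a F)"
      unfolding swap_energy_eq[OF fin] of_real_sum
      by (intro sum.cong refl) (auto simp: L_def v0_def permutes_compose permutes_swap_id intro!: sum.cong)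
    moreover have "(\<Sum>b\<in>?I. (cmod (v0 b))\<^sup>2) = (\<Sum>p | p permutes N. (F p)\<^sup>2)"
      by (intro sum.cong refl) (simp add: v0_def)
    ultimately show ?thesis using min[OF v0] by simp
  qed
  note that' = that[OF _ _ _ this]
  show ?thesis
  proof (cases "Re (v p0) = 0")
    case True
    then have "Im (v p0) \<noteq> 0" using p0 by (simp add: complex_eq_iff)
    moreover have "(\<Sum>i\<in>N. \<Sum>j\<in>N. a i j * (Im (v p) - Im (v (p \<circ> transpose i j)))) / 2 = e * Im (v p)"
      if "p \<in> ?I" for p using arg_cong[OF ev[OF that], of Im] by simp
    ultimately show ?thesis using p0 arg_cong[OF vs, of Im] by (intro that'[of "\<lambda>p. Im (v p)"]) auto
  next
    case False
    moreover have "(\<Sum>i\<in>N. \<Sum>j\<in>N. a i j * (Re (v p) - Re (v (p \<circ> transpose i j)))) / 2 = e * Re (v p)"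
      if "p \<in> ?I" for p using arg_cong[OF ev[OF that], of Re] by simp
    ultimately show ?thesis using p0 arg_cong[OF vs, of Re] by (intro that'[of "\<lambda>p. Re (v p)"]) auto
  qed
qed

lemma marginal_eigenvector:
  assumes fin: "finite N" and k: "k \<in> N"
    and ev: "\<And>p. p permutes N \<Longrightarrow> (\<Sum>i\<in>N. \<Sum>j\<in>N. a i j * (F p - F (p \<circ> transpose i j))) / 2 = e * F p"
  shows "e * (\<Sum>y\<in>N. (marginal N F k y)\<^sup>2) = (\<Sum>i\<in>N. \<Sum>j\<in>N. a i j * (marginal N F k i - marginal N F k j)\<^sup>2) / 2"
proof -
  let ?m = "marginal N F k"
  have "e * ?m y = (\<Sum>i\<in>N. \<Sum>j\<in>N. a i j * (?m y - ?m (transpose i j y))) / 2" for y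
  proof -
    have "e * ?m y = (\<Sum>p | p permutes N. of_bool (p y = k) * ((\<Sum>i\<in>N. \<Sum>j\<in>N. a i j * (F p - F (p \<circ> transpose i j))) / 2))"
      unfolding marginal_def sum_distrib_left by (intro sum.cong refl) (simp add: ev)
    also have "\<dots> = (\<Sum>p | p permutes N. \<Sum>i\<in>N. \<Sum>j\<in>N. a i j * (of_bool (p y = k) * F p - of_bool (p y = k) * F (p \<circ> transpose i j))) / 2"
      unfolding sum_divide_distrib sum_distrib_left by (intro sum.cong refl) (simp add: algebra_simps)
    also have "(\<Sum>p | p permutes N. \<Sum>i\<in>N. \<Sum>j\<in>N. a i j * (of_bool (p y = k) * F p - of_bool (p y = k) * F (p \<circ> transpose i j)))
      = (\<Sum>i\<in>N. \<Sum>j\<in>N. \<Sum>p | p permutes N. a i j * (of_bool (p y = k) * F p - of_bool (p y = k) * F (p \<circ> transpose i j)))"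
      by (subst sum.swap, rule sum.cong[OF refl], rule sum.swap)
    also have "\<dots> = (\<Sum>i\<in>N. \<Sum>j\<in>N. a i j * (?m y - marginal N (\<lambda>p. F (p \<circ> transpose i j)) k y))"
      by (simp add: marginal_def sum_distrib_left[symmetric] sum_subtractf)
    also have "\<dots> = (\<Sum>i\<in>N. \<Sum>j\<in>N. a i j * (?m y - ?m (transpose i j y)))"
      by (intro sum.cong refl) (simp add: marginal_transpose)
    finally show ?thesis .
  qed
  from this[symmetric] have "e * (\<Sum>y\<in>N. (?m y)\<^sup>2) = (\<Sum>y\<in>N. (\<Sum>i\<in>N. \<Sum>j\<in>N. a i j * (?m y - ?m (transpose i j y))) / 2 * ?m y)"
    by (simp only: sum_distrib_left power2_eq_square mult.assoc)
  then show ?thesis by (simp only: energy_eq_transpose[OF fin])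
qed

text \<open>By the octopus inequality with the weights \<open>a x i\<close>, the star at x has at
  least the energy of the mesh that replaces it. The functions still live on the permutations of all
  of N; the restriction to those of N - {x} is left to the induction.\<close>

lemma swap_energy_star_mesh:
  fixes N :: "nat set"
  assumes fin: "finite N" and x: "x \<in> N"
    and sym: "\<And>i j. i \<in> N \<Longrightarrow> j \<in> N \<Longrightarrow> a i j = a j i"
    and pos: "\<And>i j. i \<in> N \<Longrightarrow> j \<in> N \<Longrightarrow> a i j \<ge> 0"
    and s: "(\<Sum>i\<in>N - {x}. a x i) > 0"
  shows "(\<Sum>i\<in>N - {x}. \<Sum>j\<in>N - {x}. (a i j + a x i * a x j / (\<Sum>k\<in>N - {x}. a x k)) *
      (\<Sum>p | p permutes N. (F (p \<circ> transpose i j) - F p)\<^sup>2)) / 4 \<le> swap_energy N a F"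
proof -
  let ?A = "N - {x}"
  define s where "s = (\<Sum>i\<in>?A. a x i)"
  define D where "D i j = (\<Sum>p | p permutes N. (F (p \<circ> transpose i j) - F p)\<^sup>2)" for i j
  have s0: "s > 0" using assms(5) by (simp add: s_def)
  have "(\<Sum>i\<in>?A. \<Sum>j\<in>?A. a x i * a x j * D i j) \<le> 2 * s * (\<Sum>i\<in>?A. a x i * D x i)"
    unfolding D_def s_def by (rule octopus_inequality[OF fin x]) (use pos x in auto)
  then have o: "(\<Sum>i\<in>?A. \<Sum>j\<in>?A. a x i * a x j * D i j) / s \<le> 2 * (\<Sum>i\<in>?A. a x i * D x i)"
    using s0 by (simp add: field_simps)
  have "(\<Sum>i\<in>?A. \<Sum>j\<in>?A. (a i j + a x i * a x j / s) * D i j)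
     = (\<Sum>i\<in>?A. \<Sum>j\<in>?A. a i j * D i j) + (\<Sum>i\<in>?A. \<Sum>j\<in>?A. a x i * a x j * D i j) / s"
    unfolding sum_divide_distrib sum.distrib[symmetric]
    by (intro sum.cong refl) (simp add: algebra_simps)
  also have "\<dots> \<le> (\<Sum>i\<in>?A. \<Sum>j\<in>?A. a i j * D i j) + 2 * (\<Sum>i\<in>?A. a x i * D x i)"
    using o by simp
  also have "\<dots> = (\<Sum>i\<in>N. \<Sum>j\<in>N. a i j * D i j)"
    by (rule sum_pairs_remove[OF fin x, symmetric]) (use sym x in \<open>auto simp: D_def transpose_commute[of _ x]\<close>)
  finally show ?thesis by (simp add: swap_energy_def D_def s_def)
qed

text \<open>Aldous' spectral gap conjecture, proved by Caputo, Liggett and Richthammer. The induction on the number of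
  vertices removes \<open>x\<close>: an eigenfunction either has a non-zero one-particle marginal, which is an eigenvector of the
  random walk, or has mean zero on each fibre \<open>p x = k\<close>, where the hypothesis for the star-mesh weights applies.\<close>

theorem interchange_poincare:
  fixes N :: "nat set" and F :: "(nat \<Rightarrow> nat) \<Rightarrow> real"
  assumes "finite N"
    and "\<And>i j. i \<in> N \<Longrightarrow> j \<in> N \<Longrightarrow> a i j = a j i"
    and "\<And>i j. i \<in> N \<Longrightarrow> j \<in> N \<Longrightarrow> a i j \<ge> 0"
    and "\<And>v. sum v N = 0 \<Longrightarrow> \<mu> * (\<Sum>i\<in>N. (v i)\<^sup>2) \<le> (\<Sum>i\<in>N. \<Sum>j\<in>N. a i j * (v i - v j)\<^sup>2) / 2"
    and "(\<Sum>p | p permutes N. F p) = 0"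
  shows "\<mu> * (\<Sum>p | p permutes N. (F p)\<^sup>2) \<le> swap_energy N a F"
  using assms
proof (induction N arbitrary: a F rule: finite_induct)
  case empty
  then show ?case by (simp add: swap_energy_def)
next
  case (insert x A)
  let ?N = "insert x A"
  note sym = insert.prems(1) and pos = insert.prems(2) and gap = insert.prems(3) and F0 = insert.prems(4)
  have fin: "finite ?N" and x: "x \<in> ?N" and NA: "?N - {x} = A" using insert.hyps by auto
  show ?case
  proof (cases "\<forall>p. p permutes ?N \<longrightarrow> F p = 0")
    case True
    then have "(\<Sum>p | p permutes ?N. (F p)\<^sup>2) = 0" by simp
    then show ?thesis using swap_energy_nonneg[of ?N a F] pos by simp
  next
    case False
    then obtain p0 where p0: "p0 permutes ?N" "F p0 \<noteq> 0" by blast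
    obtain e F1 where F1: "(\<Sum>p | p permutes ?N. F1 p) = (0 :: real)" "\<exists>p. p permutes ?N \<and> F1 p \<noteq> 0"
      and ev: "\<And>p. p permutes ?N \<Longrightarrow> (\<Sum>i\<in>?N. \<Sum>j\<in>?N. a i j * (F1 p - F1 (p \<circ> transpose i j))) / 2 = e * F1 p"
      and eF: "e * (\<Sum>p | p permutes ?N. (F p)\<^sup>2) \<le> swap_energy ?N a F"
      by (rule interchange_eigenfunction[where a = a, OF fin p0 F0]) (rule that)
    define n1 where "n1 = (\<Sum>p | p permutes ?N. (F1 p)\<^sup>2)"
    have n1: "n1 > 0"
    proof -
      obtain p where p: "p permutes ?N" "F1 p \<noteq> 0" using F1 by blast
      have "(F1 p)\<^sup>2 \<le> n1" unfolding n1_def using p fin by (intro member_le_sum) (auto simp: finite_permutations)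
      moreover have "(F1 p)\<^sup>2 > 0" using p by simp
      ultimately show ?thesis by linarith
    qed
    have en1: "swap_energy ?N a F1 = e * n1"
      unfolding swap_energy_eq[OF fin] n1_def sum_distrib_left
      by (intro sum.cong refl) (simp add: ev power2_eq_square del: sum.insert)
    have "\<mu> \<le> e"
    proof (cases "\<exists>k\<in>?N. \<exists>y\<in>?N. marginal ?N F1 k y \<noteq> 0")
      case True
      then obtain k y where k: "k \<in> ?N" "y \<in> ?N" "marginal ?N F1 k y \<noteq> 0" by blast
      have "(marginal ?N F1 k y)\<^sup>2 \<le> (\<Sum>y\<in>?N. (marginal ?N F1 k y)\<^sup>2)"
        using k fin by (intro member_le_sum) auto
      moreover have "(marginal ?N F1 k y)\<^sup>2 > 0" using k by simp
      ultimately have m: "(\<Sum>y\<in>?N. (marginal ?N F1 k y)\<^sup>2) > 0" by linarith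
      have "sum (marginal ?N F1 k) ?N = 0" using sum_marginal[OF fin k(1), of F1] F1(1) by simp
      from gap[OF this] have "\<mu> * (\<Sum>y\<in>?N. (marginal ?N F1 k y)\<^sup>2) \<le> e * (\<Sum>y\<in>?N. (marginal ?N F1 k y)\<^sup>2)"
        by (simp only: marginal_eigenvector[where a = a and F = F1 and e = e, OF fin k(1) ev])
      then show ?thesis using m by (rule mult_right_le_imp_le)
    next
      case False
      show ?thesis
      proof (cases "(\<Sum>i\<in>A. a x i) > 0")
        case True
        define a' where "a' i j = a i j + a x i * a x j / (\<Sum>k\<in>A. a x k)" for i j
        define E where "E k = (\<lambda>q. F1 (transpose x k \<circ> q))" for k
        have IH: "\<mu> * (\<Sum>q | q permutes A. (E k q)\<^sup>2) \<le> swap_energy A a' (E k)" if k: "k \<in> ?N" for k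
        proof (rule insert.IH)
          show "a' i j = a' j i" if "i \<in> A" "j \<in> A" for i j using that sym by (simp add: a'_def)
          show "a' i j \<ge> 0" if "i \<in> A" "j \<in> A" for i j
            unfolding a'_def using that pos True by (intro add_nonneg_nonneg divide_nonneg_pos mult_nonneg_nonneg) auto
          show "\<mu> * (\<Sum>i\<in>A. (v i)\<^sup>2) \<le> (\<Sum>i\<in>A. \<Sum>j\<in>A. a' i j * (v i - v j)\<^sup>2) / 2" if "sum v A = 0" for v
            unfolding a'_def using poincare_star_mesh[of ?N x a \<mu> v, OF fin x sym pos gap] True that NA by simp
          show "(\<Sum>q | q permutes A. E k q) = 0"
            unfolding E_def marginal_insert[OF insert.hyps k, symmetric] using False k x by blast
        qed
        have ins: "(\<Sum>p | p permutes ?N. g p) = (\<Sum>k\<in>?N. \<Sum>q | q permutes A. g (transpose x k \<circ> q))" for g :: "(nat \<Rightarrow> nat) \<Rightarrow> real"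
          by (rule sum_over_permutations_insert[OF insert.hyps])
        have "\<mu> * n1 = (\<Sum>k\<in>?N. \<mu> * (\<Sum>q | q permutes A. (E k q)\<^sup>2))"
          unfolding n1_def ins E_def by (simp only: sum_distrib_left)
        also have "\<dots> \<le> (\<Sum>k\<in>?N. swap_energy A a' (E k))" by (intro sum_mono IH)
        \<comment> \<open>A swap of points of A acts on the right and does not change
          \<open>p x\<close>, so the energies of the fibres add up to the energy of
          \<open>F1\<close> for the mesh weights.\<close>
        also have "\<dots> = (\<Sum>i\<in>A. \<Sum>j\<in>A. a' i j * (\<Sum>k\<in>?N. \<Sum>q | q permutes A. (E k (q \<circ> transpose i j) - E k q)\<^sup>2)) / 4"
          unfolding swap_energy_def sum_divide_distrib[symmetric] sum_distrib_left[of "a' _ _" _ ?N]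
          by (subst sum.swap, rule arg_cong[where f = "\<lambda>t. t / 4"], rule sum.cong[OF refl], rule sum.swap)
        also have "\<dots> = (\<Sum>i\<in>?N - {x}. \<Sum>j\<in>?N - {x}. (a i j + a x i * a x j / (\<Sum>k\<in>?N - {x}. a x k)) *
            (\<Sum>p | p permutes ?N. (F1 (p \<circ> transpose i j) - F1 p)\<^sup>2)) / 4"
          unfolding NA ins E_def a'_def by (simp only: o_assoc)
        also have "\<dots> \<le> swap_energy ?N a F1"
          using True by (intro swap_energy_star_mesh fin x sym pos) (simp_all only: NA)
        finally have "\<mu> * n1 \<le> e * n1" by (simp only: en1)
        then show ?thesis using n1 by (rule mult_right_le_imp_le)
      next
        \<comment> \<open>If x is isolated there are no star-mesh weights. The indicator of x then
          has energy zero and, as A is not empty, positive variance, which forces \<mu> to be at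
          most 0; and e is not negative because energies are not.\<close>
        case s0: False
        have a0: "a x i = 0" if "i \<in> A" for i
        proof -
          have "(\<Sum>i\<in>A. a x i) = 0" using s0 pos sum_nonneg[of A "a x"] by force
          then show ?thesis using that pos insert.hyps(1) by (subst (asm) sum_nonneg_eq_0_iff) auto
        qed
        have A: "A \<noteq> {}"
        proof
          assume "A = {}"
          then have "p permutes ?N \<longleftrightarrow> p = id" for p by simp
          then show False using F1(1,2) by simp
        qed
        define v where "v = (\<lambda>i. of_bool (i = x) :: real)"
        have sv: "sum v ?N = 1" using insert.hyps by (simp add: v_def)
        have sv2: "(\<Sum>i\<in>?N. (v i)\<^sup>2) = 1" using sv by (simp add: v_def of_bool_def if_distrib[of "\<lambda>t. t\<^sup>2"] del: sum.insert cong: if_cong)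
        have "(\<Sum>i\<in>?N. \<Sum>j\<in>?N. a i j * (v i - v j)\<^sup>2) = 0"
          using a0 sym by (intro sum.neutral ballI) (auto simp: v_def)
        then have "\<mu> * (1 - 1 / real (card ?N)) \<le> 0"
          using poincare_recentre[of ?N \<mu> a v, OF fin _ gap] sv sv2 by (simp del: sum.insert)
        moreover have "card ?N > 1" using A insert.hyps by (simp add: card_gt_0_iff)
        then have "1 - 1 / real (card ?N) > 0" by simp
        ultimately have "\<mu> \<le> 0" by (simp add: mult_le_0_iff)
        moreover have "0 \<le> e * n1" unfolding en1[symmetric] by (intro swap_energy_nonneg pos)
        then have "0 \<le> e" using n1 by (simp add: zero_le_mult_iff)
        ultimately show ?thesis by simp
      qed
    qed
    then have "\<mu> * (\<Sum>p | p permutes ?N. (F p)\<^sup>2) \<le> e * (\<Sum>p | p permutes ?N. (F p)\<^sup>2)"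
      by (intro mult_right_mono sum_nonneg) auto
    then show ?thesis using eF by linarith
  qed
qed

section \<open>Spectral gaps of unitary representations\<close>

locale finite_unitary_rep = group H + unitary_rep H R
  for H :: "('h, 'm) monoid_scheme" and R :: "('h, 'b) rep" +
  assumes fin: "finite (carrier H)"
begin

lemma sum_closed:
  assumes "\<And>x. x \<in> A \<Longrightarrow> u x \<in> rep_space R"
  shows "(\<lambda>b. \<Sum>x\<in>A. z x * u x b) \<in> rep_space R"
proof (cases "finite A")
  case True
  then show ?thesis using assms
  proof (induction A)
    case empty
    then show ?case using zero_closed by simp
  next
    case (insert x A)
    then show ?case using add_closed[OF scale_closed, of "u x" "\<lambda>b. \<Sum>x\<in>A. z x * u x b" "z x"] by simp
  qed
qed (use zero_closed in simp)

lemma act_sum: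
  assumes "h \<in> carrier H" "\<And>x. x \<in> A \<Longrightarrow> u x \<in> rep_space R"
  shows "rep_act R h (\<lambda>b. \<Sum>x\<in>A. z x * u x b) = (\<lambda>b. \<Sum>x\<in>A. z x * rep_act R h (u x) b)"
proof (cases "finite A")
  case True
  then show ?thesis using assms(2)
  proof (induction A)
    case empty
    then show ?case using act_scale[OF assms(1) zero_closed, of 0] by simp
  next
    case (insert x A)
    have s: "(\<lambda>b. \<Sum>x\<in>A. z x * u x b) \<in> rep_space R" using insert.prems by (intro sum_closed) simp
    show ?case using insert act_add[OF assms(1) scale_closed s, of "u x" "z x"] act_scale[OF assms(1), of "u x" "z x"] by simp
  qed
next
  case False
  then show ?thesis using act_scale[OF assms(1) zero_closed, of 0] by simp
qed

lemma inner_add_left: "rep_inner R (\<lambda>b. u b + u' b) v = rep_inner R u v + rep_inner R u' v"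
  by (simp add: rep_inner_def distrib_right sum.distrib)

lemma inner_diff_left: "rep_inner R (\<lambda>b. u b - u' b) v = rep_inner R u v - rep_inner R u' v"
  by (simp add: rep_inner_def left_diff_distrib sum_subtractf)

lemma inner_scale_left: "rep_inner R (\<lambda>b. z * u b) v = z * rep_inner R u v"
  by (simp add: rep_inner_def sum_distrib_left mult.assoc)

lemma inner_sum_left: "rep_inner R (\<lambda>b. \<Sum>x\<in>A. z x * u x b) v = (\<Sum>x\<in>A. z x * rep_inner R (u x) v)"
proof -
  have "rep_inner R (\<lambda>b. \<Sum>x\<in>A. z x * u x b) v = (\<Sum>b\<in>rep_index R. \<Sum>x\<in>A. z x * (u x b * cnj (v b)))"
    by (simp add: rep_inner_def sum_distrib_right mult.assoc)
  also have "\<dots> = (\<Sum>x\<in>A. \<Sum>b\<in>rep_index R. z x * (u x b * cnj (v b)))" by (rule sum.swap)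
  finally show ?thesis by (simp add: rep_inner_def sum_distrib_left)
qed

lemma inner_commute: "rep_inner R v u = cnj (rep_inner R u v)"
  by (simp add: rep_inner_def mult.commute)

lemma inner_self: "rep_inner R u u = complex_of_real (\<Sum>b\<in>rep_index R. (cmod (u b))\<^sup>2)"
  by (simp add: rep_inner_def complex_norm_square del: of_real_power)

lemma inner_self_eq_0:
  assumes "u \<in> rep_space R" "rep_inner R u u = 0" shows "u = (\<lambda>b. 0)"
proof
  fix b
  have "(\<Sum>b\<in>rep_index R. (cmod (u b))\<^sup>2) = 0" using assms(2) unfolding inner_self by (simp only: of_real_eq_0_iff)
  then have "\<forall>b\<in>rep_index R. u b = 0" using finite_index by (subst (asm) sum_nonneg_eq_0_iff) auto
  then show "u b = 0" using support[OF assms(1)] by blast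
qed

lemma act_inv:
  assumes "h \<in> carrier H" "v \<in> rep_space R"
  shows "rep_act R (inv\<^bsub>H\<^esub> h) (rep_act R h v) = v" "rep_act R h (rep_act R (inv\<^bsub>H\<^esub> h) v) = v"
  using act_mult[of "inv\<^bsub>H\<^esub> h" h v] act_mult[of h "inv\<^bsub>H\<^esub> h" v] act_one[of v] assms by simp_all

lemma inner_act_left:
  assumes "h \<in> carrier H" "u \<in> rep_space R" "v \<in> rep_space R"
  shows "rep_inner R (rep_act R h u) v = rep_inner R u (rep_act R (inv\<^bsub>H\<^esub> h) v)"
  using act_unitary[of "inv\<^bsub>H\<^esub> h" "rep_act R h u" v] act_inv(1)[of h u] act_closed assms by simp

lemma galg_act_laplacian:
  assumes "v \<in> rep_space R"
  shows "galg_act H R (laplacian H w) v = (\<lambda>b. \<Sum>h\<in>carrier H. complex_of_real (w h) * (v b - rep_act R h v b))"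
proof
  fix b
  have "galg_act H R (laplacian H w) v b
     = (\<Sum>x\<in>carrier H. \<Sum>h\<in>carrier H. complex_of_real (w h) * (complex_of_real (galg_unit \<one>\<^bsub>H\<^esub> x - galg_unit h x) * rep_act R x v b))"
    by (simp add: galg_act_def laplacian_def sum_distrib_right mult.assoc)
  also have "\<dots> = (\<Sum>h\<in>carrier H. complex_of_real (w h) * (\<Sum>x\<in>carrier H. complex_of_real (galg_unit \<one>\<^bsub>H\<^esub> x - galg_unit h x) * rep_act R x v b))"
    by (subst sum.swap) (simp only: sum_distrib_left)
  also have "\<dots> = (\<Sum>h\<in>carrier H. complex_of_real (w h) * (v b - rep_act R h v b))"
  proof (rule sum.cong[OF refl])
    fix h assume h: "h \<in> carrier H"
    have "(\<Sum>x\<in>carrier H. complex_of_real (galg_unit k x) * rep_act R x v b) = rep_act R k v b" if "k \<in> carrier H" for k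
    proof -
      have "(\<Sum>x\<in>carrier H. complex_of_real (galg_unit k x) * rep_act R x v b) = (\<Sum>x\<in>carrier H. if x = k then rep_act R x v b else 0)"
        by (intro sum.cong refl) (simp add: galg_unit_def)
      then show ?thesis using that fin by simp
    qed
    then have "(\<Sum>x\<in>carrier H. complex_of_real (galg_unit \<one>\<^bsub>H\<^esub> x - galg_unit h x) * rep_act R x v b) = v b - rep_act R h v b"
      using h act_one[OF assms] by (simp add: left_diff_distrib sum_subtractf)
    then show "complex_of_real (w h) * (\<Sum>x\<in>carrier H. complex_of_real (galg_unit \<one>\<^bsub>H\<^esub> x - galg_unit h x) * rep_act R x v b)
      = complex_of_real (w h) * (v b - rep_act R h v b)" by simp
  qed
  finally show "galg_act H R (laplacian H w) v b = (\<Sum>h\<in>carrier H. complex_of_real (w h) * (v b - rep_act R h v b))" .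
qed

lemma diff_closed: "u \<in> rep_space R \<Longrightarrow> v \<in> rep_space R \<Longrightarrow> (\<lambda>b. u b - v b) \<in> rep_space R"
  using add_closed[OF _ scale_closed, of u v "-1"] by simp

lemma laplacian_closed:
  assumes "v \<in> rep_space R" shows "galg_act H R (laplacian H w) v \<in> rep_space R"
  unfolding galg_act_laplacian[OF assms] by (intro sum_closed diff_closed act_closed assms)

lemma inner_laplacian:
  assumes "v \<in> rep_space R"
  shows "rep_inner R (galg_act H R (laplacian H w) v) u
    = (\<Sum>h\<in>carrier H. complex_of_real (w h) * (rep_inner R v u - rep_inner R (rep_act R h v) u))"
  unfolding galg_act_laplacian[OF assms] by (simp add: inner_sum_left inner_diff_left)

lemma laplacian_self_adjoint:
  assumes "u \<in> rep_space R" "v \<in> rep_space R" and w: "\<And>h. h \<in> carrier H \<Longrightarrow> w (inv\<^bsub>H\<^esub> h) = w h"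
  shows "rep_inner R (galg_act H R (laplacian H w) u) v = rep_inner R u (galg_act H R (laplacian H w) v)"
proof -
  have "rep_inner R u (galg_act H R (laplacian H w) v)
      = (\<Sum>h\<in>carrier H. complex_of_real (w h) * (rep_inner R u v - rep_inner R u (rep_act R h v)))"
    unfolding inner_commute[of u] inner_laplacian[OF assms(2)] by (simp add: inner_commute[of u])
  also have "\<dots> = (\<Sum>h\<in>carrier H. complex_of_real (w (inv\<^bsub>H\<^esub> h)) * (rep_inner R u v - rep_inner R u (rep_act R (inv\<^bsub>H\<^esub> h) v)))"
    by (rule sum.reindex_bij_witness[of _ "m_inv H" "m_inv H"]) auto
  also have "\<dots> = rep_inner R (galg_act H R (laplacian H w) u) v"
    unfolding inner_laplacian[OF assms(1)] by (intro sum.cong refl) (simp add: w inner_act_left assms)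
  finally show ?thesis ..
qed

lemma inner_laplacian_energy:
  assumes "v \<in> rep_space R"
  shows "Re (rep_inner R (galg_act H R (laplacian H w) v) v)
    = (\<Sum>h\<in>carrier H. w h * (\<Sum>b\<in>rep_index R. (cmod (v b - rep_act R h v b))\<^sup>2)) / 2"
proof -
  have "(\<Sum>b\<in>rep_index R. (cmod (v b - rep_act R h v b))\<^sup>2) = 2 * Re (rep_inner R v v - rep_inner R (rep_act R h v) v)"
    if h: "h \<in> carrier H" for h
  proof -
    let ?d = "\<lambda>b. v b - rep_act R h v b"
    have "rep_inner R ?d ?d = rep_inner R v v - rep_inner R (rep_act R h v) v
        - (cnj (rep_inner R (rep_act R h v) v) - rep_inner R (rep_act R h v) (rep_act R h v))"
      unfolding inner_diff_left inner_commute[of _ ?d]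
      by (simp add: inner_diff_left inner_commute[of v "rep_act R h v"] inner_commute[of v v, symmetric] inner_commute[of "rep_act R h v" "rep_act R h v", symmetric])
    then have "Re (rep_inner R ?d ?d) = 2 * Re (rep_inner R v v - rep_inner R (rep_act R h v) v)"
      using act_unitary[OF h assms assms] by simp
    then show ?thesis unfolding inner_self by simp
  qed
  then have "(\<Sum>h\<in>carrier H. w h * (\<Sum>b\<in>rep_index R. (cmod (v b - rep_act R h v b))\<^sup>2)) / 2
      = (\<Sum>h\<in>carrier H. w h * (2 * Re (rep_inner R v v - rep_inner R (rep_act R h v) v))) / 2"
    by simp
  also have "\<dots> = (\<Sum>h\<in>carrier H. w h * Re (rep_inner R v v - rep_inner R (rep_act R h v) v))"
    unfolding sum_divide_distrib by (intro sum.cong refl) simp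
  finally show ?thesis unfolding inner_laplacian[OF assms] by simp
qed

lemma fixed_perp_laplacian:
  assumes "v \<in> fixed_perp H R" shows "galg_act H R (laplacian H w) v \<in> fixed_perp H R"
proof -
  have v: "v \<in> rep_space R" using assms by (simp add: fixed_perp_def)
  have "rep_inner R (galg_act H R (laplacian H w) v) u = 0" if u: "u \<in> fixed_space H R" for u
    unfolding inner_laplacian[OF v]
  proof (rule sum.neutral, intro ballI)
    fix h assume h: "h \<in> carrier H"
    have "rep_inner R (rep_act R h v) u = rep_inner R v u"
      using u v h inner_act_left[of h v u] by (simp add: fixed_space_def)
    then show "complex_of_real (w h) * (rep_inner R v u - rep_inner R (rep_act R h v) u) = 0" by simp
  qed
  then show ?thesis using laplacian_closed[OF v] by (simp add: fixed_perp_def)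
qed

text \<open>A vector v - h v is orthogonal to every fixed u, because <h v, u> = <v, h^-1 u> = <v,
  u>. This avoids a projection onto the fixed space.\<close>

lemma fixed_perp_nonzero:
  assumes "fixed_space H R \<noteq> rep_space R"
  obtains v where "v \<in> fixed_perp H R" "v \<noteq> (\<lambda>b. 0)"
proof -
  obtain v h where v: "v \<in> rep_space R" "h \<in> carrier H" "rep_act R h v \<noteq> v"
    using assms by (auto simp: fixed_space_def)
  have "rep_inner R (\<lambda>b. v b - rep_act R h v b) u = 0" if "u \<in> fixed_space H R" for u
    using that inner_act_left[OF v(2,1), of u] v(2) by (simp add: inner_diff_left fixed_space_def)
  then have "(\<lambda>b. v b - rep_act R h v b) \<in> fixed_perp H R"
    using v by (simp add: fixed_perp_def diff_closed act_closed)
  moreover have "(\<lambda>b. v b - rep_act R h v b) \<noteq> (\<lambda>b. 0)" using v(3) by (auto simp: fun_eq_iff) metis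
  ultimately show ?thesis by (rule that)
qed

lemma fixed_space_neq:
  assumes "v \<in> fixed_perp H R" "v \<noteq> (\<lambda>b. 0)" shows "fixed_space H R \<noteq> rep_space R"
  using assms inner_self_eq_0[of v] by (auto simp: fixed_perp_def)

lemma finite_laplacian_eigenvalues:
  assumes "\<And>h. h \<in> carrier H \<Longrightarrow> w (inv\<^bsub>H\<^esub> h) = w h"
  shows "finite (laplacian_eigenvalues H w R)"
  unfolding laplacian_eigenvalues_def
  by (rule finite_eigenvalues[OF finite_index])
    (use support laplacian_self_adjoint[where w = w] assms in \<open>auto simp: fixed_perp_def rep_inner_def\<close>)

end

text \<open>The compactness argument for the minimum needs both conditions. They are assumptions
  here because for the regular, the standard and the induced representations they can be read off
  the explicit descriptions.\<close>

locale continuous_unitary_rep = finite_unitary_rep +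
  assumes closed_space: "closed (rep_space R)"
    and continuous_act: "\<And>h b. h \<in> carrier H \<Longrightarrow> continuous_on (rep_space R) (\<lambda>v. rep_act R h v b)"
begin

lemma closed_fixed_perp: "closed (fixed_perp H R)"
proof -
  have "closed {v. rep_inner R v u = 0}" for u
  proof -
    have "continuous_on UNIV (\<lambda>v. rep_inner R v u)"
      unfolding rep_inner_def by (intro continuous_intros continuous_on_coordinate)
    from continuous_closed_preimage_constant[OF this closed_UNIV, of 0] show ?thesis by simp
  qed
  moreover have "fixed_perp H R = rep_space R \<inter> (\<Inter>u\<in>fixed_space H R. {v. rep_inner R v u = 0})"
    by (auto simp: fixed_perp_def)
  ultimately show ?thesis using closed_space by (auto intro!: closed_Int closed_INT)
qed

text \<open>The last conclusion is the variational form of \<open>psi\<close>: it turns a single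
  test vector orthogonal to the fixed space into an upper bound.\<close>

lemma psi_attained:
  assumes w: "\<And>h. h \<in> carrier H \<Longrightarrow> w (inv\<^bsub>H\<^esub> h) = w h" and ne: "fixed_space H R \<noteq> rep_space R"
  obtains e v where "psi H w R = ereal e" "v \<in> fixed_perp H R" "v \<noteq> (\<lambda>b. 0)"
    "galg_act H R (laplacian H w) v = (\<lambda>b. complex_of_real e * v b)"
    "\<And>u. u \<in> fixed_perp H R \<Longrightarrow> e * (\<Sum>b\<in>rep_index R. (cmod (u b))\<^sup>2)
        \<le> (\<Sum>h\<in>carrier H. w h * (\<Sum>b\<in>rep_index R. (cmod (u b - rep_act R h u b))\<^sup>2)) / 2"
proof -
  let ?L = "galg_act H R (laplacian H w)" and ?W = "fixed_perp H R"
  have W: "v \<in> rep_space R" if "v \<in> ?W" for v using that by (simp add: fixed_perp_def)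
  obtain v0 where v0: "v0 \<in> ?W" "v0 \<noteq> (\<lambda>b. 0)" using fixed_perp_nonzero[OF ne] .
  obtain e v where e: "v \<in> ?W" "v \<noteq> (\<lambda>b. 0)" "?L v = (\<lambda>b. complex_of_real e * v b)"
    and min: "\<And>u. u \<in> ?W \<Longrightarrow> e * (\<Sum>b\<in>rep_index R. (cmod (u b))\<^sup>2) \<le> Re (\<Sum>b\<in>rep_index R. ?L u b * cnj (u b))"
  proof (rule spectral_minimum[OF finite_index closed_fixed_perp, of ?L v0])
    show "v b = 0" if "v \<in> ?W" "b \<notin> rep_index R" for v b using support W that by blast
    show "(\<lambda>b. u b + v b) \<in> ?W" if "u \<in> ?W" "v \<in> ?W" for u v
      using that by (simp add: fixed_perp_def add_closed inner_add_left)
    show "(\<lambda>b. z * v b) \<in> ?W" if "v \<in> ?W" for z v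
      using that by (simp add: fixed_perp_def scale_closed inner_scale_left)
    show "?L v \<in> ?W" if "v \<in> ?W" for v using that by (rule fixed_perp_laplacian)
    show "?L (\<lambda>b. u b + v b) = (\<lambda>b. ?L u b + ?L v b)" if "u \<in> ?W" "v \<in> ?W" for u v
      using W that by (simp add: galg_act_laplacian add_closed act_add sum.distrib[symmetric] distrib_left[symmetric] fun_eq_iff cong: sum.cong)
        (simp add: algebra_simps)
    show "?L (\<lambda>b. z * v b) = (\<lambda>b. z * ?L v b)" if "v \<in> ?W" for z v
      using W[OF that] by (simp add: galg_act_laplacian scale_closed act_scale sum_distrib_left fun_eq_iff algebra_simps cong: sum.cong)
    show "(\<Sum>b\<in>rep_index R. ?L u b * cnj (v b)) = (\<Sum>b\<in>rep_index R. u b * cnj (?L v b))" if "u \<in> ?W" "v \<in> ?W" for u v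
      using laplacian_self_adjoint[where w = w, OF W[OF that(1)] W[OF that(2)] w] by (simp add: rep_inner_def)
    show "continuous_on ?W (\<lambda>v. ?L v b)" for b
    proof -
      have "continuous_on ?W (\<lambda>v. \<Sum>h\<in>carrier H. complex_of_real (w h) * (v b - rep_act R h v b))"
        by (intro continuous_intros continuous_on_coordinate continuous_on_subset[OF continuous_act]) (use W in auto)
      then show ?thesis by (rule continuous_on_eq) (simp add: galg_act_laplacian W)
    qed
  qed (use v0 in auto)
  have eE: "e \<in> laplacian_eigenvalues H w R" using e by (auto simp: laplacian_eigenvalues_def)
  have energy: "e' * (\<Sum>b\<in>rep_index R. (cmod (u b))\<^sup>2)
        \<le> Re (rep_inner R (?L u) u)" if "u \<in> ?W" "e' = e" for u e'
    using min[OF that(1)] that(2) by (simp add: rep_inner_def)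
  have "Min (laplacian_eigenvalues H w R) = e"
  proof (rule Min_eqI)
    show "finite (laplacian_eigenvalues H w R)" using w by (rule finite_laplacian_eigenvalues)
    show "e \<in> laplacian_eigenvalues H w R" by fact
    fix e' assume "e' \<in> laplacian_eigenvalues H w R"
    then obtain u where u: "u \<in> ?W" "u \<noteq> (\<lambda>b. 0)" "?L u = (\<lambda>b. complex_of_real e' * u b)"
      by (auto simp: laplacian_eigenvalues_def)
    define nn where "nn = (\<Sum>b\<in>rep_index R. (cmod (u b))\<^sup>2)"
    have "rep_inner R (?L u) u = complex_of_real (e' * nn)" unfolding u(3) inner_scale_left inner_self nn_def by simp
    then have "e * nn \<le> e' * nn" using energy[OF u(1) refl] by (simp add: nn_def)
    moreover have "nn \<noteq> 0" using inner_self_eq_0[OF W[OF u(1)]] u(2) unfolding inner_self nn_def of_real_eq_0_iff by blast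
    then have "nn > 0" by (simp add: nn_def less_le sum_nonneg)
    ultimately show "e \<le> e'" by simp
  qed
  then have "psi H w R = ereal e" using ne by (simp add: psi_def)
  then show ?thesis using e energy[OF _ refl] inner_laplacian_energy[OF W] by (intro that) auto
qed

end

section \<open>The regular representation and matrix coefficients\<close>

lemma (in group) sum_carrier_left_translate:
  assumes "h \<in> carrier G"
  shows "(\<Sum>x\<in>carrier G. F (h \<otimes> x)) = (\<Sum>x\<in>carrier G. F x)"
  by (rule sum.reindex_bij_witness[of _ "\<lambda>x. inv h \<otimes> x" "\<lambda>x. h \<otimes> x"])
    (use assms in \<open>auto simp: m_assoc[symmetric]\<close>)

lemma continuous_unitary_rep_regular:
  assumes "group H" "finite (carrier H)"
  shows "continuous_unitary_rep H (regular_rep H)"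
proof -
  interpret group H by fact
  interpret unitary_rep H "regular_rep H" using assms by (rule unitary_rep_regular_rep)
  note cb = continuous_on_coordinate
  show ?thesis
  proof
    show "finite (carrier H)" by fact
    have "closed {v :: 'a \<Rightarrow> complex. v x = 0}" for x
      using continuous_closed_preimage_constant[OF cb closed_UNIV, of x 0] by simp
    moreover have "rep_space (regular_rep H) = (\<Inter>x\<in>- carrier H. {v. v x = 0})" by (auto simp: regular_rep_def)
    ultimately show "closed (rep_space (regular_rep H))" by auto
    show "continuous_on (rep_space (regular_rep H)) (\<lambda>v. rep_act (regular_rep H) h v b)" for h b
      by (cases "b \<in> carrier H") (auto simp: regular_rep_def intro: cb)
  qed
qed

lemma regular_fixed_perp:
  assumes "group H"
  shows "f \<in> fixed_perp H (regular_rep H) \<longleftrightarrow> f \<in> rep_space (regular_rep H) \<and> (\<Sum>x\<in>carrier H. f x) = 0"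
proof -
  interpret group H by fact
  let ?reg = "regular_rep H"
  define u0 where "u0 x = (if x \<in> carrier H then 1 else (0 :: complex))" for x
  have u0: "u0 \<in> fixed_space H ?reg"
    by (auto simp: fixed_space_def regular_rep_def u0_def fun_eq_iff)
  have "rep_inner ?reg f u = (\<Sum>x\<in>carrier H. f x) * cnj (u \<one>\<^bsub>H\<^esub>)" if u: "u \<in> fixed_space H ?reg" for u
  proof -
    have "u x = u \<one>\<^bsub>H\<^esub>" if x: "x \<in> carrier H" for x
    proof -
      have "rep_act ?reg x u = u" using u x by (simp add: fixed_space_def)
      from fun_cong[OF this, of x] show ?thesis using x by (simp add: regular_rep_def)
    qed
    then have "(\<Sum>x\<in>carrier H. f x * cnj (u x)) = (\<Sum>x\<in>carrier H. f x * cnj (u \<one>\<^bsub>H\<^esub>))"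
      by (intro sum.cong refl arg_cong2[of _ _ _ _ "(*)"] arg_cong[of _ _ cnj])
    then show ?thesis by (simp add: rep_inner_def regular_rep_def sum_distrib_right)
  qed
  moreover from this[OF u0] have "rep_inner ?reg f u0 = (\<Sum>x\<in>carrier H. f x)" by (simp add: u0_def)
  ultimately show ?thesis using u0 by (auto simp: fixed_perp_def)
qed

context finite_unitary_rep
begin

text \<open>A vector \<open>v\<close> embeds into the regular representation as its matrix coefficient \<open>x \<mapsto> \<langle>v, x v\<rangle>\<close>.\<close>

lemma psi_group_le:
  assumes w: "\<And>h. h \<in> carrier H \<Longrightarrow> w (inv\<^bsub>H\<^esub> h) = w h"
    and ne: "laplacian_eigenvalues H w R \<noteq> {}"
  shows "psi_group H w \<le> psi H w R"
proof (cases "fixed_space H R = rep_space R")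
  case True
  then show ?thesis by (simp add: psi_def)
next
  case False
  interpret reg: continuous_unitary_rep H "regular_rep H"
    by (intro continuous_unitary_rep_regular group_axioms fin)
  let ?reg = "regular_rep H"
  have sub: "laplacian_eigenvalues H w R \<subseteq> laplacian_eigenvalues H w ?reg"
  proof
    fix e assume "e \<in> laplacian_eigenvalues H w R"
    then obtain v where v: "v \<in> fixed_perp H R" "v \<noteq> (\<lambda>b. 0)"
      "galg_act H R (laplacian H w) v = (\<lambda>b. complex_of_real e * v b)"
      by (auto simp: laplacian_eigenvalues_def)
    have vR: "v \<in> rep_space R" using v by (simp add: fixed_perp_def)
    define f where "f x = (if x \<in> carrier H then rep_inner R v (rep_act R x v) else 0)" for x
    have f: "f \<in> rep_space ?reg" by (simp add: f_def regular_rep_def)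
    have "f \<one>\<^bsub>H\<^esub> \<noteq> 0" using v vR inner_self_eq_0[OF vR] act_one[OF vR] by (auto simp: f_def)
    then have fn: "f \<noteq> (\<lambda>b. 0)" by auto
    \<comment> \<open>Left translation of the coefficient acts on the first, linear argument of the
      inner product; hence f inherits the eigenvalue equation of v.\<close>
    have fx: "f (inv\<^bsub>H\<^esub> h \<otimes>\<^bsub>H\<^esub> x) = rep_inner R (rep_act R h v) (rep_act R x v)" if "h \<in> carrier H" "x \<in> carrier H" for h x
      using that vR by (simp add: f_def act_mult inner_act_left act_closed)
    have "galg_act H ?reg (laplacian H w) f = (\<lambda>x. complex_of_real e * f x)"
    proof
      fix x show "galg_act H ?reg (laplacian H w) f x = complex_of_real e * f x"
      proof (cases "x \<in> carrier H")
        case True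
        have "galg_act H ?reg (laplacian H w) f x = (\<Sum>h\<in>carrier H. complex_of_real (w h) * (f x - f (inv\<^bsub>H\<^esub> h \<otimes>\<^bsub>H\<^esub> x)))"
          unfolding reg.galg_act_laplacian[OF f] using True by (simp add: regular_rep_def)
        also have "\<dots> = (\<Sum>h\<in>carrier H. complex_of_real (w h) * (rep_inner R v (rep_act R x v) - rep_inner R (rep_act R h v) (rep_act R x v)))"
          using True by (intro sum.cong refl) (simp only: fx, simp add: f_def)
        also have "\<dots> = rep_inner R (galg_act H R (laplacian H w) v) (rep_act R x v)"
          using inner_laplacian[OF vR] by simp
        also have "\<dots> = complex_of_real e * f x" unfolding v(3) inner_scale_left using True by (simp add: f_def)
        finally show ?thesis .
      next
        case False
        then show ?thesis unfolding reg.galg_act_laplacian[OF f] by (simp add: regular_rep_def f_def)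
      qed
    qed
    moreover have "f \<in> fixed_perp H ?reg"
    proof -
      \<comment> \<open>The orbit sum of v is a fixed vector, hence orthogonal to v, and this inner
        product is conjugate to the sum of f.\<close>
      define s where "s = (\<lambda>b. \<Sum>x\<in>carrier H. 1 * rep_act R x v b)"
      have s: "s \<in> rep_space R" unfolding s_def by (intro sum_closed act_closed vR)
      have "rep_act R h s = s" if h: "h \<in> carrier H" for h
      proof
        fix b
        have "rep_act R h s b = (\<Sum>x\<in>carrier H. rep_act R (h \<otimes>\<^bsub>H\<^esub> x) v b)"
          unfolding s_def using h by (subst act_sum) (auto simp: act_closed vR act_mult)
        also have "\<dots> = s b" unfolding s_def using sum_carrier_left_translate[OF h, of "\<lambda>x. rep_act R x v b"] by simp
        finally show "rep_act R h s b = s b" .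
      qed
      then have "s \<in> fixed_space H R" using s by (simp add: fixed_space_def)
      then have s0: "rep_inner R v s = 0" using v by (simp add: fixed_perp_def)
      have "(\<Sum>x\<in>carrier H. f x) = cnj (rep_inner R s v)"
        unfolding s_def inner_sum_left cnj_sum by (intro sum.cong refl) (simp add: f_def inner_commute[of v])
      then have sf: "(\<Sum>x\<in>carrier H. f x) = 0" using s0 inner_commute[of v s] by simp
      then show ?thesis using f by (simp add: regular_fixed_perp[OF group_axioms])
    qed
    ultimately show "e \<in> laplacian_eigenvalues H w ?reg" using fn by (auto simp: laplacian_eigenvalues_def)
  qed
  then have "\<not> fixed_space H ?reg = rep_space ?reg"
    using ne reg.fixed_space_neq by (auto simp: laplacian_eigenvalues_def)
  then show ?thesis
    using False Min_antimono[OF sub ne reg.finite_laplacian_eigenvalues[where w = w, OF w]]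
    by (simp add: psi_group_def psi_def)
qed

end

lemma (in continuous_unitary_rep) psi_group_le_psi:
  assumes w: "\<And>h. h \<in> carrier H \<Longrightarrow> w (inv\<^bsub>H\<^esub> h) = w h"
  shows "psi_group H w \<le> psi H w R"
proof (cases "fixed_space H R = rep_space R")
  case True
  then show ?thesis by (simp add: psi_def)
next
  case False
  obtain e v where "v \<in> fixed_perp H R" "v \<noteq> (\<lambda>b. 0)"
    "galg_act H R (laplacian H w) v = (\<lambda>b. complex_of_real e * v b)"
    using psi_attained[where w = w, OF w False] by metis
  then have "laplacian_eigenvalues H w R \<noteq> {}" by (auto simp: laplacian_eigenvalues_def)
  then show ?thesis by (intro psi_group_le w)
qed

section \<open>Simultaneous eigenfunctions of commuting translations\<close>

lemma sum_power_inverse_roots_unity: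
  assumes "i < m"
  shows "(\<Sum>z | z ^ m = 1. inverse z ^ i) = (if i = 0 then of_nat m else (0 :: complex))"
proof (cases "i = 0")
  case True
  then show ?thesis using assms by (simp add: card_roots_unity_eq)
next
  case False
  define u where "u = cis (2 * pi * real 1 / real m)"
  have bij: "bij_betw (\<lambda>k. cis (2 * pi * real k / real m)) {..<m} {z. z ^ m = 1}"
    using assms by (intro bij_betw_roots_unity) simp
  have ui: "u ^ i = cis (2 * pi * real i / real m)" by (simp add: u_def Complex.DeMoivre mult_ac)
  have um: "u ^ m = 1" using assms by (simp add: u_def Complex.DeMoivre)
  then have u0: "u \<noteq> 0" using assms by (auto simp: power_0_left)
  have "u ^ i \<noteq> 1"
  proof
    assume "u ^ i = 1"
    then have "cis (2 * pi * real i / real m) = cis (2 * pi * real 0 / real m)" by (simp add: ui)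
    then show False using inj_onD[OF bij_betw_imp_inj_on[OF bij], of i 0] assms False by simp
  qed
  \<comment> \<open>Multiplication by the primitive root \<open>u\<close> permutes the roots of
    unity, so the sum equals itself times \<open>inverse (u ^ i)\<close>, a factor different from
    1.\<close>
  have "(\<Sum>z | z ^ m = 1. inverse z ^ i) = (\<Sum>z | z ^ m = 1. inverse (u * z) ^ i)"
    by (rule sum.reindex_bij_witness[of _ "\<lambda>z. u * z" "\<lambda>z. z / u"])
      (use u0 um in \<open>auto simp: power_mult_distrib power_divide\<close>)
  also have "\<dots> = inverse (u ^ i) * (\<Sum>z | z ^ m = 1. inverse z ^ i)"
    by (simp add: sum_distrib_left power_mult_distrib power_inverse)
  finally have "(\<Sum>z | z ^ m = 1. inverse z ^ i) * (u ^ i - 1) = 0" using u0 by (simp add: field_simps)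
  then show ?thesis using \<open>u ^ i \<noteq> 1\<close> False by simp
qed

text \<open>Diagonalisation by Fourier inversion on cyclic groups: \<open>u z\<close> is m times the
  projection of f onto the eigenvalue z of right translation by k. These functions add up to m f
  over the m-th roots of unity z, so one of them is non-zero. Each is a combination of translates by
  powers of k, which commute with the elements already treated and keep their eigenvalues.\<close>

lemma (in group) common_right_eigenfunction:
  fixes E :: "('a \<Rightarrow> complex) set"
  assumes fin: "finite (carrier G)"
    and supp: "\<And>f x. f \<in> E \<Longrightarrow> x \<notin> carrier G \<Longrightarrow> f x = 0"
    and comb: "\<And>(A :: nat set) z u. (\<And>i. i \<in> A \<Longrightarrow> u i \<in> E) \<Longrightarrow> (\<lambda>x. \<Sum>i\<in>A. z i * u i x) \<in> E"
    and right: "\<And>f k. f \<in> E \<Longrightarrow> k \<in> carrier G \<Longrightarrow> (\<lambda>x. if x \<in> carrier G then f (x \<otimes> k) else 0) \<in> E"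
    and f0: "f0 \<in> E" "f0 \<noteq> (\<lambda>x. 0)"
    and S: "S \<subseteq> carrier G" "\<And>s t. s \<in> S \<Longrightarrow> t \<in> S \<Longrightarrow> s \<otimes> t = t \<otimes> s"
  shows "\<exists>f\<in>E. f \<noteq> (\<lambda>x. 0) \<and> (\<forall>s\<in>S. \<exists>z. \<forall>x\<in>carrier G. f (x \<otimes> s) = z * f x)"
proof -
  have "finite S" using S(1) fin by (rule finite_subset)
  then show ?thesis using S
  proof (induction S)
    case empty
    then show ?case using f0 by auto
  next
    case (insert k S)
    obtain f where f: "f \<in> E" "f \<noteq> (\<lambda>x. 0)" and fS: "\<And>s. s \<in> S \<Longrightarrow> \<exists>z. \<forall>x\<in>carrier G. f (x \<otimes> s) = z * f x"
      using insert by auto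
    have k: "k \<in> carrier G" using insert.prems by simp
    define m where "m = order G"
    have m: "m > 0" using fin order_gt_0_iff_finite by (simp add: m_def)
    have km: "k [^] m = \<one>" using k by (simp add: m_def pow_order_eq_1)
    define u where "u z x = (\<Sum>i<m. inverse z ^ i * (if x \<in> carrier G then f (x \<otimes> k [^] i) else 0))" for z x
    have uE: "u z \<in> E" for z unfolding u_def using right[OF f(1)] k by (intro comb) simp
    have ux: "u z x = (\<Sum>i<m. inverse z ^ i * f (x \<otimes> k [^] i))" if "x \<in> carrier G" for z x
      using that by (simp add: u_def)
    have "\<exists>z. z ^ m = 1 \<and> u z \<noteq> (\<lambda>x. 0)"
    proof (rule ccontr)
      assume "\<not> ?thesis"
      then have u0: "u z x = 0" if "z ^ m = 1" for z x using that by auto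
      have "f x = 0" for x
      proof (cases "x \<in> carrier G")
        case True
        have "0 = (\<Sum>z | z ^ m = 1. u z x)" using u0 by simp
        also have "\<dots> = (\<Sum>i<m. (\<Sum>z | z ^ m = 1. inverse z ^ i) * f (x \<otimes> k [^] i))"
          unfolding ux[OF True] sum_distrib_right by (rule sum.swap)
        also have "\<dots> = (\<Sum>i<m. if i = 0 then of_nat m * f (x \<otimes> k [^] i) else 0)"
          by (intro sum.cong refl) (simp add: sum_power_inverse_roots_unity)
        also have "\<dots> = of_nat m * f x" using m True by simp
        finally show ?thesis using m by simp
      qed (use supp f in auto)
      then show False using f by auto
    qed
    then obtain z where z: "z ^ m = 1" "u z \<noteq> (\<lambda>x. 0)" by blast
    have z0: "z \<noteq> 0" using z m by (auto simp: power_0_left)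
    have uk: "u z (x \<otimes> k) = z * u z x" if x: "x \<in> carrier G" for x
    proof -
      define g where "g i = inverse z ^ i * f (x \<otimes> k [^] i)" for i
      have g: "g m = g 0" unfolding g_def by (simp add: z km power_inverse)
      have kc: "k \<otimes> k [^] i = k [^] i \<otimes> k" for i :: nat using k by (metis nat_pow_Suc nat_pow_Suc2)
      have "u z (x \<otimes> k) = (\<Sum>i<m. z * g (Suc i))"
        using x k by (simp add: ux) (intro sum.cong refl, simp add: g_def m_assoc z0 kc field_simps)
      also have "\<dots> = z * (\<Sum>i<m. g (Suc i))" by (simp only: sum_distrib_left)
      also have "(\<Sum>i<m. g (Suc i)) = (\<Sum>i<m. g i)"
        using sum.lessThan_Suc_shift[of g m] g by simp
      finally show ?thesis using x by (simp add: ux g_def)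
    qed
    have us: "\<exists>y. \<forall>x\<in>carrier G. u z (x \<otimes> s) = y * u z x" if s: "s \<in> S" for s
    proof -
      obtain y where y: "\<forall>x\<in>carrier G. f (x \<otimes> s) = y * f x" using fS[OF s] by blast
      have sc: "s \<in> carrier G" using s insert.prems by auto
      have ks: "k [^] i \<otimes> s = s \<otimes> k [^] i" for i :: nat
      proof (induction i)
        case (Suc i)
        have "k [^] Suc i \<otimes> s = k [^] i \<otimes> (k \<otimes> s)" using k sc by (simp add: m_assoc)
        also have "k \<otimes> s = s \<otimes> k" using insert.prems(2) s by simp
        also have "k [^] i \<otimes> (s \<otimes> k) = s \<otimes> k [^] Suc i" using Suc k sc by (simp add: m_assoc[symmetric])
        finally show ?case .
      qed (use sc in simp)
      have "u z (x \<otimes> s) = y * u z x" if x: "x \<in> carrier G" for x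
      proof -
        have "f (x \<otimes> s \<otimes> k [^] i) = y * f (x \<otimes> k [^] i)" for i :: nat
          using y x k sc ks[of i] by (metis m_assoc m_closed nat_pow_closed)
        then show ?thesis using x sc by (simp add: ux sum_distrib_left mult_ac)
      qed
      then show ?thesis by blast
    qed
    show ?case using uE z uk us by (intro bexI[of _ "u z"]) auto
  qed
qed

section \<open>The wreath product\<close>

locale wreath_weights = comm_group G for G :: "('a, 'm) monoid_scheme" (structure) +
  fixes n :: nat and a :: "nat \<Rightarrow> nat \<Rightarrow> real" and c :: "(nat \<Rightarrow> 'a) \<Rightarrow> real" and w :: "'a wr \<Rightarrow> real"
  assumes finG: "finite (carrier G)" and n2: "n \<ge> 2"
    and a_nonneg: "\<And>i j. 1 \<le> i \<Longrightarrow> i < j \<Longrightarrow> j \<le> n \<Longrightarrow> a i j \<ge> 0"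
    and c_nonneg: "\<And>g. g \<in> carrier (base_group G n) \<Longrightarrow> c g \<ge> 0"
    and c_inv: "\<And>g. g \<in> carrier (base_group G n) \<Longrightarrow> c g = c (inv\<^bsub>base_group G n\<^esub> g)"
    and w_eq: "w = (\<lambda>x.
           (\<Sum>(i, j)\<in>{(i, j). 1 \<le> i \<and> i < j \<and> j \<le> n}.
              a i j * galg_unit (sym_emb G n (transpose i j)) x) +
           (\<Sum>g\<in>carrier (base_group G n). c g * galg_unit (base_emb n g) x))"
begin

abbreviation B where "B \<equiv> base_group G n"
abbreviation H where "H \<equiv> wreath G n"
abbreviation swap :: "nat \<Rightarrow> nat \<Rightarrow> 'a wr" where "swap i j \<equiv> sym_emb G n (transpose i j)"
abbreviation pairs where "pairs \<equiv> {(i, j). 1 \<le> i \<and> i < j \<and> j \<le> n}"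

lemma group_B: "group B" by simp

lemma group_H: "group H" by (rule group_wreath) (rule group_axioms)

lemma finite_B: "finite (carrier B)"
  using finG by (auto intro: finite_PiE)

lemma carrier_H: "carrier H = carrier B \<times> {p. p permutes {1..n}}"
  by (simp add: wreath_def sym_group_def)

lemma finite_H: "finite (carrier H)"
  unfolding carrier_H using finite_B by (intro finite_cartesian_product finite_permutations) auto

lemma mult_H: "(g, p) \<otimes>\<^bsub>H\<^esub> (h, q) = (\<lambda>i\<in>{1..n}. g i \<otimes> h (inv' p i), p \<circ> q)"
  by (auto simp: wreath_def sym_group_mult perm_act_def fun_eq_iff)

lemma one_H: "\<one>\<^bsub>H\<^esub> = (\<lambda>i\<in>{1..n}. \<one>, id)"
  by (simp add: wreath_def sym_group_def)

lemma base_emb_eq: "base_emb n g = (g, id)"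
  by (simp add: base_emb_def sym_group_def)

lemma sym_emb_eq: "sym_emb G n p = (\<lambda>i\<in>{1..n}. \<one>, p)"
  by (simp add: sym_emb_def)

lemma base_emb_closed: "g \<in> carrier B \<Longrightarrow> base_emb n g \<in> carrier H"
  unfolding base_emb_eq carrier_H by (simp add: permutes_id del: carrier_product_group)

lemma sym_emb_closed: "p permutes {1..n} \<Longrightarrow> sym_emb G n p \<in> carrier H"
  unfolding sym_emb_eq carrier_H by auto

lemma pairs_permutes: "(i, j) \<in> pairs \<Longrightarrow> transpose i j permutes {1..n}"
  by (rule permutes_swap_id) auto

lemma B_in: "g \<in> carrier B \<Longrightarrow> i \<in> {1..n} \<Longrightarrow> g i \<in> carrier G"
  by auto

lemma B_ext: "g \<in> carrier B \<Longrightarrow> restrict g {1..n} = g"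
  by (auto simp: PiE_iff extensional_restrict)

lemma perm_in: "p permutes {1..n} \<Longrightarrow> i \<in> {1..n} \<Longrightarrow> p i \<in> {1..n}"
  by (subst permutes_in_image)

lemma inv_sym_emb: "p permutes {1..n} \<Longrightarrow> inv\<^bsub>H\<^esub> (sym_emb G n p) = sym_emb G n (inv' p)"
proof -
  assume p: "p permutes {1..n}"
  interpret H: group H by (rule group_H)
  have "sym_emb G n (inv' p) \<otimes>\<^bsub>H\<^esub> sym_emb G n p = \<one>\<^bsub>H\<^esub>"
    unfolding sym_emb_eq mult_H one_H using permutes_inv_o[OF p] perm_in[OF permutes_inv[OF permutes_inv[OF p]]]
    by (auto simp: fun_eq_iff)
  then show ?thesis using sym_emb_closed p permutes_inv[OF p] by (intro H.inv_equality) auto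
qed

lemma inv_swap: "(i, j) \<in> pairs \<Longrightarrow> inv\<^bsub>H\<^esub> (swap i j) = swap i j"
  using inv_sym_emb[OF pairs_permutes[of i j]] by (simp add: inv_unique_comp)

lemma base_mult: "g \<in> carrier B \<Longrightarrow> (h, q) \<in> carrier H \<Longrightarrow> base_emb n g \<otimes>\<^bsub>H\<^esub> (h, q) = (g \<otimes>\<^bsub>B\<^esub> h, q)"
  unfolding base_emb_eq mult_H by auto

lemma inv_base_emb: "g \<in> carrier B \<Longrightarrow> inv\<^bsub>H\<^esub> (base_emb n g) = base_emb n (inv\<^bsub>B\<^esub> g)"
proof -
  assume g: "g \<in> carrier B"
  interpret H: group H by (rule group_H)
  interpret B: group B by (rule group_B)
  have "base_emb n (inv\<^bsub>B\<^esub> g) \<otimes>\<^bsub>H\<^esub> base_emb n g = \<one>\<^bsub>H\<^esub>"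
    using base_mult[of "inv\<^bsub>B\<^esub> g" g id] base_emb_closed[OF g] g B.l_inv[OF g] B.inv_closed[OF g]
    by (simp add: base_emb_eq one_H del: carrier_product_group inv_product_group mult_product_group)
  then show ?thesis using base_emb_closed g B.inv_closed by (intro H.inv_equality) blast+
qed

lemma swap_mult:
  assumes "(i, j) \<in> pairs" "(h, q) \<in> carrier H"
  shows "swap i j \<otimes>\<^bsub>H\<^esub> (h, q) = (\<lambda>k\<in>{1..n}. h (transpose i j k), transpose i j \<circ> q)"
proof -
  have "h (transpose i j k) \<in> carrier G" if "k \<in> {1..n}" for k
    using assms(2) perm_in[OF pairs_permutes[OF assms(1)] that] B_in unfolding carrier_H by blast
  then show ?thesis unfolding sym_emb_eq mult_H by (auto simp: inv_unique_comp fun_eq_iff)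
qed

lemma swap_closed: "(i, j) \<in> pairs \<Longrightarrow> swap i j \<in> carrier H"
  by (rule sym_emb_closed[OF pairs_permutes])

text \<open>Stated over a normed field so as to serve both the complex Laplacian and the real
  energies.\<close>

lemma sum_weights:
  fixes F :: "'a wr \<Rightarrow> 'c :: real_normed_field"
  shows "(\<Sum>h\<in>carrier H. of_real (w h) * F h)
    = (\<Sum>(i, j)\<in>pairs. of_real (a i j) * F (swap i j)) + (\<Sum>g\<in>carrier B. of_real (c g) * F (base_emb n g))"
proof -
  have unit: "(\<Sum>h\<in>carrier H. of_real (galg_unit k h) * F h) = F k" if "k \<in> carrier H" for k
  proof -
    have "(\<Sum>h\<in>carrier H. of_real (galg_unit k h) * F h) = (\<Sum>h\<in>carrier H. if h = k then F h else 0)"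
      by (intro sum.cong refl) (simp add: galg_unit_def)
    then show ?thesis using that finite_H by simp
  qed
  have "(\<Sum>h\<in>carrier H. of_real (w h) * F h)
     = (\<Sum>h\<in>carrier H. \<Sum>(i, j)\<in>pairs. of_real (a i j) * (of_real (galg_unit (swap i j) h) * F h))
     + (\<Sum>h\<in>carrier H. \<Sum>g\<in>carrier B. of_real (c g) * (of_real (galg_unit (base_emb n g) h) * F h))"
    unfolding w_eq sum.distrib[symmetric]
    by (intro sum.cong refl) (simp add: distrib_right sum_distrib_right case_prod_unfold mult.assoc)
  also have "(\<Sum>h\<in>carrier H. \<Sum>(i, j)\<in>pairs. of_real (a i j) * (of_real (galg_unit (swap i j) h) * F h))
     = (\<Sum>(i, j)\<in>pairs. of_real (a i j) * (\<Sum>h\<in>carrier H. of_real (galg_unit (swap i j) h) * F h))"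
    unfolding sum_distrib_left case_prod_unfold by (rule sum.swap)
  also have "\<dots> = (\<Sum>(i, j)\<in>pairs. of_real (a i j) * F (swap i j))"
  proof (rule sum.cong[OF refl])
    fix x assume "x \<in> pairs"
    then show "(case x of (i, j) \<Rightarrow> of_real (a i j) * (\<Sum>h\<in>carrier H. of_real (galg_unit (swap i j) h) * F h))
      = (case x of (i, j) \<Rightarrow> of_real (a i j) * F (swap i j))"
      by (cases x) (simp only: unit swap_closed prod.case)
  qed
  also have "(\<Sum>h\<in>carrier H. \<Sum>g\<in>carrier B. of_real (c g) * (of_real (galg_unit (base_emb n g) h) * F h))
     = (\<Sum>g\<in>carrier B. of_real (c g) * (\<Sum>h\<in>carrier H. of_real (galg_unit (base_emb n g) h) * F h))"
    unfolding sum_distrib_left by (rule sum.swap)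
  also have "\<dots> = (\<Sum>g\<in>carrier B. of_real (c g) * F (base_emb n g))"
    by (intro sum.cong refl arg_cong2[of _ _ _ _ "(*)"] unit base_emb_closed)
  finally show ?thesis .
qed

lemmas sum_weights_real = sum_weights[where 'c = real, simplified of_real_eq_id id_apply]

lemma w_inv:
  assumes h: "h \<in> carrier H" shows "w (inv\<^bsub>H\<^esub> h) = w h"
proof -
  interpret H: group H by (rule group_H)
  interpret B: group B by (rule group_B)
  have i: "galg_unit k (inv\<^bsub>H\<^esub> h) = galg_unit (inv\<^bsub>H\<^esub> k) h" if "k \<in> carrier H" for k
    unfolding galg_unit_def using that h by (metis H.inv_inv)
  have "(\<Sum>(i, j)\<in>pairs. a i j * galg_unit (swap i j) (inv\<^bsub>H\<^esub> h)) = (\<Sum>(i, j)\<in>pairs. a i j * galg_unit (swap i j) h)"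
  proof (rule sum.cong[OF refl])
    fix x assume "x \<in> pairs"
    then show "(case x of (i, j) \<Rightarrow> a i j * galg_unit (swap i j) (inv\<^bsub>H\<^esub> h)) = (case x of (i, j) \<Rightarrow> a i j * galg_unit (swap i j) h)"
      by (cases x) (simp only: i swap_closed inv_swap prod.case)
  qed
  moreover have "(\<Sum>g\<in>carrier B. c g * galg_unit (base_emb n g) (inv\<^bsub>H\<^esub> h)) = (\<Sum>g\<in>carrier B. c g * galg_unit (base_emb n g) h)"
  proof -
    have "(\<Sum>g\<in>carrier B. c g * galg_unit (base_emb n g) (inv\<^bsub>H\<^esub> h)) = (\<Sum>g\<in>carrier B. c (inv\<^bsub>B\<^esub> g) * galg_unit (base_emb n (inv\<^bsub>B\<^esub> g)) h)"
      by (intro sum.cong refl) (simp only: i base_emb_closed inv_base_emb c_inv[symmetric])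
    also have "\<dots> = (\<Sum>g\<in>carrier B. c g * galg_unit (base_emb n g) h)"
      by (rule sum.reindex_bij_witness[of _ "m_inv B" "m_inv B"]) (simp_all only: B.inv_inv B.inv_closed)
    finally show ?thesis .
  qed
  ultimately show ?thesis unfolding w_eq by simp
qed

text \<open>The hypotheses concern \<open>a i j\<close> for i < j only, whereas the interchange
  process is set up with symmetric rates and sums over ordered pairs.\<close>

definition rate :: "nat \<Rightarrow> nat \<Rightarrow> real" where
  "rate i j = (if i < j then a i j else if j < i then a j i else 0)"

lemma rate_commute: "rate i j = rate j i"
  by (simp add: rate_def)

lemma rate_nonneg: "i \<in> {1..n} \<Longrightarrow> j \<in> {1..n} \<Longrightarrow> rate i j \<ge> 0"
  using a_nonneg by (auto simp: rate_def)

lemma sum_pairs_cong: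
  assumes "\<And>i j. (i, j) \<in> pairs \<Longrightarrow> f i j = g i j"
  shows "(\<Sum>(i, j)\<in>pairs. f i j) = (\<Sum>(i, j)\<in>pairs. g i j)"
  using assms by (intro sum.cong refl) auto

lemma sum_pairs_rate:
  fixes F :: "nat \<Rightarrow> nat \<Rightarrow> real"
  assumes "\<And>i j. F i j = F j i"
  shows "(\<Sum>(i, j)\<in>pairs. a i j * F i j) = (\<Sum>i\<in>{1..n}. \<Sum>j\<in>{1..n}. rate i j * F i j) / 2"
proof -
  define T where "T i j = (if i < j then a i j * F i j else 0)" for i j
  have "(\<Sum>(i, j)\<in>pairs. a i j * F i j) = (\<Sum>(i, j)\<in>{1..n} \<times> {1..n}. T i j)"
    by (rule sum.mono_neutral_cong_left) (auto simp: T_def split: if_splits)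
  then have 1: "(\<Sum>(i, j)\<in>pairs. a i j * F i j) = (\<Sum>i\<in>{1..n}. \<Sum>j\<in>{1..n}. T i j)"
    by (simp add: sum.cartesian_product)
  have "(\<Sum>i\<in>{1..n}. \<Sum>j\<in>{1..n}. rate i j * F i j) = (\<Sum>i\<in>{1..n}. \<Sum>j\<in>{1..n}. T i j + T j i)"
    by (intro sum.cong refl) (auto simp: T_def rate_def assms)
  also have "\<dots> = (\<Sum>i\<in>{1..n}. \<Sum>j\<in>{1..n}. T i j) + (\<Sum>i\<in>{1..n}. \<Sum>j\<in>{1..n}. T j i)"
    by (simp add: sum.distrib)
  also have "(\<Sum>i\<in>{1..n}. \<Sum>j\<in>{1..n}. T j i) = (\<Sum>i\<in>{1..n}. \<Sum>j\<in>{1..n}. T i j)" by (rule sum.swap)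
  finally show ?thesis using 1 by simp
qed

section \<open>The standard representation and the trivial base character\<close>

abbreviation Std :: "('a wr, nat) rep" where "Std \<equiv> wreath_std_rep n"

lemma continuous_unitary_rep_std: "continuous_unitary_rep H Std"
proof -
  interpret H: group H by (rule group_H)
  interpret unitary_rep H Std by (rule unitary_rep_wreath_std_rep)
  note d = wreath_std_rep_def lift_rep_def std_rep_def
  show ?thesis
  proof
    show "finite (carrier H)" by (rule finite_H)
    have c1: "closed {v :: nat \<Rightarrow> complex. v x = 0}" for x
      using continuous_closed_preimage_constant[OF continuous_on_coordinate closed_UNIV, of x 0] by simp
    have c2: "closed {v :: nat \<Rightarrow> complex. (\<Sum>i\<in>{1..n}. v i) = 0}"
    proof -
      have "continuous_on UNIV (\<lambda>v :: nat \<Rightarrow> complex. \<Sum>i\<in>{1..n}. v i)"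
        by (intro continuous_on_sum continuous_on_coordinate)
      from continuous_closed_preimage_constant[OF this closed_UNIV, of 0] show ?thesis by simp
    qed
    have eq: "rep_space Std = (\<Inter>x\<in>- {1..n}. {v. v x = 0}) \<inter> {v. (\<Sum>i\<in>{1..n}. v i) = 0}"
      by (auto simp: d)
    show "closed (rep_space Std)" unfolding eq by (intro closed_Int closed_INT ballI c1 c2)
    show "continuous_on (rep_space Std) (\<lambda>v. rep_act Std h v b)" for h :: "'a wr" and b
      by (simp add: d continuous_on_coordinate)
  qed
qed

lemma std_fixed_space: "fixed_space H Std = {\<lambda>i. 0}"
proof
  interpret std: continuous_unitary_rep H Std by (rule continuous_unitary_rep_std)
  note d = wreath_std_rep_def lift_rep_def std_rep_def
  show "{\<lambda>i. 0} \<subseteq> fixed_space H Std"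
    using std.zero_closed by (auto simp: fixed_space_def d)
  show "fixed_space H Std \<subseteq> {\<lambda>i. 0}"
  proof
    fix v assume "v \<in> fixed_space H Std"
    then have v: "v \<in> rep_space Std"
      and fixed: "\<And>h. h \<in> carrier H \<Longrightarrow> rep_act Std h v = v" by (auto simp: fixed_space_def)
    have "v i = v 1" if i: "i \<in> {1..n}" for i
    proof -
      have "transpose 1 i permutes {1..n}" using i by (intro permutes_swap_id) auto
      from fun_cong[OF fixed[OF sym_emb_closed[OF this]], of i] show ?thesis
        by (simp add: d sym_emb_eq inv_unique_comp)
    qed
    then have "(\<Sum>i\<in>{1..n}. v i) = (\<Sum>i\<in>{1..n}. v 1)" by (rule sum.cong[OF refl])
    moreover have "(\<Sum>i\<in>{1..n}. v i) = 0" using v by (simp add: d)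
    ultimately have "v 1 = 0" using n2 by simp
    then have "v i = 0" for i using \<open>\<And>i. i \<in> {1..n} \<Longrightarrow> v i = v 1\<close> v by (cases "i \<in> {1..n}") (simp_all add: d)
    then show "v \<in> {\<lambda>i. 0}" by auto
  qed
qed

text \<open>The base group acts trivially on the lifted representation, so its weights contribute no
  energy, and the spectral gap on sum-zero vectors is that of the random walk with these rates. This
  is the form in which Aldous' theorem uses it.\<close>

lemma std_poincare:
  obtains \<mu> where "psi H w Std = ereal \<mu>"
    "\<And>v. sum v {1..n} = 0 \<Longrightarrow> \<mu> * (\<Sum>i\<in>{1..n}. (v i)\<^sup>2) \<le> (\<Sum>i\<in>{1..n}. \<Sum>j\<in>{1..n}. rate i j * (v i - v j)\<^sup>2) / 2"
proof -
  interpret std: continuous_unitary_rep H Std by (rule continuous_unitary_rep_std)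
  note d = wreath_std_rep_def lift_rep_def std_rep_def
  \<comment> \<open>The difference of the first two basis vectors shows that the representation is
    not zero, so \<open>psi\<close> is finite; this uses n \<ge> 2.\<close>
  have "(\<lambda>i. if i = 1 then 1 else if i = 2 then -1 else 0) \<in> rep_space Std"
  proof -
    have "(\<Sum>i\<in>{1..n}. if i = 1 then 1 else if i = 2 then -1 else (0 :: complex))
       = (\<Sum>i\<in>{1..n}. (if i = 1 then 1 else 0) + (if i = 2 then -1 else 0))"
      by (intro sum.cong refl) auto
    also have "\<dots> = 0" using n2 by (simp add: sum.distrib)
    finally show ?thesis using n2 by (auto simp: d)
  qed
  moreover have "(\<lambda>i. if i = 1 then 1 else if i = 2 then -1 else (0 :: complex)) \<noteq> (\<lambda>i. 0)"
    by (metis zero_neq_one)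
  ultimately have ne: "fixed_space H Std \<noteq> rep_space Std" unfolding std_fixed_space by blast
  have perp: "fixed_perp H Std = rep_space Std"
    unfolding fixed_perp_def std_fixed_space by (auto simp: rep_inner_def)
  obtain \<mu> where \<mu>: "psi H w Std = ereal \<mu>"
    and min: "\<And>u. u \<in> rep_space Std \<Longrightarrow> \<mu> * (\<Sum>b\<in>rep_index Std. (cmod (u b))\<^sup>2)
        \<le> (\<Sum>h\<in>carrier H. w h * (\<Sum>b\<in>rep_index Std. (cmod (u b - rep_act Std h u b))\<^sup>2)) / 2"
    using std.psi_attained[where w = w, OF w_inv ne] unfolding perp by blast
  show ?thesis
  proof (rule that[OF \<mu>])
    fix v :: "nat \<Rightarrow> real" assume v: "sum v {1..n} = 0"
    define u where "u i = (if i \<in> {1..n} then complex_of_real (v i) else 0)" for i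
    have u: "u \<in> rep_space Std" using v by (auto simp: d u_def of_real_sum[symmetric])
    have bs: "(\<Sum>b\<in>rep_index Std. (cmod (u b - rep_act Std (base_emb n g) u b))\<^sup>2) = 0" for g
      by (simp add: d base_emb_eq)
    have sw: "(\<Sum>b\<in>rep_index Std. (cmod (u b - rep_act Std (swap i j) u b))\<^sup>2) = 2 * (v i - v j)\<^sup>2"
      if ij: "(i, j) \<in> pairs" for i j
    proof -
      have "(\<Sum>b\<in>rep_index Std. (cmod (u b - rep_act Std (swap i j) u b))\<^sup>2) = (\<Sum>b\<in>{i, j}. (cmod (u b - rep_act Std (swap i j) u b))\<^sup>2)"
        using ij by (intro sum.mono_neutral_right) (auto simp: d sym_emb_eq inv_unique_comp)
      also have "\<dots> = (cmod (u i - u j))\<^sup>2 + (cmod (u j - u i))\<^sup>2"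
        using ij by (simp add: d sym_emb_eq inv_unique_comp)
      also have "\<dots> = 2 * (v i - v j)\<^sup>2"
        using ij by (simp add: u_def of_real_diff[symmetric] norm_of_real power2_commute[of "v j"] del: of_real_diff)
      finally show ?thesis .
    qed
    have "(\<Sum>h\<in>carrier H. w h * (\<Sum>b\<in>rep_index Std. (cmod (u b - rep_act Std h u b))\<^sup>2))
        = (\<Sum>(i, j)\<in>pairs. a i j * (2 * (v i - v j)\<^sup>2))"
      unfolding sum_weights_real bs mult_zero_right sum.neutral_const add_0_right
      by (rule sum_pairs_cong) (simp only: sw)
    also have "\<dots> = (\<Sum>i\<in>{1..n}. \<Sum>j\<in>{1..n}. rate i j * (2 * (v i - v j)\<^sup>2)) / 2"
      by (rule sum_pairs_rate) (simp add: power2_commute)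
    also have "\<dots> = (\<Sum>i\<in>{1..n}. \<Sum>j\<in>{1..n}. rate i j * (v i - v j)\<^sup>2)"
      unfolding sum_divide_distrib by (intro sum.cong refl) simp
    finally show "\<mu> * (\<Sum>i\<in>{1..n}. (v i)\<^sup>2) \<le> (\<Sum>i\<in>{1..n}. \<Sum>j\<in>{1..n}. rate i j * (v i - v j)\<^sup>2) / 2"
      using min[OF u] by (simp add: d u_def cong: sum.cong_simp)
  qed
qed

text \<open>An eigenfunction that is invariant under right multiplication by the base group is a function on the
  symmetric group; inversion turns left into right multiplication.\<close>

lemma std_bound:
  assumes f: "f \<in> fixed_perp H (regular_rep H)" "f \<noteq> (\<lambda>x. 0)"
    and ev: "galg_act H (regular_rep H) (laplacian H w) f = (\<lambda>x. complex_of_real e * f x)"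
    and inv: "\<And>g x. g \<in> carrier B \<Longrightarrow> x \<in> carrier H \<Longrightarrow> f (x \<otimes>\<^bsub>H\<^esub> base_emb n g) = f x"
  shows "psi H w Std \<le> ereal e"
proof -
  interpret H: group H by (rule group_H)
  interpret B: group B by (rule group_B)
  interpret reg: continuous_unitary_rep H "regular_rep H"
    by (intro continuous_unitary_rep_regular group_H finite_H)
  have fs: "f \<in> rep_space (regular_rep H)" using f by (simp add: fixed_perp_def)
  let ?one = "\<one>\<^bsub>B\<^esub>" and ?N = "{1..n}"
  have one: "?one \<in> carrier B" by (rule B.one_closed)
  have const: "f (g, p) = f (?one, p)" if g: "g \<in> carrier B" and p: "p permutes ?N" for g p
  proof -
    \<comment> \<open>This h solves \<open>(1, p) h = (g, p)\<close>: right multiplication by the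
      base group reaches every first component, so f depends on p alone.\<close>
    define h where "h = (\<lambda>i\<in>?N. g (p i))"
    have h: "h \<in> carrier B" using g perm_in[OF p] unfolding h_def by (auto simp: PiE_iff)
    have "(?one, p) \<otimes>\<^bsub>H\<^esub> base_emb n h = (g, p)"
    proof -
      have "(\<lambda>i\<in>?N. ?one i \<otimes> h (inv' p i)) = g"
      proof
        fix i show "(\<lambda>i\<in>?N. ?one i \<otimes> h (inv' p i)) i = g i"
          using B_in[OF g, of i] perm_in[OF permutes_inv[OF p], of i] permutes_inverses[OF p] fun_cong[OF B_ext[OF g], of i]
          by (cases "i \<in> ?N") (auto simp: h_def)
      qed
      then show ?thesis unfolding base_emb_eq mult_H by simp
    qed
    then show ?thesis using inv[OF h, of "(?one, p)"] one p by (simp add: carrier_H del: carrier_product_group one_product_group)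
  qed
  define F where "F p = f (?one, inv' p)" for p
  have sumF: "(\<Sum>p | p permutes ?N. F p) = 0"
  proof -
    have "(\<Sum>x\<in>carrier H. f x) = 0" using f(1) by (simp only: regular_fixed_perp[OF group_H])
    then have "(\<Sum>g\<in>carrier B. \<Sum>p | p permutes ?N. f (g, p)) = 0"
      unfolding carrier_H by (simp add: sum.cartesian_product del: carrier_product_group)
    moreover have "(\<Sum>g\<in>carrier B. \<Sum>p | p permutes ?N. f (g, p)) = (\<Sum>g\<in>carrier B. \<Sum>p | p permutes ?N. f (?one, p))"
      by (intro sum.cong refl) (simp add: const del: carrier_product_group one_product_group)
    ultimately have "of_nat (card (carrier B)) * (\<Sum>p | p permutes ?N. f (?one, p)) = 0" by simp
    moreover have "card (carrier B) \<noteq> 0" using one finite_B by (metis card_0_eq empty_iff)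
    ultimately have "(\<Sum>p | p permutes ?N. f (?one, p)) = 0" by simp
    then show ?thesis unfolding F_def using sum_permutations_inverse[of "\<lambda>p. f (?one, p)" ?N] by simp
  qed
  have evF: "(\<Sum>(i, j)\<in>pairs. complex_of_real (a i j) * (F p - F (p \<circ> transpose i j))) = complex_of_real e * F p"
    if p: "p permutes ?N" for p
  proof -
    let ?x = "(?one, inv' p)"
    have ip: "inv' p permutes ?N" using p by (rule permutes_inv)
    have x: "?x \<in> carrier H" using one ip by (simp add: carrier_H del: carrier_product_group one_product_group)
    have "complex_of_real e * F p = galg_act H (regular_rep H) (laplacian H w) f ?x" unfolding ev F_def ..
    also have "\<dots> = (\<Sum>h\<in>carrier H. complex_of_real (w h) * (f ?x - f (inv\<^bsub>H\<^esub> h \<otimes>\<^bsub>H\<^esub> ?x)))"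
      unfolding reg.galg_act_laplacian[OF fs] using x by (simp add: regular_rep_def del: one_product_group)
    also have "\<dots> = (\<Sum>(i, j)\<in>pairs. complex_of_real (a i j) * (f ?x - f (inv\<^bsub>H\<^esub> (swap i j) \<otimes>\<^bsub>H\<^esub> ?x)))
       + (\<Sum>g\<in>carrier B. complex_of_real (c g) * (f ?x - f (inv\<^bsub>H\<^esub> (base_emb n g) \<otimes>\<^bsub>H\<^esub> ?x)))"
      by (rule sum_weights)
    \<comment> \<open>Base elements change only the first component of the argument, on which f does
      not depend; this is the vanishing of the potential.\<close>
    also have "(\<Sum>g\<in>carrier B. complex_of_real (c g) * (f ?x - f (inv\<^bsub>H\<^esub> (base_emb n g) \<otimes>\<^bsub>H\<^esub> ?x))) = 0"
    proof (rule sum.neutral, intro ballI)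
      fix g assume g: "g \<in> carrier B"
      have "inv\<^bsub>H\<^esub> (base_emb n g) \<otimes>\<^bsub>H\<^esub> ?x = (inv\<^bsub>B\<^esub> g, inv' p)"
        using base_mult[OF B.inv_closed[OF g] x] B.r_one[OF B.inv_closed[OF g]] by (simp only: inv_base_emb[OF g])
      then show "complex_of_real (c g) * (f ?x - f (inv\<^bsub>H\<^esub> (base_emb n g) \<otimes>\<^bsub>H\<^esub> ?x)) = 0"
        using const[OF B.inv_closed[OF g] ip] by simp
    qed
    also have "(\<Sum>(i, j)\<in>pairs. complex_of_real (a i j) * (f ?x - f (inv\<^bsub>H\<^esub> (swap i j) \<otimes>\<^bsub>H\<^esub> ?x)))
      = (\<Sum>(i, j)\<in>pairs. complex_of_real (a i j) * (F p - F (p \<circ> transpose i j)))"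
    proof (rule sum.cong[OF refl])
      fix ij assume "ij \<in> pairs"
      then obtain i j where ij: "ij = (i, j)" "(i, j) \<in> pairs" by (cases ij) blast
      have tp: "transpose i j permutes ?N" by (rule pairs_permutes[OF ij(2)])
      have "inv\<^bsub>H\<^esub> (swap i j) \<otimes>\<^bsub>H\<^esub> ?x = (\<lambda>k\<in>?N. ?one (transpose i j k), transpose i j \<circ> inv' p)"
        using swap_mult[OF ij(2) x] inv_swap[OF ij(2)] by simp
      moreover have "(\<lambda>k\<in>?N. ?one (transpose i j k)) = ?one"
        using perm_in[OF tp] by (auto simp: fun_eq_iff)
      moreover have "inv' (p \<circ> transpose i j) = transpose i j \<circ> inv' p"
        using o_inv_distrib[OF permutes_bij[OF p] permutes_bij[OF tp]] by (simp add: inv_unique_comp)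
      ultimately have "f (inv\<^bsub>H\<^esub> (swap i j) \<otimes>\<^bsub>H\<^esub> ?x) = F (p \<circ> transpose i j)"
        by (simp only: F_def)
      then show "(case ij of (i, j) \<Rightarrow> complex_of_real (a i j) * (f ?x - f (inv\<^bsub>H\<^esub> (swap i j) \<otimes>\<^bsub>H\<^esub> ?x)))
         = (case ij of (i, j) \<Rightarrow> complex_of_real (a i j) * (F p - F (p \<circ> transpose i j)))"
        unfolding ij(1) prod.case by (simp only: F_def)
    qed
    finally show ?thesis by simp
  qed
  obtain p0 where p0: "p0 permutes ?N" "F p0 \<noteq> 0"
  proof -
    obtain x where x: "f x \<noteq> 0" using f(2) by (auto simp: fun_eq_iff simp del: split_paired_All)
    then have "x \<in> carrier H" using fs by (cases x) (auto simp: regular_rep_def)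
    then obtain g p where gp: "x = (g, p)" "g \<in> carrier B" "p permutes ?N" by (auto simp: carrier_H simp del: carrier_product_group)
    then have "F (inv' p) \<noteq> 0" using const[OF gp(2,3)] x by (simp add: F_def permutes_inv_inv del: one_product_group)
    then show ?thesis using that permutes_inv[OF gp(3)] by blast
  qed
  obtain \<mu> where \<mu>: "psi H w Std = ereal \<mu>"
    and gap: "\<And>v. sum v ?N = 0 \<Longrightarrow> \<mu> * (\<Sum>i\<in>?N. (v i)\<^sup>2) \<le> (\<Sum>i\<in>?N. \<Sum>j\<in>?N. rate i j * (v i - v j)\<^sup>2) / 2"
    by (rule std_poincare) (rule that)
  have main: "\<mu> \<le> e" if F1: "(\<Sum>p | p permutes ?N. F1 p) = 0" "F1 p0 \<noteq> 0"
    and ev1: "\<And>p. p permutes ?N \<Longrightarrow> (\<Sum>(i, j)\<in>pairs. a i j * (F1 p - F1 (p \<circ> transpose i j))) = e * F1 p"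
    for F1 :: "(nat \<Rightarrow> nat) \<Rightarrow> real"
  proof -
    have "\<mu> * (\<Sum>p | p permutes ?N. (F1 p)\<^sup>2) \<le> swap_energy ?N rate F1"
      by (rule interchange_poincare[OF _ rate_commute rate_nonneg gap F1(1)]) simp
    also have "\<dots> = (\<Sum>p | p permutes ?N. e * F1 p * F1 p)"
      unfolding swap_energy_eq[OF finite_atLeastAtMost]
    proof (intro sum.cong refl)
      fix p assume "p \<in> {p. p permutes ?N}"
      then show "(\<Sum>i\<in>?N. \<Sum>j\<in>?N. rate i j * (F1 p - F1 (p \<circ> transpose i j))) / 2 * F1 p = e * F1 p * F1 p"
        using ev1[of p] sum_pairs_rate[of "\<lambda>i j. F1 p - F1 (p \<circ> transpose i j)"] by (simp add: transpose_commute)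
    qed
    also have "\<dots> = e * (\<Sum>p | p permutes ?N. (F1 p)\<^sup>2)" by (simp add: sum_distrib_left power2_eq_square mult.assoc)
    finally have "\<mu> * (\<Sum>p | p permutes ?N. (F1 p)\<^sup>2) \<le> e * (\<Sum>p | p permutes ?N. (F1 p)\<^sup>2)" .
    moreover have "(F1 p0)\<^sup>2 \<le> (\<Sum>p | p permutes ?N. (F1 p)\<^sup>2)"
      using p0 by (intro member_le_sum) (auto simp: finite_permutations)
    then have "(\<Sum>p | p permutes ?N. (F1 p)\<^sup>2) > 0" using F1(2) zero_less_power2[of "F1 p0"] by linarith
    ultimately show ?thesis by simp
  qed
  have "\<mu> \<le> e"
  proof (cases "Re (F p0) = 0")
    case True
    then have "Im (F p0) \<noteq> 0" using p0 by (simp add: complex_eq_iff)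
    moreover have "(\<Sum>(i, j)\<in>pairs. a i j * (Im (F p) - Im (F (p \<circ> transpose i j)))) = e * Im (F p)" if "p permutes ?N" for p
      using arg_cong[OF evF[OF that], of Im] by (simp add: case_prod_unfold)
    ultimately show ?thesis using arg_cong[OF sumF, of Im] by (intro main[of "\<lambda>p. Im (F p)"]) simp_all
  next
    case False
    moreover have "(\<Sum>(i, j)\<in>pairs. a i j * (Re (F p) - Re (F (p \<circ> transpose i j)))) = e * Re (F p)" if "p permutes ?N" for p
      using arg_cong[OF evF[OF that], of Re] by (simp add: case_prod_unfold)
    ultimately show ?thesis using arg_cong[OF sumF, of Re] by (intro main[of "\<lambda>p. Re (F p)"]) simp_all
  qed
  then show ?thesis by (simp add: \<mu>)
qed

end

section \<open>Characters of the base group and the phase function\<close>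

lemma (in group) character_mult: "\<psi> \<in> characters G \<Longrightarrow> x \<in> carrier G \<Longrightarrow> y \<in> carrier G \<Longrightarrow> \<psi> (x \<otimes> y) = \<psi> x * \<psi> y"
  by (simp add: characters_def)

lemma (in group) character_nonzero: "\<psi> \<in> characters G \<Longrightarrow> x \<in> carrier G \<Longrightarrow> \<psi> x \<noteq> 0"
  by (auto simp: characters_def)

lemma (in group) character_one: "\<psi> \<in> characters G \<Longrightarrow> \<psi> \<one> = 1"
  using character_mult[of \<psi> \<one> \<one>] character_nonzero[of \<psi> \<one>] by simp

lemma (in group) finite_characters:
  assumes "finite (carrier G)" shows "finite (characters G)"
proof -
  have "\<psi> x ^ order G = 1" if \<psi>: "\<psi> \<in> characters G" and x: "x \<in> carrier G" for \<psi> x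
  proof -
    have "\<psi> (x [^] k) = \<psi> x ^ k" for k :: nat
      using x by (induction k) (simp_all add: character_one[OF \<psi>] character_mult[OF \<psi>])
    from this[of "order G"] show ?thesis using x by (simp add: pow_order_eq_1 character_one[OF \<psi>])
  qed
  then have "characters G \<subseteq> (carrier G \<rightarrow>\<^sub>E {z. z ^ order G = 1})"
    by (auto simp: characters_def)
  moreover have "finite (carrier G \<rightarrow>\<^sub>E {z :: complex. z ^ order G = 1})"
    using assms order_gt_0_iff_finite by (intro finite_PiE finite_roots_unity) auto
  ultimately show ?thesis by (rule finite_subset)
qed

context wreath_weights
begin

definition base_char :: "(nat \<Rightarrow> 'a \<Rightarrow> complex) \<Rightarrow> (nat \<Rightarrow> 'a) \<Rightarrow> complex" where
  "base_char b g = (\<Prod>i\<in>{1..n}. b i (g i))"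

text \<open>A unimodular function with the covariance required in the induced representation:
  extended by zero it is itself a vector there, so multiplying it by a function invariant under the
  block subgroup on the right gives another one. Reading g at \<open>p i\<close> makes it invariant
  under left multiplication by permutations, while base elements on the left multiply it by a value
  of the character.\<close>

definition phase :: "(nat \<Rightarrow> 'a \<Rightarrow> complex) \<Rightarrow> 'a wr \<Rightarrow> complex" where
  "phase b x = (\<Prod>i\<in>{1..n}. inverse (b i (fst x (snd x i))))"

lemma block_character_eq:
  assumes "b \<in> {1..n} \<rightarrow> characters G"
  shows "block_character G n b x = base_char b (fst x)"
proof -
  obtain g p where x: "x = (g, p)" by (cases x)
  have "block_character G n b x = (\<Prod>\<psi>\<in>characters G. \<Prod>i\<in>{i\<in>{1..n}. b i = \<psi>}. b i (g i))"
    by (simp add: block_character_def x)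
  also have "\<dots> = (\<Prod>i\<in>{1..n}. b i (g i))"
    by (rule prod.group) (use assms finite_characters[OF finG] in auto)
  finally show ?thesis by (simp add: base_char_def x)
qed

lemma norm_phase:
  assumes "b \<in> {1..n} \<rightarrow> characters G" "x \<in> carrier H"
  shows "cmod (phase b x) = 1"
proof -
  have "cmod (b i (fst x (snd x i))) = 1" if i: "i \<in> {1..n}" for i
  proof (rule norm_character_eq_1[OF group_axioms finG])
    show "b i \<in> characters G" using assms i by blast
    have "fst x \<in> carrier B" "snd x permutes {1..n}" using assms(2) unfolding carrier_H by auto
    then show "fst x (snd x i) \<in> carrier G" using perm_in i B_in by blast
  qed
  then show ?thesis unfolding phase_def prod_norm[symmetric] norm_inverse by simp
qed

lemma phase_swap:
  assumes "(i, j) \<in> pairs" "x \<in> carrier H"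
  shows "phase b (swap i j \<otimes>\<^bsub>H\<^esub> x) = phase b x"
proof -
  obtain g p where x: "x = (g, p)" by (cases x)
  have p: "p permutes {1..n}" using assms(2) by (simp add: x carrier_H)
  show ?thesis
    using assms(2) unfolding phase_def x swap_mult[OF assms(1) assms(2)[unfolded x]]
    by (intro prod.cong refl) (use perm_in[OF pairs_permutes[OF assms(1)] perm_in[OF p]] in auto)
qed

lemma phase_base:
  assumes b: "b \<in> {1..n} \<rightarrow> characters G" and g: "g \<in> carrier B" and x: "x \<in> carrier H"
  shows "phase b (base_emb n g \<otimes>\<^bsub>H\<^esub> x) = inverse (base_char b (\<lambda>i\<in>{1..n}. g (snd x i))) * phase b x"
proof -
  obtain h p where xp: "x = (h, p)" by (cases x)
  have hp: "h \<in> carrier B" "p permutes {1..n}" using x by (auto simp: xp carrier_H simp del: carrier_product_group)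
  have "inverse (b i ((g \<otimes>\<^bsub>B\<^esub> h) (p i))) = inverse (b i (g (p i))) * inverse (b i (h (p i)))" if i: "i \<in> {1..n}" for i
  proof -
    have "g (p i) \<in> carrier G" "h (p i) \<in> carrier G" using g hp(1) B_in perm_in[OF hp(2) i] by blast+
    then have "b i (g (p i) \<otimes> h (p i)) = b i (g (p i)) * b i (h (p i))" using b i by (intro character_mult) auto
    then show ?thesis using perm_in[OF hp(2) i] by simp
  qed
  then show ?thesis
    unfolding phase_def base_char_def xp base_mult[OF g x[unfolded xp]]
    by (simp add: prod.distrib prod_inversef[symmetric, unfolded comp_def])
qed

lemma block_subgroup_iff:
  "(g, p) \<in> block_subgroup G n b \<longleftrightarrow> g \<in> carrier B \<and> p permutes {1..n} \<and> (\<forall>i\<in>{1..n}. b (p i) = b i)"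
  unfolding block_subgroup_def carrier_H by auto

lemma base_emb_block: "g \<in> carrier B \<Longrightarrow> base_emb n g \<in> block_subgroup G n b"
  by (simp add: base_emb_eq block_subgroup_iff permutes_id del: carrier_product_group)

lemma subgroup_block: "subgroup (block_subgroup G n b) H"
proof -
  interpret H: group H by (rule group_H)
  let ?K = "block_subgroup G n b"
  have sub: "?K \<subseteq> carrier H" by (auto simp: block_subgroup_def)
  have mult: "x \<otimes>\<^bsub>H\<^esub> y \<in> ?K" if xy: "x \<in> ?K" "y \<in> ?K" for x y
  proof -
    obtain g p h q where e: "x = (g, p)" "y = (h, q)" by (cases x, cases y)
    have "x \<otimes>\<^bsub>H\<^esub> y \<in> carrier H" using xy sub by blast
    moreover have "b (p (q i)) = b i" if "i \<in> {1..n}" for i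
      using xy that perm_in[of q i] unfolding e block_subgroup_iff by auto
    ultimately show ?thesis unfolding e mult_H by (simp add: block_subgroup_iff carrier_H del: carrier_product_group)
  qed
  show ?thesis
  proof (rule H.subgroupI)
    show "?K \<subseteq> carrier H" by (rule sub)
    have "\<one>\<^bsub>B\<^esub> \<in> carrier B" using group.is_monoid[OF group_B] by (rule monoid.one_closed)
    then show "?K \<noteq> {}" using base_emb_block by blast
    show "x \<otimes>\<^bsub>H\<^esub> y \<in> ?K" if "x \<in> ?K" "y \<in> ?K" for x y using that by (rule mult)
    fix x assume x: "x \<in> ?K"
    \<comment> \<open>In a finite group the inverse is a power, so closure under multiplication
      gives closure under inverses.\<close>
    have "x [^]\<^bsub>H\<^esub> (k :: nat) \<in> ?K" for k
    proof (induction k)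
      case 0
      have "\<one>\<^bsub>H\<^esub> = base_emb n \<one>\<^bsub>B\<^esub>" by (simp add: one_H base_emb_eq)
      then show ?case using base_emb_block[OF \<open>\<one>\<^bsub>B\<^esub> \<in> carrier B\<close>] by simp
    next
      case (Suc k)
      then show ?case using mult x by simp
    qed
    moreover have "inv\<^bsub>H\<^esub> x = x [^]\<^bsub>H\<^esub> (order H - 1)"
    proof -
      have xc: "x \<in> carrier H" using x sub by blast
      have "order H > 0" using finite_H H.order_gt_0_iff_finite by blast
      then have "x [^]\<^bsub>H\<^esub> (order H - 1) \<otimes>\<^bsub>H\<^esub> x = \<one>\<^bsub>H\<^esub>"
        using H.pow_order_eq_1[OF xc] xc by (simp add: H.nat_pow_Suc[symmetric] del: H.nat_pow_Suc)
      then show ?thesis using xc by (intro H.inv_equality) auto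
    qed
    ultimately show "inv\<^bsub>H\<^esub> x \<in> ?K" by simp
  qed
qed

text \<open>The permutation q of k preserves the blocks, so replacing i by \<open>q i\<close> leaves
  the labels unchanged and the product splits into a factor for x and one for k.\<close>

lemma phase_block:
  assumes b: "b \<in> {1..n} \<rightarrow> characters G" and x: "x \<in> carrier H" and k: "k \<in> block_subgroup G n b"
  shows "phase b (x \<otimes>\<^bsub>H\<^esub> k) = inverse (base_char b (fst k)) * phase b x"
proof -
  obtain g p h q where e: "x = (g, p)" "k = (h, q)" by (cases x, cases k)
  have gp: "g \<in> carrier B" "p permutes {1..n}" using x by (auto simp: e carrier_H simp del: carrier_product_group)
  have hq: "h \<in> carrier B" "q permutes {1..n}" and bq: "\<And>i. i \<in> {1..n} \<Longrightarrow> b (q i) = b i"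
    using k by (auto simp: e block_subgroup_iff simp del: carrier_product_group)
  have pq: "p (q i) \<in> {1..n}" if "i \<in> {1..n}" for i using that perm_in gp hq by blast
  define t where "t j = inverse (b j (g (p j))) * inverse (b j (h j))" for j
  have "inverse (b i ((\<lambda>i\<in>{1..n}. g i \<otimes> h (inv' p i)) (p (q i)))) = t (q i)" if i: "i \<in> {1..n}" for i
  proof -
    have "(\<lambda>i\<in>{1..n}. g i \<otimes> h (inv' p i)) (p (q i)) = g (p (q i)) \<otimes> h (q i)"
      using pq[OF i] permutes_inverses[OF gp(2)] by simp
    moreover have "g (p (q i)) \<in> carrier G" "h (q i) \<in> carrier G"
      using gp(1) hq(1) B_in pq[OF i] perm_in[OF hq(2) i] by blast+
    then have "b i (g (p (q i)) \<otimes> h (q i)) = b i (g (p (q i))) * b i (h (q i))"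
      using b i by (intro character_mult) auto
    ultimately show ?thesis using bq[OF i] by (simp add: t_def)
  qed
  then have "phase b (x \<otimes>\<^bsub>H\<^esub> k) = (\<Prod>i\<in>{1..n}. t (q i))"
    unfolding phase_def e mult_H by simp
  also have "\<dots> = (\<Prod>i\<in>{1..n}. t i)" using prod.permute[OF hq(2), of t] by (simp add: o_def)
  also have "\<dots> = inverse (base_char b (fst k)) * phase b x"
    unfolding t_def prod.distrib phase_def base_char_def e by (simp add: prod_inversef[symmetric, unfolded comp_def])
  finally show ?thesis .
qed

text \<open>Applying \<open>phase_block\<close> to k and then to its inverse returns to the non-zero
  phase at the identity; this avoids a formula for inverses in the wreath product.\<close>

lemma base_char_inv:
  assumes b: "b \<in> {1..n} \<rightarrow> characters G" and k: "k \<in> block_subgroup G n b"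
  shows "base_char b (fst (inv\<^bsub>H\<^esub> k)) = inverse (base_char b (fst k))"
proof -
  interpret H: group H by (rule group_H)
  interpret K: subgroup "block_subgroup G n b" H by (rule subgroup_block)
  have kc: "k \<in> carrier H" using k by simp
  have p1: "phase b (\<one>\<^bsub>H\<^esub>) \<noteq> 0" using norm_phase[OF b H.one_closed] by auto
  have "phase b k = inverse (base_char b (fst k)) * phase b \<one>\<^bsub>H\<^esub>"
    using phase_block[OF b H.one_closed k] kc by simp
  moreover have "phase b \<one>\<^bsub>H\<^esub> = inverse (base_char b (fst (inv\<^bsub>H\<^esub> k))) * phase b k"
    using phase_block[OF b kc K.m_inv_closed[OF k]] kc by simp
  ultimately have e: "inverse (base_char b (fst (inv\<^bsub>H\<^esub> k))) * (inverse (base_char b (fst k)) * phase b \<one>\<^bsub>H\<^esub>) = phase b \<one>\<^bsub>H\<^esub>"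
    by simp
  have "inverse (base_char b (fst (inv\<^bsub>H\<^esub> k))) * inverse (base_char b (fst k)) * phase b \<one>\<^bsub>H\<^esub> = 1 * phase b \<one>\<^bsub>H\<^esub>"
    unfolding mult.assoc e by simp
  then have "inverse (base_char b (fst (inv\<^bsub>H\<^esub> k))) * inverse (base_char b (fst k)) = 1"
    by (rule mult_right_cancel[OF p1, THEN iffD1])
  then have "inverse (inverse (base_char b (fst (inv\<^bsub>H\<^esub> k)))) = inverse (base_char b (fst k))" by (rule inverse_unique)
  then show ?thesis by simp
qed

end

section \<open>Test vectors in the induced representations\<close>

lemma L2_set_diff_le:
  fixes u v :: "'k \<Rightarrow> complex"
  assumes "finite K"
  shows "\<bar>L2_set (\<lambda>k. cmod (u k)) K - L2_set (\<lambda>k. cmod (v k)) K\<bar> \<le> L2_set (\<lambda>k. cmod (u k - v k)) K"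
proof -
  have tri: "L2_set (\<lambda>k. cmod (u k)) K \<le> L2_set (\<lambda>k. cmod (v k)) K + L2_set (\<lambda>k. cmod (u k - v k)) K"
    for u v :: "'k \<Rightarrow> complex"
  proof -
    have "L2_set (\<lambda>k. cmod (u k)) K \<le> L2_set (\<lambda>k. cmod (v k) + cmod (u k - v k)) K"
      by (rule L2_set_mono) (use norm_triangle_sub in auto)
    also have "\<dots> \<le> L2_set (\<lambda>k. cmod (v k)) K + L2_set (\<lambda>k. cmod (u k - v k)) K" by (rule L2_set_triangle_ineq)
    finally show ?thesis .
  qed
  show ?thesis using tri[of u v] tri[of v u] by (simp add: norm_minus_commute abs_le_iff)
qed

context wreath_weights
begin

lemma w_sum_mono:
  assumes "\<And>i j. (i, j) \<in> pairs \<Longrightarrow> F (swap i j) \<le> F' (swap i j)"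
    and "\<And>g. g \<in> carrier B \<Longrightarrow> F (base_emb n g) \<le> (F' (base_emb n g) :: real)"
  shows "(\<Sum>h\<in>carrier H. w h * F h) \<le> (\<Sum>h\<in>carrier H. w h * F' h)"
  unfolding sum_weights_real
proof (intro add_mono sum_mono)
  fix x assume "x \<in> pairs"
  then show "(case x of (i, j) \<Rightarrow> a i j * F (swap i j)) \<le> (case x of (i, j) \<Rightarrow> a i j * F' (swap i j))"
    using assms(1) a_nonneg by (cases x) (simp add: mult_left_mono)
next
  fix g assume "g \<in> carrier B"
  then show "c g * F (base_emb n g) \<le> c g * F' (base_emb n g)"
    using assms(2) c_nonneg by (intro mult_left_mono)
qed

text \<open>\<open>V_rep\<close> picks its labelling by Hilbert choice; here the labelling is a
  parameter, so that the construction can follow the character of a given eigenfunction.\<close>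

abbreviation Vind :: "(nat \<Rightarrow> 'a \<Rightarrow> complex) \<Rightarrow> ('a wr, 'a wr \<times> unit) rep" where
  "Vind b \<equiv> induced_rep H (block_subgroup G n b) (linear_rep (block_character G n b))"

lemma Vind_space:
  assumes b: "b \<in> {1..n} \<rightarrow> characters G"
  shows "rep_space (Vind b) = {F. (\<forall>h\<in>- carrier H. F (h, ()) = 0) \<and>
    (\<forall>h\<in>carrier H. \<forall>k\<in>block_subgroup G n b. F (h \<otimes>\<^bsub>H\<^esub> k, ()) = inverse (base_char b (fst k)) * F (h, ()))}"
proof -
  have "(\<lambda>u :: unit. F (h \<otimes>\<^bsub>H\<^esub> k, u)) = rep_act (linear_rep (block_character G n b)) (inv\<^bsub>H\<^esub> k) (\<lambda>u. F (h, u))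
    \<longleftrightarrow> F (h \<otimes>\<^bsub>H\<^esub> k, ()) = inverse (base_char b (fst k)) * F (h, ())"
    if "k \<in> block_subgroup G n b" for F h k
    using base_char_inv[OF b that] by (auto simp: linear_rep_def fun_eq_iff block_character_eq[OF b])
  then show ?thesis
    by (auto simp: induced_rep_def linear_rep_def)
qed

lemma continuous_unitary_rep_Vind:
  assumes b: "b \<in> {1..n} \<rightarrow> characters G" and u: "unitary_rep H (Vind b)"
  shows "continuous_unitary_rep H (Vind b)"
proof -
  interpret H: group H by (rule group_H)
  interpret unitary_rep H "Vind b" by (rule u)
  show ?thesis
  proof
    show "finite (carrier H)" by (rule finite_H)
    have c1: "closed {F :: 'a wr \<times> unit \<Rightarrow> complex. F (h, ()) = 0}" for h
      by (intro closed_Collect_eq continuous_on_coordinate continuous_on_const)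
    have c2: "closed {F :: 'a wr \<times> unit \<Rightarrow> complex. F (h', ()) = z * F (h, ())}" for h' h z
      by (intro closed_Collect_eq continuous_on_coordinate continuous_on_mult continuous_on_const)
    have eq: "rep_space (Vind b) = (\<Inter>h\<in>- carrier H. {F. F (h, ()) = 0}) \<inter>
      (\<Inter>h\<in>carrier H. \<Inter>k\<in>block_subgroup G n b. {F. F (h \<otimes>\<^bsub>H\<^esub> k, ()) = inverse (base_char b (fst k)) * F (h, ())})"
      unfolding Vind_space[OF b] by auto
    show "closed (rep_space (Vind b))" unfolding eq by (intro closed_Int closed_INT ballI c1 c2)
    show "continuous_on (rep_space (Vind b)) (\<lambda>v. rep_act (Vind b) h v z)" for h z
      by (cases z; cases "fst z \<in> carrier H") (simp_all add: induced_rep_def continuous_on_coordinate)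
  qed
qed

lemma Vind_act: "h \<in> carrier H \<Longrightarrow> x \<in> carrier H \<Longrightarrow> rep_act (Vind b) h F (x, ()) = F (inv\<^bsub>H\<^esub> h \<otimes>\<^bsub>H\<^esub> x, ())"
  by (simp add: induced_rep_def)

text \<open>A fixed function is constant on the group. Covariance under the base element with y in
  coordinate i and \<one> elsewhere multiplies it by \<open>inverse (b i y)\<close>, which is not 1,
  so the constant is zero.\<close>

lemma Vind_fixed:
  assumes b: "b \<in> {1..n} \<rightarrow> characters G" and i: "i \<in> {1..n}" "y \<in> carrier G" "b i y \<noteq> 1"
    and F: "F \<in> fixed_space H (Vind b)"
  shows "F = (\<lambda>z. 0)"
proof -
  interpret H: group H by (rule group_H)
  have Fs: "F \<in> rep_space (Vind b)" and fixed: "\<And>h. h \<in> carrier H \<Longrightarrow> rep_act (Vind b) h F = F"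
    using F by (auto simp: fixed_space_def)
  have const: "F (x, ()) = F (\<one>\<^bsub>H\<^esub>, ())" if x: "x \<in> carrier H" for x
    using fun_cong[OF fixed[OF x], of "(x, ())"] x by (simp add: Vind_act)
  define g where "g = (\<lambda>j\<in>{1..n}. if j = i then y else \<one>)"
  have g: "g \<in> carrier B" using i by (auto simp: g_def)
  have "b j \<one> = 1" if "j \<in> {1..n}" for j using b that character_one by blast
  then have "base_char b g = (\<Prod>j\<in>{1..n}. if j = i then b i y else 1)"
    unfolding base_char_def by (intro prod.cong refl) (simp add: g_def)
  also have "\<dots> = b i y" using i by simp
  finally have bg: "base_char b g \<noteq> 1" using i by simp
  have "F (\<one>\<^bsub>H\<^esub> \<otimes>\<^bsub>H\<^esub> base_emb n g, ()) = inverse (base_char b (fst (base_emb n g))) * F (\<one>\<^bsub>H\<^esub>, ())"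
    using Fs base_emb_block[OF g] H.one_closed unfolding Vind_space[OF b] by blast
  then have "F (\<one>\<^bsub>H\<^esub>, ()) = inverse (base_char b g) * F (\<one>\<^bsub>H\<^esub>, ())"
    using const[OF base_emb_closed[OF g]] base_emb_closed[OF g] by (simp add: base_emb_eq)
  moreover have "inverse (base_char b g) \<noteq> 1" using bg by simp
  ultimately have F1: "F (\<one>\<^bsub>H\<^esub>, ()) = 0" by auto
  have "F (x, ()) = 0" for x
    using F1 const[of x] Fs unfolding Vind_space[OF b] by (cases "x \<in> carrier H") auto
  then show ?thesis by auto
qed

text \<open>The modulus of an eigenfunction, averaged in mean square over right cosets of the block subgroup and
  multiplied by a phase, lies in the induced representation; by the reverse triangle inequality its Rayleigh
  quotient is no larger.\<close>

lemma Vind_bound: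
  assumes b: "b \<in> {1..n} \<rightarrow> characters G" and u: "unitary_rep H (Vind b)"
    and i: "i \<in> {1..n}" "y \<in> carrier G" "b i y \<noteq> 1"
    and f: "f \<in> rep_space (regular_rep H)" "f \<noteq> (\<lambda>x. 0)"
    and ev: "galg_act H (regular_rep H) (laplacian H w) f = (\<lambda>x. complex_of_real e * f x)"
    and right: "\<And>g x. g \<in> carrier B \<Longrightarrow> x \<in> carrier H \<Longrightarrow> f (x \<otimes>\<^bsub>H\<^esub> base_emb n g) = inverse (base_char b g) * f x"
  shows "\<not> trivial_rep H (Vind b)" and "psi H w (Vind b) \<le> ereal e"
proof -
  interpret H: group H by (rule group_H)
  interpret B: group B by (rule group_B)
  interpret reg: continuous_unitary_rep H "regular_rep H"
    by (intro continuous_unitary_rep_regular group_H finite_H)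
  interpret V: continuous_unitary_rep H "Vind b" using b u by (rule continuous_unitary_rep_Vind)
  let ?K = "block_subgroup G n b"
  interpret K: subgroup ?K H by (rule subgroup_block)
  have fixed0: "fixed_space H (Vind b) = {\<lambda>z. 0}"
    using Vind_fixed[OF b i] V.zero_closed Vind_act by (auto simp: fixed_space_def induced_rep_def)
  show "\<not> trivial_rep H (Vind b)"
  proof
    assume t: "trivial_rep H (Vind b)"
    then obtain v where v: "v \<noteq> (\<lambda>b. 0)" "rep_space (Vind b) = {u. \<exists>z. u = (\<lambda>b. z * v b)}"
      unfolding trivial_rep_def by blast
    have "v \<in> rep_space (Vind b)" unfolding v(2) by (auto intro: exI[of _ 1])
    then have "v \<in> fixed_space H (Vind b)" using t unfolding trivial_rep_def fixed_space_def by blast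
    then show False using v(1) fixed0 by blast
  qed
  have finK: "finite ?K" using K.subset finite_H by (rule finite_subset)
  define \<Phi> where "\<Phi> x = L2_set (\<lambda>k. cmod (f (x \<otimes>\<^bsub>H\<^esub> k))) ?K" for x
  define \<phi> where "\<phi> x = (if x \<in> carrier H then phase b x * complex_of_real (\<Phi> x) else 0)" for x
  define v where "v z = \<phi> (fst z)" for z :: "'a wr \<times> unit"
  have \<Phi>K: "\<Phi> (x \<otimes>\<^bsub>H\<^esub> k) = \<Phi> x" if x: "x \<in> carrier H" and k: "k \<in> ?K" for x k
  proof -
    have kc: "k \<in> carrier H" using k by (rule K.mem_carrier)
    have c: "inv\<^bsub>H\<^esub> k \<otimes>\<^bsub>H\<^esub> (k \<otimes>\<^bsub>H\<^esub> l) = l" "k \<otimes>\<^bsub>H\<^esub> (inv\<^bsub>H\<^esub> k \<otimes>\<^bsub>H\<^esub> l) = l" "x \<otimes>\<^bsub>H\<^esub> k \<otimes>\<^bsub>H\<^esub> l = x \<otimes>\<^bsub>H\<^esub> (k \<otimes>\<^bsub>H\<^esub> l)"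
      if "l \<in> ?K" for l
      using kc K.mem_carrier[OF that] x by (simp_all add: H.m_assoc[symmetric])
    show ?thesis unfolding \<Phi>_def L2_set_def
      by (rule arg_cong[where f = sqrt], rule sum.reindex_bij_witness[of _ "\<lambda>l. inv\<^bsub>H\<^esub> k \<otimes>\<^bsub>H\<^esub> l" "\<lambda>l. k \<otimes>\<^bsub>H\<^esub> l"])
        (simp_all only: c K.m_closed[OF k] K.m_closed[OF K.m_inv_closed[OF k]])
  qed
  have vV: "v \<in> rep_space (Vind b)"
    unfolding Vind_space[OF b] using phase_block[OF b] \<Phi>K K.mem_carrier
    by (auto simp: v_def \<phi>_def)
  have nv: "(\<Sum>z\<in>rep_index (Vind b). (cmod (v z))\<^sup>2) = real (card ?K) * (\<Sum>x\<in>carrier H. (cmod (f x))\<^sup>2)"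
    and nf: "(\<Sum>x\<in>carrier H. (cmod (f x))\<^sup>2) > 0"
    and en: "(\<Sum>h\<in>carrier H. w h * (\<Sum>z\<in>rep_index (Vind b). (cmod (v z - rep_act (Vind b) h v z))\<^sup>2)) / 2
      \<le> real (card ?K) * (e * (\<Sum>x\<in>carrier H. (cmod (f x))\<^sup>2))"
  proof -
    have idx: "(\<Sum>z\<in>rep_index (Vind b). T z) = (\<Sum>x\<in>carrier H. T (x, ()))" for T :: "_ \<Rightarrow> real"
      by (simp add: induced_rep_def linear_rep_def sum.cartesian_product' UNIV_unit)
    have rt: "(\<Sum>x\<in>carrier H. T (x \<otimes>\<^bsub>H\<^esub> k)) = (\<Sum>x\<in>carrier H. T x)" if "k \<in> ?K" for T :: "_ \<Rightarrow> real" and k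
      by (rule sum.reindex_bij_witness[of _ "\<lambda>x. x \<otimes>\<^bsub>H\<^esub> inv\<^bsub>H\<^esub> k" "\<lambda>x. x \<otimes>\<^bsub>H\<^esub> k"])
        (use that K.mem_carrier in \<open>auto simp: H.m_assoc\<close>)
    have \<Phi>2: "(\<Phi> x)\<^sup>2 = (\<Sum>k\<in>?K. (cmod (f (x \<otimes>\<^bsub>H\<^esub> k)))\<^sup>2)" for x
      unfolding \<Phi>_def L2_set_def by (simp add: sum_nonneg)
    \<comment> \<open>Averaging over the block subgroup multiplies both the square norm and the
      bound on the energy by its order, which cancels in the Rayleigh quotient.\<close>
    have sumK: "(\<Sum>x\<in>carrier H. \<Sum>k\<in>?K. T (x \<otimes>\<^bsub>H\<^esub> k)) = real (card ?K) * (\<Sum>x\<in>carrier H. T x)" for T :: "_ \<Rightarrow> real"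
    proof -
      have "(\<Sum>x\<in>carrier H. \<Sum>k\<in>?K. T (x \<otimes>\<^bsub>H\<^esub> k)) = (\<Sum>k\<in>?K. \<Sum>x\<in>carrier H. T (x \<otimes>\<^bsub>H\<^esub> k))" by (rule sum.swap)
      also have "\<dots> = (\<Sum>k\<in>?K. \<Sum>x\<in>carrier H. T x)" by (intro sum.cong refl rt)
      finally show ?thesis by simp
    qed
    have cm: "cmod (\<phi> x) = \<Phi> x" if "x \<in> carrier H" for x
      using that norm_phase[OF b that] by (simp add: \<phi>_def norm_mult \<Phi>_def)
    have "(\<Sum>z\<in>rep_index (Vind b). (cmod (v z))\<^sup>2) = (\<Sum>x\<in>carrier H. (\<Phi> x)\<^sup>2)"
      unfolding idx v_def by (simp add: cm)
    then show "(\<Sum>z\<in>rep_index (Vind b). (cmod (v z))\<^sup>2) = real (card ?K) * (\<Sum>x\<in>carrier H. (cmod (f x))\<^sup>2)"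
      unfolding \<Phi>2 by (simp only: sumK[of "\<lambda>x. (cmod (f x))\<^sup>2"])
    have innf: "rep_inner (regular_rep H) f f = complex_of_real (\<Sum>x\<in>carrier H. (cmod (f x))\<^sup>2)"
      unfolding reg.inner_self by (simp add: regular_rep_def)
    then have "(\<Sum>x\<in>carrier H. (cmod (f x))\<^sup>2) \<noteq> 0" using reg.inner_self_eq_0[OF f(1)] f(2) by fastforce
    then show "(\<Sum>x\<in>carrier H. (cmod (f x))\<^sup>2) > 0" by (simp add: less_le sum_nonneg)
    define D where "D h x = (cmod (f x - f (inv\<^bsub>H\<^esub> h \<otimes>\<^bsub>H\<^esub> x)))\<^sup>2" for h x
    have eD: "(\<Sum>h\<in>carrier H. w h * (\<Sum>x\<in>carrier H. D h x)) / 2 = e * (\<Sum>x\<in>carrier H. (cmod (f x))\<^sup>2)"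
    proof -
      have "Re (rep_inner (regular_rep H) (galg_act H (regular_rep H) (laplacian H w) f) f) = e * (\<Sum>x\<in>carrier H. (cmod (f x))\<^sup>2)"
        unfolding ev reg.inner_scale_left innf by simp
      then show ?thesis unfolding reg.inner_laplacian_energy[OF f(1)]
        by (simp add: regular_rep_def D_def cong: sum.cong)
    qed
    have ptwise: "(cmod (\<phi> x - \<phi> (inv\<^bsub>H\<^esub> h \<otimes>\<^bsub>H\<^esub> x)))\<^sup>2 \<le> (\<Sum>k\<in>?K. D h (x \<otimes>\<^bsub>H\<^esub> k))"
      if hx: "h \<in> carrier H" "x \<in> carrier H"
        and le: "cmod (\<phi> x - \<phi> (inv\<^bsub>H\<^esub> h \<otimes>\<^bsub>H\<^esub> x)) \<le> L2_set (\<lambda>k. cmod (f (x \<otimes>\<^bsub>H\<^esub> k) - f (inv\<^bsub>H\<^esub> h \<otimes>\<^bsub>H\<^esub> x \<otimes>\<^bsub>H\<^esub> k))) ?K" for h x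
    proof -
      have "(cmod (\<phi> x - \<phi> (inv\<^bsub>H\<^esub> h \<otimes>\<^bsub>H\<^esub> x)))\<^sup>2 \<le> (L2_set (\<lambda>k. cmod (f (x \<otimes>\<^bsub>H\<^esub> k) - f (inv\<^bsub>H\<^esub> h \<otimes>\<^bsub>H\<^esub> x \<otimes>\<^bsub>H\<^esub> k))) ?K)\<^sup>2"
        using le by (intro power_mono) auto
      also have "\<dots> = (\<Sum>k\<in>?K. (cmod (f (x \<otimes>\<^bsub>H\<^esub> k) - f (inv\<^bsub>H\<^esub> h \<otimes>\<^bsub>H\<^esub> x \<otimes>\<^bsub>H\<^esub> k)))\<^sup>2)"
        unfolding L2_set_def by (simp add: sum_nonneg)
      also have "\<dots> = (\<Sum>k\<in>?K. D h (x \<otimes>\<^bsub>H\<^esub> k))"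
        using hx K.mem_carrier by (intro sum.cong refl) (simp add: D_def H.m_assoc)
      finally show ?thesis .
    qed
    \<comment> \<open>The phase does not change under a swap on the left, so the difference is that
      of two norms, to which the reverse triangle inequality applies.\<close>
    have swap_le: "cmod (\<phi> x - \<phi> (inv\<^bsub>H\<^esub> (swap i j) \<otimes>\<^bsub>H\<^esub> x)) \<le> L2_set (\<lambda>k. cmod (f (x \<otimes>\<^bsub>H\<^esub> k) - f (inv\<^bsub>H\<^esub> (swap i j) \<otimes>\<^bsub>H\<^esub> x \<otimes>\<^bsub>H\<^esub> k))) ?K"
      if ij: "(i, j) \<in> pairs" and x: "x \<in> carrier H" for i j x
    proof -
      let ?y = "inv\<^bsub>H\<^esub> (swap i j) \<otimes>\<^bsub>H\<^esub> x"
      have y: "?y \<in> carrier H" using swap_closed[OF ij] x by simp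
      have "\<phi> x - \<phi> ?y = phase b x * complex_of_real (\<Phi> x - \<Phi> ?y)"
        using x y phase_swap[OF ij x, of b] by (simp add: \<phi>_def inv_swap[OF ij] right_diff_distrib)
      then have "cmod (\<phi> x - \<phi> ?y) = \<bar>\<Phi> x - \<Phi> ?y\<bar>"
        using norm_phase[OF b x] by (simp only: norm_mult norm_of_real mult_1)
      then show ?thesis unfolding \<Phi>_def using L2_set_diff_le[OF finK] by simp
    qed
    have base_le: "cmod (\<phi> x - \<phi> (inv\<^bsub>H\<^esub> (base_emb n g) \<otimes>\<^bsub>H\<^esub> x)) \<le> L2_set (\<lambda>k. cmod (f (x \<otimes>\<^bsub>H\<^esub> k) - f (inv\<^bsub>H\<^esub> (base_emb n g) \<otimes>\<^bsub>H\<^esub> x \<otimes>\<^bsub>H\<^esub> k))) ?K"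
      if g0: "g \<in> carrier B" and x: "x \<in> carrier H" for g x
    proof -
      define g' where "g' = inv\<^bsub>B\<^esub> g"
      have g: "g' \<in> carrier B" unfolding g'_def using g0 by (rule B.inv_closed)
      have ig: "inv\<^bsub>H\<^esub> (base_emb n g) = base_emb n g'" unfolding g'_def using g0 by (rule inv_base_emb)
      define m where "m = inverse (base_char b (\<lambda>i\<in>{1..n}. g' (snd x i)))"
      let ?y = "base_emb n g' \<otimes>\<^bsub>H\<^esub> x"
      have y: "?y \<in> carrier H" using base_emb_closed[OF g] x by simp
      \<comment> \<open>The factor m is the same for all k in the block subgroup: moving g' past x k
        permutes its entries also by the permutation of k, which preserves the labels. This is the
        invariance of the potential under the stabiliser, and it gives equality for base
        elements.\<close>
      have fm: "f (?y \<otimes>\<^bsub>H\<^esub> k) = m * f (x \<otimes>\<^bsub>H\<^esub> k)" if k: "k \<in> ?K" for k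
      proof -
        obtain h p where hp: "x \<otimes>\<^bsub>H\<^esub> k = (h, p)" by (cases "x \<otimes>\<^bsub>H\<^esub> k")
        obtain h1 p1 where x1: "x = (h1, p1)" by (cases x)
        obtain h2 q where k2: "k = (h2, q)" by (cases k)
        have xk: "x \<otimes>\<^bsub>H\<^esub> k \<in> carrier H" using x k K.mem_carrier by blast
        then have h: "h \<in> carrier B" and p: "p permutes {1..n}" by (auto simp: hp carrier_H simp del: carrier_product_group)
        have q: "q permutes {1..n}" "\<And>i. i \<in> {1..n} \<Longrightarrow> b (q i) = b i"
          using k by (auto simp: k2 block_subgroup_iff simp del: carrier_product_group)
        have pq: "p = p1 \<circ> q" using hp unfolding x1 k2 mult_H by simp
        define g'' where "g'' = (\<lambda>i\<in>{1..n}. g' (p i))"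
        have g'': "g'' \<in> carrier B" using B_in[OF g] perm_in[OF p] unfolding g''_def by (auto simp: PiE_iff)
        have "?y \<otimes>\<^bsub>H\<^esub> k = base_emb n g' \<otimes>\<^bsub>H\<^esub> (h, p)"
          using x k K.mem_carrier base_emb_closed[OF g] by (simp add: H.m_assoc hp[symmetric])
        \<comment> \<open>Conjugation by (h, p) permutes the entries of the base element; h itself
          drops out because G is commutative.\<close>
        also have "\<dots> = (h, p) \<otimes>\<^bsub>H\<^esub> base_emb n g''"
        proof -
          have "g' i \<otimes> h i = h i \<otimes> g'' (inv' p i)" if i: "i \<in> {1..n}" for i
          proof -
            have "g'' (inv' p i) = g' i" using perm_in[OF permutes_inv[OF p] i] permutes_inverses[OF p] by (simp add: g''_def)
            then show ?thesis using B_in[OF g i] B_in[OF h i] by (simp add: m_comm)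
          qed
          then show ?thesis
            unfolding base_mult[OF g xk[unfolded hp]] unfolding base_emb_eq mult_H by (auto simp: fun_eq_iff)
        qed
        finally have "f (?y \<otimes>\<^bsub>H\<^esub> k) = inverse (base_char b g'') * f (x \<otimes>\<^bsub>H\<^esub> k)"
          using right[OF g'' xk] by (simp add: hp)
        moreover have "base_char b g'' = base_char b (\<lambda>i\<in>{1..n}. g' (snd x i))"
        proof -
          define t where "t j = b j (g' (p1 j))" for j
          have "base_char b g'' = (\<Prod>i\<in>{1..n}. t (q i))"
            unfolding base_char_def by (intro prod.cong refl) (simp add: g''_def pq t_def q(2))
          also have "\<dots> = (\<Prod>i\<in>{1..n}. t i)" using prod.permute[OF q(1), of t] by (simp add: o_def)
          finally show ?thesis by (simp add: base_char_def t_def x1)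
        qed
        ultimately show ?thesis by (simp add: m_def)
      qed
      have nm: "cmod m = 1"
      proof -
        have "phase b ?y = m * phase b x" unfolding m_def by (rule phase_base[OF b g x])
        then show ?thesis using norm_phase[OF b y] norm_phase[OF b x] by (simp add: norm_mult)
      qed
      have "\<Phi> ?y = \<Phi> x" unfolding \<Phi>_def by (rule L2_set_cong) (simp_all add: fm norm_mult nm)
      then have "\<phi> x - \<phi> ?y = (1 - m) * (phase b x * complex_of_real (\<Phi> x))"
        using x y phase_base[OF b g x] by (simp add: \<phi>_def m_def algebra_simps)
      then have "cmod (\<phi> x - \<phi> ?y) = cmod (1 - m) * \<Phi> x"
        using norm_phase[OF b x] by (simp add: norm_mult \<Phi>_def)
      also have "\<dots> = L2_set (\<lambda>k. cmod (1 - m) * cmod (f (x \<otimes>\<^bsub>H\<^esub> k))) ?K"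
        unfolding \<Phi>_def by (rule L2_set_right_distrib) simp
      also have "\<dots> = L2_set (\<lambda>k. cmod (f (x \<otimes>\<^bsub>H\<^esub> k) - f (?y \<otimes>\<^bsub>H\<^esub> k))) ?K"
        by (rule L2_set_cong) (simp_all add: fm norm_mult[symmetric] algebra_simps)
      finally show ?thesis unfolding ig by simp
    qed
    have "(\<Sum>h\<in>carrier H. w h * (\<Sum>z\<in>rep_index (Vind b). (cmod (v z - rep_act (Vind b) h v z))\<^sup>2))
       = (\<Sum>h\<in>carrier H. w h * (\<Sum>x\<in>carrier H. (cmod (\<phi> x - \<phi> (inv\<^bsub>H\<^esub> h \<otimes>\<^bsub>H\<^esub> x)))\<^sup>2))"
      unfolding idx by (intro sum.cong refl arg_cong2[of _ _ _ _ "(*)"]) (simp add: Vind_act v_def)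
    also have "\<dots> \<le> (\<Sum>h\<in>carrier H. w h * (\<Sum>x\<in>carrier H. \<Sum>k\<in>?K. D h (x \<otimes>\<^bsub>H\<^esub> k)))"
      by (intro w_sum_mono sum_mono ptwise swap_closed base_emb_closed swap_le base_le) assumption+
    also have "\<dots> = (\<Sum>h\<in>carrier H. real (card ?K) * (w h * (\<Sum>x\<in>carrier H. D h x)))"
      by (intro sum.cong refl) (simp only: sumK mult.left_commute)
    also have "\<dots> = real (card ?K) * (\<Sum>h\<in>carrier H. w h * (\<Sum>x\<in>carrier H. D h x))" by (simp only: sum_distrib_left)
    finally have "(\<Sum>h\<in>carrier H. w h * (\<Sum>z\<in>rep_index (Vind b). (cmod (v z - rep_act (Vind b) h v z))\<^sup>2)) / 2
      \<le> real (card ?K) * ((\<Sum>h\<in>carrier H. w h * (\<Sum>x\<in>carrier H. D h x)) / 2)" by simp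
    then show "(\<Sum>h\<in>carrier H. w h * (\<Sum>z\<in>rep_index (Vind b). (cmod (v z - rep_act (Vind b) h v z))\<^sup>2)) / 2
      \<le> real (card ?K) * (e * (\<Sum>x\<in>carrier H. (cmod (f x))\<^sup>2))" unfolding eD .
  qed
  have K0: "real (card ?K) > 0" using finK card_gt_0_iff[of ?K] K.one_closed by fastforce
  have "v \<noteq> (\<lambda>z. 0)"
  proof
    assume "v = (\<lambda>z. 0)"
    then have "real (card ?K) * (\<Sum>x\<in>carrier H. (cmod (f x))\<^sup>2) = 0" unfolding nv[symmetric] by simp
    then show False using K0 nf by simp
  qed
  then have ne: "fixed_space H (Vind b) \<noteq> rep_space (Vind b)" using vV unfolding fixed0 by blast
  obtain \<mu> where \<mu>: "psi H w (Vind b) = ereal \<mu>"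
    and min: "\<And>u. u \<in> fixed_perp H (Vind b) \<Longrightarrow> \<mu> * (\<Sum>z\<in>rep_index (Vind b). (cmod (u z))\<^sup>2)
      \<le> (\<Sum>h\<in>carrier H. w h * (\<Sum>z\<in>rep_index (Vind b). (cmod (u z - rep_act (Vind b) h u z))\<^sup>2)) / 2"
    using V.psi_attained[where w = w, OF w_inv ne] by blast
  have "v \<in> fixed_perp H (Vind b)" using vV unfolding fixed_perp_def fixed0 by (simp add: rep_inner_def)
  from min[OF this] have "\<mu> * (real (card ?K) * (\<Sum>x\<in>carrier H. (cmod (f x))\<^sup>2)) \<le> e * (real (card ?K) * (\<Sum>x\<in>carrier H. (cmod (f x))\<^sup>2))"
    using en unfolding nv by (simp add: mult.left_commute)
  then have "\<mu> \<le> e" by (rule mult_right_le_imp_le) (use K0 nf in simp)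
  then show "psi H w (Vind b) \<le> ereal e" by (simp add: \<mu>)
qed

end

section \<open>Eigenspaces in the regular representation and the choice of labelling\<close>

lemma (in group) right_translate_eigenfunction:
  fixes w :: "'a \<Rightarrow> real"
  defines "E e \<equiv> {f \<in> fixed_perp G (regular_rep G). galg_act G (regular_rep G) (laplacian G w) f = (\<lambda>x. complex_of_real e * f x)}"
  assumes fin: "finite (carrier G)" and f: "f \<in> E e" and k: "k \<in> carrier G"
  shows "(\<lambda>x. if x \<in> carrier G then f (x \<otimes> k) else 0) \<in> E e"
proof -
  interpret reg: continuous_unitary_rep G "regular_rep G"
    by (intro continuous_unitary_rep_regular group_axioms fin)
  let ?reg = "regular_rep G" and ?g = "\<lambda>x. if x \<in> carrier G then f (x \<otimes> k) else 0"
  have fp: "f \<in> rep_space ?reg" "(\<Sum>x\<in>carrier G. f x) = 0"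
    and ev: "galg_act G ?reg (laplacian G w) f = (\<lambda>x. complex_of_real e * f x)"
    using f by (auto simp: E_def regular_fixed_perp[OF group_axioms])
  have gs: "?g \<in> rep_space ?reg" by (simp add: regular_rep_def)
  have "(\<Sum>x\<in>carrier G. ?g x) = (\<Sum>x\<in>carrier G. f x)"
    by (rule sum.reindex_bij_witness[of _ "\<lambda>x. x \<otimes> inv k" "\<lambda>x. x \<otimes> k"]) (use k in \<open>auto simp: m_assoc\<close>)
  moreover have "galg_act G ?reg (laplacian G w) ?g x = complex_of_real e * ?g x" for x
  proof (cases "x \<in> carrier G")
    case True
    have "galg_act G ?reg (laplacian G w) ?g x = (\<Sum>h\<in>carrier G. complex_of_real (w h) * (f (x \<otimes> k) - f (inv h \<otimes> (x \<otimes> k))))"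
      unfolding reg.galg_act_laplacian[OF gs] using True k by (intro sum.cong refl) (simp add: regular_rep_def m_assoc)
    also have "\<dots> = galg_act G ?reg (laplacian G w) f (x \<otimes> k)"
      unfolding reg.galg_act_laplacian[OF fp(1)] using True k by (simp add: regular_rep_def)
    finally show ?thesis using True by (simp add: ev)
  next
    case False
    then show ?thesis unfolding reg.galg_act_laplacian[OF gs] by (simp add: regular_rep_def)
  qed
  ultimately show ?thesis using gs fp(2) unfolding E_def by (simp add: regular_fixed_perp[OF group_axioms] fun_eq_iff)
qed

lemma (in group) sum_eigenfunctions:
  fixes w :: "'a \<Rightarrow> real" and A :: "'i set"
  defines "E e \<equiv> {f \<in> fixed_perp G (regular_rep G). galg_act G (regular_rep G) (laplacian G w) f = (\<lambda>x. complex_of_real e * f x)}"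
  assumes fin: "finite (carrier G)" and u: "\<And>i. i \<in> A \<Longrightarrow> u i \<in> E e"
  shows "(\<lambda>x. \<Sum>i\<in>A. z i * u i x) \<in> E e"
proof -
  interpret reg: continuous_unitary_rep G "regular_rep G"
    by (intro continuous_unitary_rep_regular group_axioms fin)
  let ?reg = "regular_rep G" and ?L = "galg_act G (regular_rep G) (laplacian G w)"
  have us: "u i \<in> rep_space ?reg" "\<And>v. v \<in> fixed_space G ?reg \<Longrightarrow> rep_inner ?reg (u i) v = 0"
    "?L (u i) = (\<lambda>x. complex_of_real e * u i x)" if "i \<in> A" for i
    using u[OF that] by (auto simp: E_def fixed_perp_def)
  have s: "(\<lambda>x. \<Sum>i\<in>A. z i * u i x) \<in> rep_space ?reg" by (intro reg.sum_closed us)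
  moreover have "rep_inner ?reg (\<lambda>x. \<Sum>i\<in>A. z i * u i x) v = 0" if "v \<in> fixed_space G ?reg" for v
    unfolding reg.inner_sum_left using us(2) that by simp
  moreover have "?L (\<lambda>x. \<Sum>i\<in>A. z i * u i x) x = complex_of_real e * (\<Sum>i\<in>A. z i * u i x)" for x
  proof -
    have "?L (\<lambda>x. \<Sum>i\<in>A. z i * u i x) x
        = (\<Sum>h\<in>carrier G. complex_of_real (w h) * ((\<Sum>i\<in>A. z i * u i x) - (\<Sum>i\<in>A. z i * rep_act ?reg h (u i) x)))"
      unfolding reg.galg_act_laplacian[OF s] by (intro sum.cong refl) (simp add: reg.act_sum us(1))
    also have "\<dots> = (\<Sum>h\<in>carrier G. \<Sum>i\<in>A. z i * (complex_of_real (w h) * (u i x - rep_act ?reg h (u i) x)))"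
      unfolding sum_subtractf[symmetric] sum_distrib_left by (intro sum.cong refl) (simp add: algebra_simps)
    also have "\<dots> = (\<Sum>i\<in>A. z i * ?L (u i) x)"
      by (subst sum.swap) (simp add: reg.galg_act_laplacian us(1) sum_distrib_left)
    also have "\<dots> = complex_of_real e * (\<Sum>i\<in>A. z i * u i x)"
      unfolding sum_distrib_left by (intro sum.cong refl) (simp add: us(3) mult_ac)
    finally show ?thesis .
  qed
  ultimately show ?thesis by (simp add: E_def fixed_perp_def fun_eq_iff)
qed

context wreath_weights
begin

lemma base_emb_mult:
  assumes "g \<in> carrier B" "h \<in> carrier B"
  shows "base_emb n g \<otimes>\<^bsub>H\<^esub> base_emb n h = base_emb n (g \<otimes>\<^bsub>B\<^esub> h)"
  using base_mult[OF assms(1), of h id] base_emb_closed[OF assms(2)] by (simp only: base_emb_eq)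

text \<open>A character of a finite product is the product of its restrictions to the factors; the
  proof enlarges the set of coordinates one at a time.\<close>

lemma base_char_exists:
  assumes mult: "\<And>g h. g \<in> carrier B \<Longrightarrow> h \<in> carrier B \<Longrightarrow> \<beta> (g \<otimes>\<^bsub>B\<^esub> h) = \<beta> g * \<beta> h"
    and nz: "\<And>g. g \<in> carrier B \<Longrightarrow> \<beta> g \<noteq> (0 :: complex)"
  obtains b where "b \<in> {1..n} \<rightarrow> characters G" "\<And>g. g \<in> carrier B \<Longrightarrow> base_char b g = \<beta> g"
proof -
  interpret B: group B by (rule group_B)
  define single where "single i y = (\<lambda>j\<in>{1..n}. if j = i then y else \<one>)" for i y
  have single: "single i y \<in> carrier B" if "y \<in> carrier G" for i y
    using that by (auto simp: single_def)
  have single_mult: "single i (x \<otimes> y) = single i x \<otimes>\<^bsub>B\<^esub> single i y" if "x \<in> carrier G" "y \<in> carrier G" for i x y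
    using that by (auto simp: single_def fun_eq_iff)
  define b where "b i = (\<lambda>y\<in>carrier G. \<beta> (single i y))" for i
  have "b i \<in> characters G" for i
    using mult nz single single_mult by (auto simp: characters_def b_def simp del: mult_product_group carrier_product_group)
  moreover have "base_char b g = \<beta> g" if g: "g \<in> carrier B" for g
  proof -
    have B1: "\<beta> \<one>\<^bsub>B\<^esub> = 1"
      using mult[OF B.one_closed B.one_closed] nz[OF B.one_closed] B.r_one[OF B.one_closed] by simp
    have gi: "g i \<in> carrier G" if "i \<in> {1..n}" for i using B_in[OF g that] .
    have "\<beta> (\<lambda>j\<in>{1..n}. if j \<in> I then g j else \<one>) = (\<Prod>i\<in>I. \<beta> (single i (g i)))" if "I \<subseteq> {1..n}" for I
    proof -
      have "finite I" using that by (rule finite_subset) simp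
      then show ?thesis using that
      proof (induction I)
        case empty
        then show ?case using B1 by (simp add: restrict_def)
      next
        case (insert i I)
        let ?r = "\<lambda>j\<in>{1..n}. if j \<in> I then g j else \<one>"
        have r: "?r \<in> carrier B" using gi by auto
        have i: "i \<in> {1..n}" using insert.prems by simp
        have eq: "(\<lambda>j\<in>{1..n}. if j \<in> insert i I then g j else \<one>) = single i (g i) \<otimes>\<^bsub>B\<^esub> ?r"
        proof
          fix j show "(\<lambda>j\<in>{1..n}. if j \<in> insert i I then g j else \<one>) j = (single i (g i) \<otimes>\<^bsub>B\<^esub> ?r) j"
            using gi[of j] insert.hyps by (cases "j \<in> {1..n}"; cases "j = i"; cases "j \<in> I") (auto simp: single_def)
        qed
        have IH: "\<beta> ?r = (\<Prod>i\<in>I. \<beta> (single i (g i)))" using insert.IH insert.prems by blast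
        show ?case unfolding eq mult[OF single[OF gi[OF i]] r] IH using insert.hyps by simp
      qed
    qed
    from this[of "{1..n}"] have "\<beta> (\<lambda>j\<in>{1..n}. if j \<in> {1..n} then g j else \<one>) = (\<Prod>i\<in>{1..n}. \<beta> (single i (g i)))" by simp
    moreover have "(\<lambda>j\<in>{1..n}. if j \<in> {1..n} then g j else \<one>) = restrict g {1..n}"
      by (rule restrict_ext) simp
    then have "(\<lambda>j\<in>{1..n}. if j \<in> {1..n} then g j else \<one>) = g" by (simp only: B_ext[OF g])
    ultimately have "\<beta> g = (\<Prod>i\<in>{1..n}. \<beta> (single i (g i)))" by (simp only:)
    also have "\<dots> = base_char b g" unfolding base_char_def b_def using gi by (intro prod.cong refl) simp
    finally show ?thesis ..
  qed
  ultimately show ?thesis using that[of b] by blast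
qed

definition label_count :: "(nat \<Rightarrow> 'a \<Rightarrow> complex) \<Rightarrow> ('a \<Rightarrow> complex) \<Rightarrow> nat" where
  "label_count b = (\<lambda>\<psi>\<in>characters G. card {i\<in>{1..n}. b i = \<psi>})"

lemma label_count_multiplicity:
  assumes "b \<in> {1..n} \<rightarrow> characters G"
  shows "label_count b \<in> multiplicity_vectors G n"
proof -
  have "(\<Sum>\<psi>\<in>characters G. card {i\<in>{1..n}. b i = \<psi>}) = (\<Sum>\<psi>\<in>characters G. \<Sum>i\<in>{i\<in>{1..n}. b i = \<psi>}. 1)" by simp
  also have "\<dots> = (\<Sum>i\<in>{1..n}. 1)"
    by (rule sum.group) (use assms finite_characters[OF finG] in auto)
  finally show ?thesis by (simp add: multiplicity_vectors_def label_count_def)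
qed

text \<open>The labelling chosen in \<open>V_rep\<close> agrees with the one found from an
  eigenfunction only in its multiplicities. Equal multiplicities mean equal multisets of labels, and
  these give a permutation relating the two.\<close>

lemma labellings_conjugate:
  assumes "block_labelling G n (label_count b) b'" "b \<in> {1..n} \<rightarrow> characters G"
  obtains p where "p permutes {1..n}" "\<And>i. i \<in> {1..n} \<Longrightarrow> b' i = b (p i)"
proof -
  have b': "b' \<in> {1..n} \<rightarrow> characters G" and card: "\<And>\<psi>. \<psi> \<in> characters G \<Longrightarrow> card {i\<in>{1..n}. b' i = \<psi>} = card {i\<in>{1..n}. b i = \<psi>}"
    using assms(1) by (simp_all add: block_labelling_def label_count_def)
  have "image_mset b' (mset_set {1..n}) = image_mset b (mset_set {1..n})"
  proof (rule multiset_eqI)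
    fix \<psi>
    have c: "count (image_mset r (mset_set {1..n})) \<psi> = card {i\<in>{1..n}. r i = \<psi>}" for r :: "nat \<Rightarrow> 'a \<Rightarrow> complex"
    proof -
      have "count (image_mset r (mset_set {1..n})) \<psi> = (\<Sum>i | i \<in> {1..n} \<and> \<psi> = r i. count (mset_set {1..n}) i)"
        unfolding count_image_mset' by (simp only: finite_atLeastAtMost elem_mset_set)
      also have "\<dots> = (\<Sum>i\<in>{i\<in>{1..n}. r i = \<psi>}. 1)" by (rule sum.cong) auto
      finally show ?thesis by simp
    qed
    show "count (image_mset b' (mset_set {1..n})) \<psi> = count (image_mset b (mset_set {1..n})) \<psi>"
    proof (cases "\<psi> \<in> characters G")
      case False
      then have "{i\<in>{1..n}. b' i = \<psi>} = {}" "{i\<in>{1..n}. b i = \<psi>} = {}" using b' assms(2) by auto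
      then show ?thesis by (simp only: c)
    qed (simp only: c card)
  qed
  then show ?thesis using that by (rule image_mset_eq_implies_permutes[rotated]) auto
qed

lemma V_rep_eq:
  assumes "\<kappa> \<in> multiplicity_vectors G n"
  obtains b where "V_rep G n \<kappa> = Vind b" "block_labelling G n \<kappa> b" "b \<in> {1..n} \<rightarrow> characters G" "unitary_rep H (Vind b)"
proof -
  define b where "b = (SOME b. block_labelling G n \<kappa> b)"
  have n0: "n > 0" using n2 by simp
  have b: "block_labelling G n \<kappa> b" unfolding b_def by (rule someI_ex[OF ex_block_labelling[OF assms n0]])
  have V: "V_rep G n \<kappa> = Vind b" by (simp add: V_rep_def b_def Let_def)
  show ?thesis
    using that[OF V b] b unitary_rep_V_rep[OF group_axioms finG assms n0] by (simp add: V block_labelling_def)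
qed

lemma psi_group_lower_bound:
  "min (psi H w Std) (INF \<kappa>\<in>{\<kappa> \<in> multiplicity_vectors G n. \<not> trivial_rep H (V_rep G n \<kappa>)}. psi H w (V_rep G n \<kappa>)) \<le> psi_group H w"
  (is "min ?S ?V \<le> _")
proof (cases "fixed_space H (regular_rep H) = rep_space (regular_rep H)")
  case True
  then show ?thesis by (simp add: psi_group_def psi_def)
next
  case False
  interpret H: group H by (rule group_H)
  interpret B: group B by (rule group_B)
  interpret reg: continuous_unitary_rep H "regular_rep H"
    by (intro continuous_unitary_rep_regular group_H finite_H)
  let ?L = "galg_act H (regular_rep H) (laplacian H w)"
  obtain e f0 where e: "psi H w (regular_rep H) = ereal e"
    and f0: "f0 \<in> fixed_perp H (regular_rep H)" "f0 \<noteq> (\<lambda>x. 0)" "?L f0 = (\<lambda>x. complex_of_real e * f0 x)"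
    using reg.psi_attained[where w = w, OF w_inv False] by blast
  define E where "E = {f \<in> fixed_perp H (regular_rep H). ?L f = (\<lambda>x. complex_of_real e * f x)}"
  have Esupp: "f x = 0" if "f \<in> E" "x \<notin> carrier H" for f x
  proof -
    have "f \<in> rep_space (regular_rep H)" using that(1) by (simp add: E_def fixed_perp_def)
    then show ?thesis using reg.support[of f x] that(2) by (simp add: regular_rep_def del: split_paired_All)
  qed
  have Eright: "(\<lambda>x. if x \<in> carrier H then f (x \<otimes>\<^bsub>H\<^esub> k) else 0) \<in> E" if "f \<in> E" "k \<in> carrier H" for f k
    using H.right_translate_eigenfunction[OF finite_H, of f w e k] that unfolding E_def by blast
  have Ecomb: "(\<lambda>x. \<Sum>i\<in>A. z i * u i x) \<in> E" if "\<And>i. i \<in> A \<Longrightarrow> u i \<in> E" for A :: "nat set" and z u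
    using H.sum_eigenfunctions[OF finite_H, of A u w e z] that unfolding E_def by blast
  have comm: "s \<otimes>\<^bsub>H\<^esub> t = t \<otimes>\<^bsub>H\<^esub> s" if st: "s \<in> base_emb n ` carrier B" "t \<in> base_emb n ` carrier B" for s t
  proof -
    obtain g h where gh: "s = base_emb n g" "t = base_emb n h" "g \<in> carrier B" "h \<in> carrier B" using st by blast
    have "g \<otimes>\<^bsub>B\<^esub> h = h \<otimes>\<^bsub>B\<^esub> g" using B_in[OF gh(3)] B_in[OF gh(4)] by (auto simp: fun_eq_iff m_comm)
    then show ?thesis using base_emb_mult gh by simp
  qed
  have "\<exists>f\<in>E. f \<noteq> (\<lambda>x. 0) \<and> (\<forall>s\<in>base_emb n ` carrier B. \<exists>z. \<forall>x\<in>carrier H. f (x \<otimes>\<^bsub>H\<^esub> s) = z * f x)"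
  proof (rule H.common_right_eigenfunction[where E = E and ?f0.0 = f0, OF finite_H])
    show "f x = 0" if "f \<in> E" "x \<notin> carrier H" for f x using that by (rule Esupp)
    show "(\<lambda>x. \<Sum>i\<in>A. z i * u i x) \<in> E" if "\<And>i. i \<in> A \<Longrightarrow> u i \<in> E" for A :: "nat set" and z u
      using that by (rule Ecomb)
    show "(\<lambda>x. if x \<in> carrier H then f (x \<otimes>\<^bsub>H\<^esub> k) else 0) \<in> E" if "f \<in> E" "k \<in> carrier H" for f k
      using that by (rule Eright)
    show "f0 \<in> E" "f0 \<noteq> (\<lambda>x. 0)" using f0 by (simp_all add: E_def)
    show "base_emb n ` carrier B \<subseteq> carrier H" using base_emb_closed by blast
  qed (use comm in blast)+
  then obtain f where f: "f \<in> E" "f \<noteq> (\<lambda>x. 0)"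
    and fz: "\<And>g. g \<in> carrier B \<Longrightarrow> \<exists>z. \<forall>x\<in>carrier H. f (x \<otimes>\<^bsub>H\<^esub> base_emb n g) = z * f x" by blast
  obtain z where z: "\<And>g x. g \<in> carrier B \<Longrightarrow> x \<in> carrier H \<Longrightarrow> f (x \<otimes>\<^bsub>H\<^esub> base_emb n g) = z g * f x"
    using fz by metis
  obtain x0 where "f x0 \<noteq> 0" using f(2) by (auto simp: fun_eq_iff simp del: split_paired_All)
  then have x0: "x0 \<in> carrier H" "f x0 \<noteq> 0" using Esupp[OF f(1)] by blast+
  have zm: "z (g \<otimes>\<^bsub>B\<^esub> h) = z g * z h" if gh: "g \<in> carrier B" "h \<in> carrier B" for g h
  proof -
    have "z (g \<otimes>\<^bsub>B\<^esub> h) * f x0 = f (x0 \<otimes>\<^bsub>H\<^esub> base_emb n g \<otimes>\<^bsub>H\<^esub> base_emb n h)"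
      using z[OF B.m_closed[OF gh] x0(1)] x0(1) base_emb_closed gh by (simp only: H.m_assoc base_emb_mult)
    also have "\<dots> = z g * z h * f x0"
      using z[OF gh(2) H.m_closed[OF x0(1) base_emb_closed[OF gh(1)]]] z[OF gh(1) x0(1)] by simp
    finally show ?thesis using x0(2) by simp
  qed
  have "base_emb n \<one>\<^bsub>B\<^esub> = \<one>\<^bsub>H\<^esub>" by (simp add: base_emb_eq one_H)
  then have z1: "z \<one>\<^bsub>B\<^esub> = 1" using z[OF B.one_closed x0(1)] x0 by simp
  have z0: "z g \<noteq> 0" if g: "g \<in> carrier B" for g
    using zm[OF g B.inv_closed[OF g]] z1 B.r_inv[OF g] by (metis mult_zero_left zero_neq_one)
  \<comment> \<open>The inverse matches the convention F (h k) = k^-1 (F h) of the induced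
    representation.\<close>
  obtain b where b: "b \<in> {1..n} \<rightarrow> characters G" and bz: "\<And>g. g \<in> carrier B \<Longrightarrow> base_char b g = inverse (z g)"
    by (rule base_char_exists[of "\<lambda>g. inverse (z g)"]) (use zm z0 in \<open>auto simp del: carrier_product_group mult_product_group\<close>)
  have right: "f (x \<otimes>\<^bsub>H\<^esub> base_emb n g) = inverse (base_char b g) * f x" if "g \<in> carrier B" "x \<in> carrier H" for g x
    using z[OF that] bz[OF that(1)] by simp
  have "min ?S ?V \<le> ereal e"
  proof (cases "\<forall>i\<in>{1..n}. \<forall>y\<in>carrier G. b i y = 1")
    case True
    then have "base_char b g = 1" if "g \<in> carrier B" for g
      unfolding base_char_def using B_in[OF that] by (intro prod.neutral) blast
    then have "?S \<le> ereal e" using f right by (intro std_bound[of f]) (simp_all add: E_def)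
    then show ?thesis by (simp add: min.coboundedI1)
  next
    case False
    then obtain i y where iy: "i \<in> {1..n}" "y \<in> carrier G" "b i y \<noteq> 1" by blast
    let ?\<kappa> = "label_count b"
    have \<kappa>: "?\<kappa> \<in> multiplicity_vectors G n" by (rule label_count_multiplicity[OF b])
    obtain b' where b': "V_rep G n ?\<kappa> = Vind b'" "block_labelling G n ?\<kappa> b'" "b' \<in> {1..n} \<rightarrow> characters G" "unitary_rep H (Vind b')"
      by (rule V_rep_eq[OF \<kappa>])
    obtain p where p: "p permutes {1..n}" "\<And>i. i \<in> {1..n} \<Longrightarrow> b' i = b (p i)"
      by (rule labellings_conjugate[OF b'(2) b]) (rule that)
    define q where "q = inv' p"
    have q: "q permutes {1..n}" unfolding q_def by (rule permutes_inv[OF p(1)])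
    have pq: "p (q j) = j" "q (p j) = j" "inv' q = p" for j
      unfolding q_def using permutes_inverses[OF p(1)] permutes_inv_inv[OF p(1)] by simp_all
    have i': "q i \<in> {1..n}" using perm_in[OF q iy(1)] .
    have b'i: "b' (q i) y \<noteq> 1" using p(2)[OF i'] iy(3) pq by simp
    \<comment> \<open>Translating on the right by q changes the base character of the eigenfunction
      from that of \<open>b\<close> to that of \<open>b'\<close>, the labelling used in
      \<open>V_rep\<close>, and stays in the eigenspace.\<close>
    define f' where "f' = (\<lambda>x. if x \<in> carrier H then f (x \<otimes>\<^bsub>H\<^esub> sym_emb G n q) else 0)"
    have f'E: "f' \<in> E" unfolding f'_def by (rule Eright[OF f(1) sym_emb_closed[OF q]])
    have f'0: "f' \<noteq> (\<lambda>x. 0)"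
    proof -
      have s: "sym_emb G n q \<in> carrier H" by (rule sym_emb_closed[OF q])
      have "f' (x0 \<otimes>\<^bsub>H\<^esub> inv\<^bsub>H\<^esub> (sym_emb G n q)) = f x0"
        using x0(1) s by (simp add: f'_def H.m_assoc)
      then show ?thesis using x0(2) by auto
    qed
    have right': "f' (x \<otimes>\<^bsub>H\<^esub> base_emb n g) = inverse (base_char b' g) * f' x" if g: "g \<in> carrier B" and x: "x \<in> carrier H" for g x
    proof -
      have s: "sym_emb G n q \<in> carrier H" by (rule sym_emb_closed[OF q])
      define h where "h = (\<lambda>j\<in>{1..n}. g (q j))"
      have h: "h \<in> carrier B" using B_in[OF g] perm_in[OF q] unfolding h_def by (auto simp: PiE_iff)
      have "base_emb n g \<otimes>\<^bsub>H\<^esub> sym_emb G n q = sym_emb G n q \<otimes>\<^bsub>H\<^esub> base_emb n h"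
        unfolding base_emb_eq sym_emb_eq mult_H pq(3)
        using B_in[OF g] perm_in[OF p(1)] by (auto simp: fun_eq_iff h_def pq)
      then have "f' (x \<otimes>\<^bsub>H\<^esub> base_emb n g) = f (x \<otimes>\<^bsub>H\<^esub> sym_emb G n q \<otimes>\<^bsub>H\<^esub> base_emb n h)"
        using x s base_emb_closed[OF g] base_emb_closed[OF h] by (simp add: f'_def H.m_assoc)
      also have "\<dots> = inverse (base_char b h) * f' x"
        using right[OF h H.m_closed[OF x s]] x by (simp add: f'_def)
      also have "base_char b h = base_char b' g"
      proof -
        have "base_char b h = (\<Prod>j\<in>{1..n}. b j (g (q j)))" unfolding base_char_def h_def by (intro prod.cong refl) simp
        also have "\<dots> = (\<Prod>j\<in>{1..n}. b (p j) (g j))"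
          using prod.permute[OF p(1), of "\<lambda>j. b j (g (q j))"] by (simp add: o_def pq)
        also have "\<dots> = base_char b' g" unfolding base_char_def using p(2) by (intro prod.cong refl) simp
        finally show ?thesis .
      qed
      finally show ?thesis .
    qed
    note bound = Vind_bound[OF b'(3,4) i' iy(2) b'i, of f' e]
    have "f' \<in> rep_space (regular_rep H)" "?L f' = (\<lambda>x. complex_of_real e * f' x)"
      using f'E by (auto simp: E_def fixed_perp_def)
    then have "\<not> trivial_rep H (V_rep G n ?\<kappa>)" "psi H w (V_rep G n ?\<kappa>) \<le> ereal e"
      unfolding b'(1) using bound f'0 right' by blast+
    then have "?V \<le> ereal e" using \<kappa> by (intro INF_lower2[of ?\<kappa>]) auto
    then show ?thesis by (simp add: min.coboundedI2)
  qed
  then show ?thesis by (simp add: psi_group_def e)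
qed

lemma psi_group_upper_bound:
  "psi_group H w \<le> min (psi H w Std) (INF \<kappa>\<in>{\<kappa> \<in> multiplicity_vectors G n. \<not> trivial_rep H (V_rep G n \<kappa>)}. psi H w (V_rep G n \<kappa>))"
proof (intro min.boundedI INF_greatest)
  interpret std: continuous_unitary_rep H Std by (rule continuous_unitary_rep_std)
  show "psi_group H w \<le> psi H w Std" by (rule std.psi_group_le_psi[where w = w, OF w_inv])
  fix \<kappa> assume "\<kappa> \<in> {\<kappa> \<in> multiplicity_vectors G n. \<not> trivial_rep H (V_rep G n \<kappa>)}"
  then obtain b where b: "V_rep G n \<kappa> = Vind b" "b \<in> {1..n} \<rightarrow> characters G" "unitary_rep H (Vind b)"
    using V_rep_eq by blast
  interpret V: continuous_unitary_rep H "Vind b" using b by (intro continuous_unitary_rep_Vind)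
  show "psi_group H w \<le> psi H w (V_rep G n \<kappa>)" unfolding b(1) by (rule V.psi_group_le_psi[where w = w, OF w_inv])
qed

end

theorem theorem1p3:
  fixes G :: "('a, 'm) monoid_scheme" and n :: nat
    and a :: "nat \<Rightarrow> nat \<Rightarrow> real" and c :: "(nat \<Rightarrow> 'a) \<Rightarrow> real"
    and w :: "'a wr \<Rightarrow> real"
  assumes "comm_group G" and "finite (carrier G)" and "n \<ge> 2"
    and "\<And>i j. 1 \<le> i \<Longrightarrow> i < j \<Longrightarrow> j \<le> n \<Longrightarrow> a i j \<ge> 0"
    and "\<And>g. g \<in> carrier (base_group G n) \<Longrightarrow> c g \<ge> 0"
    and "\<And>g. g \<in> carrier (base_group G n) \<Longrightarrow> c g = c (inv\<^bsub>base_group G n\<^esub> g)"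
    and "w = (\<lambda>x.
           (\<Sum>(i, j)\<in>{(i, j). 1 \<le> i \<and> i < j \<and> j \<le> n}.
              a i j * galg_unit (sym_emb G n (Transposition.transpose i j)) x) +
           (\<Sum>g\<in>carrier (base_group G n). c g * galg_unit (base_emb n g) x))"
  shows "psi_group (wreath G n) w =
    min (psi (wreath G n) w (wreath_std_rep n))
        (INF \<kappa>\<in>{\<kappa> \<in> multiplicity_vectors G n. \<not> trivial_rep (wreath G n) (V_rep G n \<kappa>)}.
           psi (wreath G n) w (V_rep G n \<kappa>))"
proof -
  interpret wreath_weights G n a c w
    using assms by (intro wreath_weights.intro wreath_weights_axioms.intro)
  show ?thesis by (rule antisym[OF psi_group_upper_bound psi_group_lower_bound])
qed

end
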